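(* Let $N\ge1$, $m>0$, $\kappa>0$, $\mathcal V=(\nu_i)\in\mathbb R^N$, and let $(\Theta,\Omega)$ be the global solution of the inertial Kuramoto model with initial data $(\Theta^0,\Omega^0)$. Let $\lambda,\ell$ be reals and $\mathcal A\subset[N]$ with $$\tfrac12<\lambda\le1,\qquad \ell\in\left(0,2\cos^{-1}\left(\tfrac1\lambda-1\right)\right),\qquad|\mathcal A|\ge\lambda N,$$ and let $\eta>0$ be such that $$\xi(m,\kappa,\mathcal V_{\mathcal A},\Omega^0_{\mathcal A},\eta)<\frac\lambda2\sin\ell-(1-\lambda)\sin\frac\ell2 .$$ Assume there is a time $t_1\ge\eta m$ with $\mathcal D(\Theta_{\mathcal A}(t_1))\le\ell$. Write $\delta_{\mathcal C}=2m\mathcal D(\mathcal V_{\mathcal C})+4m\kappa+\frac{\mathcal D(\mathcal V_{\mathcal C})}{\kappa}$ for $\mathcal C\subset[N]$. Then: (1) (Stability of the majority cluster) $\sup_{t\ge t_1}\mathcal D(\Theta_{\mathcal A}(t))\le\ell$ and $$\limsup_{t\to\infty}\mathcal D(\Theta_{\mathcal A}(t))\le\phi_1(\lambda,\delta_{\mathcal A})<\frac{3\pi}{4(2\lambda-1)}\delta_{\mathcal A}.$$ (2) (Partial linear arrangement) If in addition $\delta_{\mathcal A}<\frac{(2\lambda-1)^{3/2}}{\sqrt{2\lambda}}\frac{2-\lambda}{\sqrt{\lambda/2}+(1-\lambda)}$, then for $i,j\in\mathcal A$ with $\nu_i\ge\nu_j$, with $\phi_1=\phi_1(\lambda,\delta_{\mathcal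 A})$, $$\frac{\nu_i-\nu_j}{\kappa}\le\liminf_{t\to\infty}[\theta_i(t)-\theta_j(t)]\le\limsup_{t\to\infty}[\theta_i(t)-\theta_j(t)]\le\frac{\phi_1}{2\sin(\phi_1/2)(\lambda\cos\phi_1-(1-\lambda))}\,\frac{\nu_i-\nu_j}{\kappa}.$$ Now assume in addition that $\mathcal B\subset[N]$ satisfies $\mathcal B\supset\mathcal A$ and $$m\mathcal D(\mathcal V_{\mathcal B})+2m\kappa+\frac{\mathcal D(\mathcal V_{\mathcal B})}{2\kappa}<\frac\lambda2\sin\ell-(1-\lambda)\sin\frac\ell2 .$$ Then: (3) ($\mathcal A$ confines $\mathcal B$) $\sup_{t\ge0}\mathcal D(\Theta_{\mathcal B}(t))<\infty$. In particular, if $\mathcal B=[N]$, then asymptotic phase-locking occurs. (4) (Uniqueness of the maximal majority cluster) There is a unique index set $\mathcal A_{\max}$ with $\mathcal A\subset\mathcal A_{\max}\subset\mathcal B$ having the following properties (a) and (b): (a) After replacing $\theta_i$ by $\theta_i-2k_i\pi$ for suitable integers $k_i$, $i\in\mathcal A_{\max}\setminus\mathcal A$, $$\limsup_{t\to\infty}\mathcal D(\Theta_{\mathcal A_{\max}}(t))\le\phi_1(\lambda,\delta_{\mathcal B}).$$ (b) If $\mathcal A_{\max}\subsetneq\mathcal B$, then (with the translated phases of (a)) $$\liminf_{t\to\infty}\min_{i\in\mathcal B\setminus\mathcal A_{\max},\,k\in\mathbb Z}\mathcal D\big(\Theta_{\mathcal A_{\max}}(t)\cup\{\theta_i(t)-2\pi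 k\}\big)\ge\phi_2(\lambda,\delta_{\mathcal B}),$$ and $$\liminf_{t\to\infty}\min_{i\in\mathcal B\setminus\mathcal A_{\max},\,j\in\mathcal A_{\max},\,k\in\mathbb Z}|\theta_i(t)-2\pi k-\theta_j(t)|\ge\phi_2(\lambda,\delta_{\mathcal B})-\phi_1(\lambda,\delta_{\mathcal B}).$$ Moreover: (c) (Linear arrangement) if in addition $\delta_{\mathcal B}<\frac{(2\lambda-1)^{3/2}}{\sqrt{2\lambda}}\frac{2-\lambda}{\sqrt{\lambda/2}+(1-\lambda)}$, then, after suitable $2\pi$-translations, for $i,j\in\mathcal A_{\max}$ with $\nu_i\ge\nu_j$, with $\phi_1=\phi_1(\lambda,\delta_{\mathcal B})$, $$\frac{\nu_i-\nu_j}{\kappa}\le\liminf_{t\to\infty}[\theta_i(t)-\theta_j(t)]\le\limsup_{t\to\infty}[\theta_i(t)-\theta_j(t)]\le\frac{\phi_1}{2\sin(\phi_1/2)(\lambda\cos\phi_1-(1-\lambda))}\,\frac{\nu_i-\nu_j}{\kappa}.$$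
   Context: $[N]=\{1,\dots,N\}$. The inertial Kuramoto model is the Cauchy problem $$m\ddot\theta_i+\dot\theta_i=\nu_i+\frac\kappa N\sum_{j=1}^N\sin(\theta_j-\theta_i),\quad t>0,\qquad(\theta_i,\dot\theta_i)(0)=(\theta_i^0,\omega_i^0),\quad i\in[N],$$ with real-valued unknowns $\theta_i$ on $[0,\infty)$; it has a unique global solution. $\Theta=(\theta_i)$, $\Omega=\dot\Theta$, $\Theta^0=(\theta_i^0)$, $\Omega^0=(\omega_i^0)$. For $X\in\mathbb R^N$ and $\mathcal C\subset[N]$, $X_{\mathcal C}=(x_i)_{i\in\mathcal C}$. For a finite family of reals $X$, $\mathcal D(X)$ is the maximum of $|x-x'|$ over its members (so $\mathcal D(\Theta_{\mathcal C}\cup\{a\})$ is the diameter of the family $\theta_i$, $i\in\mathcal C$, together with $a$). Asymptotic phase-locking means that $\lim_{t\to\infty}(\theta_i(t)-\theta_j(t))$ exists for all $i,j\in[N]$. For $\mathcal C\subset[N]$ and $\eta>0$, $$\xi(m,\kappa,\mathcal V_{\mathcal C},\Omega^0_{\mathcal C},\eta)=m\mathcal D(\mathcal V_{\mathcal C})+2m\kappa+\frac{\mathcal D(\mathcal V_{\mathcal C})}{2\kappa}+\mathcal D(\Omega^0_{\mathcal C})m\max\{1,\eta\}e^{-\max\{1,\eta\}}+\frac{\mathcal D(\Omega^0_{\mathcal C})}{2\kappa}\frac{e^{-\eta}}{1-e^{-\eta}}.$$ For $\lambda\in(1/2,1]$ let $f_\lambda(\theta)=\lambda\sin\theta-2(1-\lambda)\sin\frac\theta2$.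 On $(0,2\cos^{-1}\frac{1-\lambda}{\lambda})$ it is positive and strictly concave and vanishes at both endpoints. For $0<\delta<\max_{(0,2\cos^{-1}\frac{1-\lambda}{\lambda})}f_\lambda$, let $\phi_1(\lambda,\delta)<\phi_2(\lambda,\delta)$ denote the two roots of $f_\lambda(\theta)=\delta$ in $(0,2\cos^{-1}\frac{1-\lambda}{\lambda})$. *)

theory Defs
  imports "HOL-Analysis.Analysis"
begin

text \<open>
  Oscillators are indexed by \<open>{1..N}\<close>. The diameter of a finite family of reals is the library
  constant \<^const>\<open>diameter\<close> applied to the set of its members; on nonempty finite sets this supremum
  of distances is the maximum of the distances:
\<close>

lemma diameter_finite_eq_Max:
  fixes X :: "real set"
  assumes "finite X" "X \<noteq> {}"
  shows "diameter X = Max {\<bar>x - y\<bar> | x y. x \<in> X \<and> y \<in> X}"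
proof -
  have eq: "{\<bar>x - y\<bar> | x y. x \<in> X \<and> y \<in> X} = (\<lambda>(x, y). dist x y) ` (X \<times> X)"
    by (auto simp: dist_real_def)
  show ?thesis
    unfolding eq diameter_def using assms by (simp add: cSup_eq_Max)
qed

text \<open>
  \<open>\<omega>\<close> is the velocity, i.e. the derivative of \<open>\<theta>\<close> (one-sided at \<open>0\<close>). The second-order equation is
  required for \<open>t > 0\<close>, the initial data are attained continuously.
\<close>

definition inertial_kuramoto ::
  "nat \<Rightarrow> real \<Rightarrow> real \<Rightarrow> (nat \<Rightarrow> real) \<Rightarrow> (nat \<Rightarrow> real) \<Rightarrow> (nat \<Rightarrow> real) \<Rightarrow>
   (nat \<Rightarrow> real \<Rightarrow> real) \<Rightarrow> (nat \<Rightarrow> real \<Rightarrow> real) \<Rightarrow> bool" where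
  "inertial_kuramoto N m \<kappa> \<nu> \<theta>0 \<omega>0 \<theta> \<omega> \<longleftrightarrow>
     (\<forall>i\<in>{1..N}.
        \<theta> i 0 = \<theta>0 i \<and> \<omega> i 0 = \<omega>0 i \<and>
        (\<forall>t\<ge>0. (\<theta> i has_real_derivative \<omega> i t) (at t within {0..})) \<and>
        continuous_on {0..} (\<omega> i) \<and>
        (\<forall>t>0. \<exists>a. (\<omega> i has_real_derivative a) (at t) \<and>
            m * a + \<omega> i t = \<nu> i + \<kappa> / real N * (\<Sum>j=1..N. sin (\<theta> j t - \<theta> i t))))"

definition phase_locking :: "nat \<Rightarrow> (nat \<Rightarrow> real \<Rightarrow> real) \<Rightarrow> bool" where
  "phase_locking N \<theta> \<longleftrightarrow>
     (\<forall>i\<in>{1..N}. \<forall>j\<in>{1..N}. \<exists>L. ((\<lambda>t. \<theta> i t - \<theta> j t) \<longlongrightarrow> L) at_top)"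

text \<open>The set arguments \<open>V\<close> and \<open>W\<close> stand for the families of natural frequencies and of initial
  velocities over an index set.\<close>

definition xi :: "real \<Rightarrow> real \<Rightarrow> real set \<Rightarrow> real set \<Rightarrow> real \<Rightarrow> real" where
  "xi m \<kappa> V W \<eta> =
     m * diameter V + 2 * m * \<kappa> + diameter V / (2 * \<kappa>)
     + diameter W * m * max 1 \<eta> * exp (- max 1 \<eta>)
     + diameter W / (2 * \<kappa>) * (exp (- \<eta>) / (1 - exp (- \<eta>)))"

definition delta :: "real \<Rightarrow> real \<Rightarrow> real set \<Rightarrow> real" where
  "delta m \<kappa> V = 2 * m * diameter V + 4 * m * \<kappa> + diameter V / \<kappa>"

definition f_lam :: "real \<Rightarrow> real \<Rightarrow> real" where
  "f_lam lam x = lam * sin x - 2 * (1 - lam) * sin (x / 2)"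

text \<open>For \<open>1/2 < lam \<le> 1\<close> and \<open>0 < d < max f_lam\<close> this set has exactly two elements, by strict
  concavity, so \<open>phi1\<close> and \<open>phi2\<close> below are the smaller and the larger root.\<close>

definition f_roots :: "real \<Rightarrow> real \<Rightarrow> real set" where
  "f_roots lam d = {x \<in> {0<..<2 * arccos ((1 - lam) / lam)}. f_lam lam x = d}"

definition phi1 :: "real \<Rightarrow> real \<Rightarrow> real" where
  "phi1 lam d = Min (f_roots lam d)"

definition phi2 :: "real \<Rightarrow> real \<Rightarrow> real" where
  "phi2 lam d = Max (f_roots lam d)"

definition arrangement_threshold :: "real \<Rightarrow> real" where
  "arrangement_threshold lam =
     (2 * lam - 1) powr (3 / 2) / sqrt (2 * lam) * ((2 - lam) / (sqrt (lam / 2) + (1 - lam)))"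

definition linearly_arranged ::
  "real \<Rightarrow> (nat \<Rightarrow> real) \<Rightarrow> real \<Rightarrow> real \<Rightarrow> (nat \<Rightarrow> real \<Rightarrow> real) \<Rightarrow> nat set \<Rightarrow> bool" where
  "linearly_arranged \<kappa> \<nu> lam phi \<theta> C \<longleftrightarrow>
     (\<forall>i\<in>C. \<forall>j\<in>C. \<nu> i \<ge> \<nu> j \<longrightarrow>
        ereal ((\<nu> i - \<nu> j) / \<kappa>) \<le> Liminf at_top (\<lambda>t. ereal (\<theta> i t - \<theta> j t)) \<and>
        Liminf at_top (\<lambda>t. ereal (\<theta> i t - \<theta> j t)) \<le> Limsup at_top (\<lambda>t. ereal (\<theta> i t - \<theta> j t)) \<and>
        Limsup at_top (\<lambda>t. ereal (\<theta> i t - \<theta> j t)) \<le>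
          ereal (phi / (2 * sin (phi / 2) * (lam * cos phi - (1 - lam))) * ((\<nu> i - \<nu> j) / \<kappa>)))"

definition translate :: "(nat \<Rightarrow> int) \<Rightarrow> (nat \<Rightarrow> real \<Rightarrow> real) \<Rightarrow> nat \<Rightarrow> real \<Rightarrow> real" where
  "translate k \<theta> i t = \<theta> i t - 2 * of_int (k i) * pi"

text \<open>
  \<open>M\<close> is a maximal majority cluster between \<open>A\<close> and \<open>B\<close>, witnessed by the integer translations \<open>k\<close>;
  \<open>d\<close> is the level at which \<open>phi1\<close> and \<open>phi2\<close> are taken. Phases in \<open>A\<close> are not translated. Translating
  the phases outside \<open>M\<close> is immaterial since the infima range over all \<open>n \<in> \<int>\<close>; these infima, written as
  minima on paper, are attained because the quantities tend to infinity as \<open>\<bar>n\<bar> \<rightarrow> \<infinity>\<close>.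
\<close>

definition maximal_majority_cluster ::
  "real \<Rightarrow> real \<Rightarrow> (nat \<Rightarrow> real \<Rightarrow> real) \<Rightarrow> nat set \<Rightarrow> nat set \<Rightarrow> (nat \<Rightarrow> int) \<Rightarrow> nat set \<Rightarrow> bool" where
  "maximal_majority_cluster lam d \<theta> A B k M \<longleftrightarrow>
     A \<subseteq> M \<and> M \<subseteq> B \<and> (\<forall>i\<in>A. k i = 0) \<and>
     Limsup at_top (\<lambda>t. ereal (diameter ((\<lambda>i. translate k \<theta> i t) ` M))) \<le> ereal (phi1 lam d) \<and>
     (M \<noteq> B \<longrightarrow>
        ereal (phi2 lam d) \<le>
          Liminf at_top (\<lambda>t. INF i\<in>B - M. INF n\<in>(UNIV :: int set).
            ereal (diameter (insert (\<theta> i t - 2 * pi * of_int n) ((\<lambda>j. translate k \<theta> j t) ` M)))) \<and>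
        ereal (phi2 lam d - phi1 lam d) \<le>
          Liminf at_top (\<lambda>t. INF i\<in>B - M. INF j\<in>M. INF n\<in>(UNIV :: int set).
            ereal \<bar>\<theta> i t - 2 * pi * of_int n - translate k \<theta> j t\<bar>))"

end

theory Submission
  imports Defs "HOL-Complex_Analysis.Conformal_Mappings"
begin

text \<open>
  The second-order equation says that velocities are an exponentially fading average, with memory
  time \<open>m\<close>, of the forces that drive the first-order Kuramoto model. For the first-order model the
  argument would be short: if \<open>p\<close> and \<open>q\<close> carry the largest and the smallest phase of a cluster
  with at least \<open>lam N\<close> members and diameter \<open>x\<close>, then every member pulls them together and the
  remaining oscillators pull them apart as strongly as they can, so \<open>\<theta> p - \<theta> q\<close> has derivative at
  most \<open>\<nu> p - \<nu> q - \<kappa> f_lam lam x\<close>, and the diameter cannot stay where \<open>f_lam\<close> exceeds the spread of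
  natural frequencies over \<open>\<kappa>\<close>. With inertia the forces of the past have to be compared with those of
  the present. Differences of velocities within a cluster stay bounded by its frequency spread plus
  \<open>2 \<kappa>\<close>, up to a transient \<open>exp (- t / m)\<close>; this controls how far phase differences have moved in
  the past, and the weighted error is exactly what \<open>xi\<close> and \<open>delta\<close> charge for. The outcome is
  \<open>velocity_diff_estimate\<close>: for \<open>t \<ge> \<eta> m\<close> the extreme pair approaches as soon as
  \<open>f_lam lam x\<close> exceeds \<open>2 xi\<close>, and asymptotically as soon as it exceeds \<open>delta\<close>. A barrier argument
  for the maximum of finitely many differentiable functions turns this into \<open>cluster_stays\<close> and
  \<open>cluster_contracts\<close>: a cluster of diameter at most \<open>l\<close> keeps that bound and shrinks to \<open>phi1\<close>.

  Linear arrangement: for two members \<open>i\<close>, \<open>j\<close> of an asymptotically small cluster, the difference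
  \<open>x = \<theta> i - \<theta> j\<close> solves \<open>m x'' + x' + a(t) x = \<nu> i - \<nu> j\<close>, with \<open>a(t)\<close> between two explicit
  positive constants. The hypotheses force \<open>4 m \<kappa> < 1\<close>, so the equation is overdamped: in the
  coordinates \<open>x\<close> and \<open>x + 2 m x'\<close> it is a cooperative system, and comparison with the constant
  solutions for the extreme values of \<open>a\<close> gives both bounds (\<open>linear_arrangement\<close>).

  Confinement: \<open>A\<close> together with one oscillator \<open>i\<close>, shifted by a multiple of \<open>2 \<pi>\<close>, is again a
  majority cluster. If \<open>\<theta> i\<close> ever meets a phase of \<open>A\<close> modulo \<open>2 \<pi>\<close> at a late time, it is captured and
  stays close to \<open>A\<close>; otherwise it never passes such a phase and is trapped between two of
  its translates. In both cases \<open>\<theta> i\<close> remains at bounded distance from \<open>A\<close>. The maximal cluster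
  consists of all captured oscillators. That their union has diameter at most \<open>phi1\<close> in the limit,
  although two of them are a priori only known to be within \<open>2 phi1\<close> of each other, is a second
  contraction argument: two extreme members more than \<open>phi1\<close> apart leave \<open>A\<close> in a short interval
  between them, whose pull is even stronger than in the first argument
  (\<open>union_of_clusters_contracts\<close>). The same lemma gives uniqueness. With an oscillator that is not
  captured, the diameter is asymptotically at least \<open>phi2\<close>, because \<open>l\<close> may be replaced by any number
  between \<open>phi1\<close> and \<open>phi2\<close> in the capture argument.

  Phase-locking: once phase differences are bounded, the energy is bounded below and decreases at the
  rate \<open>\<Sum> (\<omega> i - mean)\<^sup>2\<close>, so all forces equalise by Barbalat's lemma. That the phases converge
  rests on the mean-field form of the coupling. With \<open>r\<close> the modulus of the order parameter, the sines
  of the phases relative to the order parameter are asymptotically determined by \<open>r\<close>, and every value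
  that \<open>r\<close> takes at arbitrarily late times solves one of finitely many analytic equations
  \<open>N r\<^sup>2 = \<Sum> \<plusminus> sqrt (r\<^sup>2 - \<sigma> i\<^sup>2)\<close>. These have only isolated solutions, so \<open>r\<close> converges, and
  with it all relative phases; the majority cluster keeps \<open>r\<close> away from \<open>0\<close>.
\<close>

section \<open>The coupling function and its roots\<close>

lemma f_lam_factor:
  "f_lam lam x = 2 * sin (x/2) * (lam * cos (x/2) - (1 - lam))"
proof -
  have "sin x = 2 * sin (x/2) * cos (x/2)" using sin_double[of "x/2"] by simp
  thus ?thesis by (simp add: f_lam_def algebra_simps)
qed

text \<open>The graph of the sine over \<open>[0, \<pi>]\<close> lies above its chords through the origin.\<close>
lemma sin_chord:
  fixes y Y :: real
  assumes "0 \<le> y" "y \<le> Y" "Y \<le> pi"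
  shows "y * sin Y \<le> Y * sin y"
proof (cases "0 < y \<and> y < Y")
  case True
  obtain u where u: "0 < u" "u < y" "sin y - sin 0 = (y - 0) * cos u"
    using MVT2[of 0 y sin cos] True by (auto intro: DERIV_sin)
  obtain v where v: "y < v" "v < Y" "sin Y - sin y = (Y - y) * cos v"
    using MVT2[of y Y sin cos] True by (auto intro: DERIV_sin)
  have "cos v \<le> cos u" using u v assms by (intro cos_monotone_0_pi_le) auto
  hence "(y * (Y - y)) * cos v \<le> (y * (Y - y)) * cos u"
    using True by (intro mult_left_mono) auto
  moreover have "sin y = y * cos u" "sin Y = y * cos u + (Y - y) * cos v"
    using u v by auto
  moreover have "Y * sin y - y * sin Y = y * (Y - y) * cos u - y * (Y - y) * cos v"
    if "sin y = y * cos u" "sin Y = y * cos u + (Y - y) * cos v"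
    unfolding that by (simp add: algebra_simps)
  ultimately show ?thesis by linarith
qed (use assms in \<open>auto simp: le_less\<close>)

locale majority_coupling =
  fixes lam :: real
  assumes lam_gt_half: "1/2 < lam" and lam_le_1: "lam \<le> 1"
begin

text \<open>The second zero of \<open>f_lam\<close>, where the pull of the majority just balances the rest.\<close>
definition cutoff :: real where "cutoff = 2 * arccos ((1 - lam) / lam)"

lemma ratio_bounds: "0 \<le> (1 - lam) / lam" "(1 - lam) / lam < 1"
  using lam_gt_half lam_le_1 by (auto simp: field_simps)

lemma cutoff_bounds: "0 < cutoff" "cutoff \<le> pi"
proof -
  have "arccos 1 < arccos ((1 - lam) / lam)"
    using ratio_bounds by (intro arccos_less_arccos) auto
  thus "0 < cutoff" by (simp add: cutoff_def)
  have "arccos ((1 - lam) / lam) \<le> pi/2"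
    using ratio_bounds by (intro arccos_le_pi2) auto
  thus "cutoff \<le> pi" by (simp add: cutoff_def)
qed

lemma cos_half_gt:
  assumes "0 \<le> x" "x < cutoff"
  shows "1 - lam < lam * cos (x/2)"
proof -
  have "cos (arccos ((1 - lam) / lam)) < cos (x/2)"
    using assms cutoff_bounds by (intro cos_monotone_0_pi) (auto simp: cutoff_def)
  moreover have "cos (arccos ((1 - lam) / lam)) = (1 - lam) / lam"
    using ratio_bounds by (intro cos_arccos) auto
  ultimately show ?thesis using lam_gt_half by (simp add: field_simps)
qed

lemma f_lam_zero: "f_lam lam 0 = 0" and f_lam_cutoff: "f_lam lam cutoff = 0"
proof -
  have "cos (arccos ((1 - lam) / lam)) = (1 - lam) / lam"
    using ratio_bounds by (intro cos_arccos) auto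
  thus "f_lam lam cutoff = 0"
    using lam_gt_half by (simp add: f_lam_factor cutoff_def)
qed (simp add: f_lam_def)

definition f_lam' :: "real \<Rightarrow> real" where
  "f_lam' x = lam * cos x - (1 - lam) * cos (x/2)"

lemma f_lam_deriv: "(f_lam lam has_real_derivative f_lam' x) (at x within S)"
  unfolding f_lam_def[abs_def] f_lam'_def
  by (auto intro!: derivative_eq_intros)

lemma continuous_f_lam: "continuous_on S (f_lam lam)"
  using f_lam_deriv DERIV_continuous_on by blast

lemma f_lam'_strict_antimono:
  assumes "0 \<le> x" "x < y" "y \<le> cutoff"
  shows "f_lam' y < f_lam' x"
proof (rule DERIV_neg_imp_decreasing_open[OF assms(2)])
  fix z assume z: "x < z" "z < y"
  have s: "sin (z/2) > 0" using z assms cutoff_bounds by (intro sin_gt_zero) auto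
  have c: "1 - lam < lam * cos (z/2)" using z assms by (intro cos_half_gt) auto
  have "sin z = 2 * sin (z/2) * cos (z/2)" using sin_double[of "z/2"] by simp
  hence eq: "- lam * sin z + (1 - lam) / 2 * sin (z/2)
      = sin (z/2) * (- 2 * (lam * cos (z/2)) + (1 - lam) / 2)" by (simp add: algebra_simps)
  have "(f_lam' has_real_derivative (- lam * sin z + (1 - lam) / 2 * sin (z/2))) (at z)"
    unfolding f_lam'_def[abs_def] by (auto intro!: derivative_eq_intros)
  moreover have "sin (z/2) * (- 2 * (lam * cos (z/2)) + (1 - lam) / 2) < 0"
    using s c lam_le_1 by (intro mult_pos_neg) auto
  ultimately show "\<exists>d. (f_lam' has_real_derivative d) (at z) \<and> d < 0" using eq by auto
qed (auto simp: f_lam'_def[abs_def] intro!: continuous_intros)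

lemma f_lam_mvt:
  assumes "x < y"
  shows "\<exists>z. x < z \<and> z < y \<and> f_lam lam y - f_lam lam x = (y - x) * f_lam' z"
  using MVT2[OF assms f_lam_deriv] by auto

text \<open>The form in which strict concavity is used: once \<open>f_lam\<close> fails to increase it decreases
  strictly. This locates all solutions of \<open>f_lam lam x = d\<close> relative to two of them.\<close>
lemma f_lam_chord:
  assumes "0 \<le> x" "x < y" "y < z" "z \<le> cutoff"
  shows "f_lam lam y - f_lam lam x \<le> 0 \<Longrightarrow> f_lam lam z - f_lam lam y < 0"
proof -
  assume le: "f_lam lam y - f_lam lam x \<le> 0"
  obtain u where u: "x < u" "u < y" "f_lam lam y - f_lam lam x = (y - x) * f_lam' u"
    using f_lam_mvt[OF assms(2)] by auto
  obtain v where v: "y < v" "v < z" "f_lam lam z - f_lam lam y = (z - y) * f_lam' v"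
    using f_lam_mvt[OF assms(3)] by auto
  have "f_lam' u \<le> 0" using u le assms by (auto simp: mult_le_0_iff)
  hence "f_lam' v < 0" using f_lam'_strict_antimono[of u v] u v assms by simp
  thus ?thesis using v assms by (simp add: mult_less_0_iff)
qed

lemma phi_props:
  assumes l: "0 < l" "l < cutoff" and d: "0 < d" "d < f_lam lam l"
  shows "0 < phi1 lam d" "phi1 lam d < l" "l < phi2 lam d" "phi2 lam d < cutoff"
    "f_lam lam (phi1 lam d) = d" "f_lam lam (phi2 lam d) = d"
    "\<And>x. phi1 lam d < x \<Longrightarrow> x < phi2 lam d \<Longrightarrow> d < f_lam lam x"
proof -
  have "\<exists>a. 0 \<le> a \<and> a \<le> l \<and> f_lam lam a = d"
    using d l by (intro IVT' continuous_f_lam) (auto simp: f_lam_zero)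
  then obtain a where a: "0 \<le> a" "a \<le> l" "f_lam lam a = d" by blast
  have "\<exists>b. l \<le> b \<and> b \<le> cutoff \<and> f_lam lam b = d"
    using d l by (intro IVT2' continuous_f_lam) (auto simp: f_lam_cutoff)
  then obtain b where b: "l \<le> b" "b \<le> cutoff" "f_lam lam b = d" by blast
  have a': "0 < a" "a < l" using a d f_lam_zero by (auto simp: less_le)
  have b': "l < b" "b < cutoff" using b d f_lam_cutoff by (auto simp: less_le)
  have between: "d < f_lam lam x" if "a < x" "x < b" for x
    using f_lam_chord[of a x b] a a' b b' that by fastforce
  have left: "f_lam lam x < d" if "0 < x" "x < a" for x
    using f_lam_chord[of x a l] a a' l d that by fastforce
  have right: "f_lam lam x < d" if "b < x" "x < cutoff" for x
    using f_lam_chord[of l b x] b b' l d that by fastforce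
  have "f_roots lam d = {a, b}"
  proof (intro equalityI subsetI)
    fix x assume "x \<in> f_roots lam d"
    hence x: "0 < x" "x < cutoff" "f_lam lam x = d"
      by (auto simp: f_roots_def cutoff_def)
    show "x \<in> {a, b}"
      using between[of x] left[of x] right[of x] x by fastforce
  qed (use a a' b b' in \<open>auto simp: f_roots_def cutoff_def\<close>)
  hence "phi1 lam d = a" "phi2 lam d = b" using a' b' by (auto simp: phi1_def phi2_def)
  thus "0 < phi1 lam d" "phi1 lam d < l" "l < phi2 lam d" "phi2 lam d < cutoff"
    "f_lam lam (phi1 lam d) = d" "f_lam lam (phi2 lam d) = d"
    "\<And>x. phi1 lam d < x \<Longrightarrow> x < phi2 lam d \<Longrightarrow> d < f_lam lam x"
    using a a' b b' between by auto
qed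

lemma f_lam'_phi1_pos:
  assumes "0 < l" "l < cutoff" "0 < d" "d < f_lam lam l"
  shows "0 < f_lam' (phi1 lam d)"
proof -
  note P = phi_props[OF assms]
  obtain v where v: "phi1 lam d < v" "v < l"
      "f_lam lam l - f_lam lam (phi1 lam d) = (l - phi1 lam d) * f_lam' v"
    using f_lam_mvt[OF P(2)] by auto
  have "0 < (l - phi1 lam d) * f_lam' v" using v P(5) assms(4) by linarith
  hence "0 < f_lam' v" using v by (simp add: zero_less_mult_iff)
  thus ?thesis using f_lam'_strict_antimono[of "phi1 lam d" v] v P assms by simp
qed

lemma phi1_less_pi_half:
  assumes "0 < l" "l < cutoff" "0 < d" "d < f_lam lam l"
  shows "phi1 lam d < pi/2"
proof (rule ccontr)
  note P = phi_props[OF assms]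
  assume "\<not> phi1 lam d < pi/2"
  hence "cos (phi1 lam d) \<le> cos (pi/2)"
    using P cutoff_bounds assms by (intro cos_monotone_0_pi_le) auto
  moreover have "0 \<le> cos (phi1 lam d / 2)"
    using P cutoff_bounds assms by (intro cos_ge_zero) auto
  hence "0 \<le> (1 - lam) * cos (phi1 lam d / 2)" using lam_le_1 by simp
  ultimately have "f_lam' (phi1 lam d) \<le> 0"
    using lam_gt_half mult_nonneg_nonpos[of lam "cos (phi1 lam d)"] by (simp add: f_lam'_def)
  thus False using f_lam'_phi1_pos[OF assms] by simp
qed

text \<open>The smaller root lies where \<open>f_lam\<close> still increases. With \<open>c = cos (\<phi>/2)\<close>, positivity of the
  derivative is the quadratic inequality \<open>lam (2 c\<^sup>2 - 1) > (1 - lam) c\<close>, which forces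
  \<open>c > (1 + lam) / (3 lam)\<close>: at equality the quadratic expression is \<open>- (2 lam - 1)\<^sup>2 / (9 lam)\<close>. Hence the factor
  \<open>lam c - (1 - lam)\<close> of \<open>f_lam\<close> exceeds \<open>(2/3) (2 lam - 1)\<close>, and the sine is bounded below by a chord.\<close>
lemma phi1_linear_bound:
  assumes "0 < l" "l < cutoff" "0 < d" "d < f_lam lam l"
  shows "phi1 lam d < 3 * pi / (4 * (2 * lam - 1)) * d"
proof -
  note P = phi_props[OF assms]
  define p where "p = phi1 lam d"
  define c where "c = cos (p/2)"
  have p: "0 < p" "p < pi/2" using P phi1_less_pi_half[OF assms] by (auto simp: p_def)
  have c0: "0 < c" unfolding c_def using p by (intro cos_gt_zero_pi) auto
  have "cos p = 2 * c\<^sup>2 - 1" using cos_double_cos[of "p/2"] by (simp add: c_def)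
  hence der: "0 < lam * (2 * c\<^sup>2 - 1) - (1 - lam) * c"
    using f_lam'_phi1_pos[OF assms] by (simp add: f_lam'_def p_def c_def)
  have ge: "1 + lam < 3 * lam * c"
  proof (rule ccontr)
    assume "\<not> 1 + lam < 3 * lam * c"
    hence le: "3 * lam * c \<le> 1 + lam" by simp
    have "9 * lam * (lam * (2 * c\<^sup>2 - 1) - (1 - lam) * c)
        = 3 * lam * c * (2 * (3 * lam * c) - 3 * (1 - lam)) - 9 * lam\<^sup>2"
      by (simp add: algebra_simps power2_eq_square)
    also have "\<dots> \<le> (1 + lam) * (2 * (1 + lam) - 3 * (1 - lam)) - 9 * lam\<^sup>2"
    proof -
      have "3 * lam * c * (2 * (3 * lam * c) - 3 * (1 - lam))
          \<le> 3 * lam * c * (2 * (1 + lam) - 3 * (1 - lam))"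
        using le c0 lam_gt_half by (intro mult_left_mono) auto
      also have "\<dots> \<le> (1 + lam) * (2 * (1 + lam) - 3 * (1 - lam))"
        using le lam_gt_half by (intro mult_right_mono) auto
      finally show ?thesis by simp
    qed
    also have "\<dots> = - ((2 * lam - 1)\<^sup>2)" by (simp add: algebra_simps power2_eq_square)
    also have "\<dots> \<le> 0" by simp
    finally show False using der lam_gt_half by (simp add: mult_le_0_iff)
  qed
  have "2 / pi * (p/2) \<le> sin (p/2)"
  proof -
    have "p/2 * sin (pi/2) \<le> pi/2 * sin (p/2)"
      using p by (intro sin_chord) auto
    thus ?thesis by (simp add: field_simps)
  qed
  hence "p / pi * (2/3 * (2 * lam - 1)) < sin (p/2) * (lam * c - (1 - lam))"
    using ge p lam_gt_half by (intro mult_le_less_imp_less) auto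
  moreover have "d = 2 * sin (p/2) * (lam * c - (1 - lam))"
    using P by (simp add: f_lam_factor p_def c_def)
  ultimately have "2 * (p / pi * (2/3 * (2 * lam - 1))) < d" by linarith
  hence "p / pi * (4/3 * (2 * lam - 1)) < d" by (simp add: mult_ac)
  hence "p < d / (4/3 * (2 * lam - 1) / pi)"
    using lam_gt_half by (simp add: field_simps)
  thus ?thesis using lam_gt_half by (simp add: p_def field_simps)
qed

text \<open>Half the cutoff is the angle with cosine \<open>(1 - lam) / lam\<close>. In a cluster of smaller diameter every
  pair of members is attracted, not only the extreme one; a level below the threshold keeps \<open>phi1\<close>
  below this angle.\<close>
lemma arrangement_threshold_eq: "arrangement_threshold lam = f_lam lam (cutoff / 2)"
proof -
  define b where "b = cutoff / 2"
  have cb: "cos b = (1 - lam) / lam" unfolding b_def cutoff_def using ratio_bounds by (simp add: cos_arccos)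
  have b: "0 < b" "b \<le> pi/2" using cutoff_bounds by (auto simp: b_def)
  have sb0: "sin b > 0" "sin (b/2) > 0" using b by (auto intro!: sin_gt_zero)
  define w where "w = sqrt (2 * lam - 1)"
  define v where "v = sqrt (2 * lam)"
  have w: "w > 0" "w\<^sup>2 = 2 * lam - 1" and v: "v > 0" "v\<^sup>2 = 2 * lam" using lam_gt_half by (auto simp: w_def v_def)
  have "(sin b)\<^sup>2 = (w / lam)\<^sup>2"
    unfolding sin_squared_eq cb power_divide w using lam_gt_half
    by (simp add: field_simps power2_eq_square)
  hence sb: "sin b = w / lam" using sb0 w lam_gt_half by (subst (asm) power2_eq_iff_nonneg) auto
  have "(sin (b/2))\<^sup>2 = (1 - cos b) / 2" using cos_double_sin[of "b/2"] by simp
  also have "\<dots> = (w / v)\<^sup>2"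
    unfolding power_divide w v cb using lam_gt_half by (simp add: field_simps)
  finally have "(sin (b/2))\<^sup>2 = (w / v)\<^sup>2" .
  hence sb2: "sin (b/2) = w / v" using sb0 w v by (subst (asm) power2_eq_iff_nonneg) auto
  have "v - 2 * (1 - lam) = (2 * lam - 1) * (2 - lam) / (v / 2 + (1 - lam))"
    using v lam_gt_half lam_le_1
    by (simp add: field_simps add_pos_nonneg add_eq_0_iff power2_eq_square)
  moreover have "f_lam lam b = w / v * (v - 2 * (1 - lam))"
    using lam_gt_half v by (simp add: f_lam_def sb sb2 field_simps)
  moreover have "(2 * lam - 1) powr (3/2) = w * (2 * lam - 1)"
  proof -
    have "(2 * lam - 1) powr (3/2) = (2 * lam - 1) powr (1/2 + 1)" by simp
    also have "\<dots> = w * (2 * lam - 1)"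
      using lam_gt_half by (subst powr_add) (simp add: w_def powr_half_sqrt)
    finally show ?thesis .
  qed
  moreover have sq: "sqrt (lam / 2) = v / 2"
    using lam_gt_half v by (intro real_sqrt_unique) (auto simp: power_divide)
  ultimately show ?thesis
    unfolding arrangement_threshold_def v_def[symmetric] b_def[symmetric] sq by simp
qed

lemma arrangement_threshold_le_1: "arrangement_threshold lam \<le> 1"
proof -
  have "0 \<le> sin (cutoff / 2 / 2)" using cutoff_bounds by (intro sin_ge_zero) auto
  hence "f_lam lam (cutoff / 2) \<le> lam * sin (cutoff / 2)" 
    using lam_le_1 by (simp add: f_lam_def)
  also have "\<dots> \<le> lam * 1" using lam_gt_half by (intro mult_left_mono) auto
  finally show ?thesis using lam_le_1 by (simp add: arrangement_threshold_eq)
qed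

lemma phi1_below_threshold:
  assumes "0 < d" "d < arrangement_threshold lam"
  shows "phi1 lam d < cutoff / 2"
  using phi_props(2)[of "cutoff / 2" d] assms cutoff_bounds by (simp add: arrangement_threshold_eq)

end

section \<open>Barriers for maxima of finitely many functions\<close>

text \<open>If the largest of finitely many functions can touch the barrier \<open>b\<close> only with smaller slope, it
  cannot cross: at the infimum \<open>s\<close> of the times of violation no function exceeds \<open>b\<close>, and those that
  touch \<open>b\<close> fall below it immediately afterwards.\<close>
lemma barrier:
  fixes x x' :: "'i \<Rightarrow> real \<Rightarrow> real" and b b' :: "real \<Rightarrow> real"
  assumes fin: "finite P"
    and x: "\<And>p t. p \<in> P \<Longrightarrow> T \<le> t \<Longrightarrow> t \<le> S \<Longrightarrow> (x p has_real_derivative x' p t) (at t)"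
    and b: "\<And>t. T \<le> t \<Longrightarrow> t \<le> S \<Longrightarrow> (b has_real_derivative b' t) (at t)"
    and start: "\<And>p. p \<in> P \<Longrightarrow> x p T \<le> b T"
    and touch: "\<And>p t. p \<in> P \<Longrightarrow> T \<le> t \<Longrightarrow> t < S \<Longrightarrow> x p t = b t \<Longrightarrow> (\<And>q. q \<in> P \<Longrightarrow> x q t \<le> x p t)
        \<Longrightarrow> x' p t < b' t"
    and p: "p \<in> P" and t: "T \<le> t" "t \<le> S"
  shows "x p t \<le> b t"
proof (rule ccontr)
  define V where "V = {u \<in> {T..t}. \<exists>q\<in>P. x q u > b u}"
  define s where "s = Inf V"
  assume "\<not> x p t \<le> b t"
  hence tV: "t \<in> V" using p t by (auto simp: V_def not_le intro!: bexI[of _ p])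
  have bdd: "bdd_below V" by (auto simp: V_def intro!: bdd_belowI[of _ T])
  have s: "T \<le> s" "s \<le> t"
  proof -
    show "T \<le> s" unfolding s_def using tV by (intro cInf_greatest) (auto simp: V_def)
    show "s \<le> t" unfolding s_def using tV bdd by (intro cInf_lower)
  qed
  have before: "x q u \<le> b u" if "q \<in> P" "T \<le> u" "u < s" for q u
  proof (rule ccontr)
    assume "\<not> x q u \<le> b u"
    hence "u \<in> V" using that s by (auto simp: V_def not_le intro!: bexI[of _ q])
    hence "s \<le> u" unfolding s_def using bdd by (intro cInf_lower)
    thus False using that by simp
  qed
  have isC: "isCont (x q) s" if "q \<in> P" for q
    using x[of q s] that s t by (auto intro: DERIV_isCont)
  have isCb: "isCont b s" using b[of s] s t by (auto intro: DERIV_isCont)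
  have at_s: "x q s \<le> b s" if q: "q \<in> P" for q
  proof (cases "s = T")
    case False
    hence "T < s" using s by simp
    have "eventually (\<lambda>u. u \<in> {T<..<s}) (at_left s)"
      using \<open>T < s\<close> by (intro eventually_at_left_real)
    hence "eventually (\<lambda>u. x q u \<le> b u) (at_left s)"
      by eventually_elim (use before q in auto)
    moreover have "(x q \<longlongrightarrow> x q s) (at_left s)" "(b \<longlongrightarrow> b s) (at_left s)"
      using isC[OF q] isCb by (auto simp: isCont_def intro: tendsto_within_subset)
    ultimately show ?thesis using tendsto_le[of "at_left s" b "b s" "x q" "x q s"] by simp
  qed (use start q in auto)
  have "s < t"
  proof -
    have "s \<noteq> t" using at_s tV by (force simp: V_def)
    thus ?thesis using s by simp
  qed
  have "eventually (\<lambda>u. x q u \<le> b u) (at_right s)" if q: "q \<in> P" for q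
  proof (cases "x q s = b s")
    case True
    have "x' q s < b' s"
      using touch[of q s] True q s t at_s \<open>s < t\<close> by auto
    moreover have "((\<lambda>u. x q u - b u) has_real_derivative (x' q s - b' s)) (at s)"
      using x[of q s] b[of s] q s t by (auto intro!: derivative_intros)
    ultimately obtain e where e: "e > 0" "\<And>h. 0 < h \<Longrightarrow> h < e \<Longrightarrow> x q (s + h) - b (s + h) < x q s - b s"
      using DERIV_neg_dec_right[of "\<lambda>u. x q u - b u" _ s] by (metis diff_less_0_iff_less)
    have "eventually (\<lambda>u. u \<in> {s<..<s+e}) (at_right s)"
      using e by (intro eventually_at_right_real) auto
    thus ?thesis
    proof eventually_elim
      case (elim u)
      thus ?case using e(2)[of "u - s"] True by auto
    qed
  next
    case False
    hence "x q s < b s" using at_s q by force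
    moreover have "(x q \<longlongrightarrow> x q s) (at_right s)" "(b \<longlongrightarrow> b s) (at_right s)"
      using isC[OF q] isCb by (auto simp: isCont_def intro: tendsto_within_subset)
    hence "((\<lambda>u. b u - x q u) \<longlongrightarrow> b s - x q s) (at_right s)" by (intro tendsto_intros)
    ultimately have "eventually (\<lambda>u. b u - x q u > 0) (at_right s)"
      by (intro order_tendstoD(1)) auto
    thus ?thesis by eventually_elim auto
  qed
  hence "eventually (\<lambda>u. \<forall>q\<in>P. x q u \<le> b u) (at_right s)"
    using fin by (intro eventually_ball_finite) auto
  then obtain c where c: "c > s" "\<And>u q. s < u \<Longrightarrow> u < c \<Longrightarrow> q \<in> P \<Longrightarrow> x q u \<le> b u"
    by (auto simp: eventually_at_right_field)
  have "min c t \<le> s" 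
    unfolding s_def
  proof (rule cInf_greatest)
    show "V \<noteq> {}" using tV by auto
    fix u assume u: "u \<in> V"
    show "min c t \<le> u"
    proof (rule ccontr)
      assume "\<not> min c t \<le> u"
      moreover have "s \<le> u" unfolding s_def using bdd u by (intro cInf_lower)
      moreover obtain q where "q \<in> P" "x q u > b u" using u by (auto simp: V_def)
      ultimately show False using c(2)[of u q] at_s[of q] by (cases "s = u") (auto simp: not_le)
    qed
  qed
  thus False using c(1) \<open>s < t\<close> by (simp split: if_splits add: min_def)
qed

text \<open>Two barriers in succession: a line descending from \<open>l\<close> with half the guaranteed speed until it
  reaches \<open>c\<close> at time \<open>S\<close>, and the constant \<open>c\<close> from then on.\<close>
lemma eventually_below_level:
  fixes x x' :: "'i \<Rightarrow> real \<Rightarrow> real"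
  assumes fin: "finite P"
    and x: "\<And>p t. p \<in> P \<Longrightarrow> T \<le> t \<Longrightarrow> (x p has_real_derivative x' p t) (at t)"
    and start: "\<And>p. p \<in> P \<Longrightarrow> x p T \<le> l"
    and r: "r > 0" and c: "c \<le> l"
    and decr: "\<And>p t. p \<in> P \<Longrightarrow> T \<le> t \<Longrightarrow> c \<le> x p t \<Longrightarrow> x p t \<le> l \<Longrightarrow> (\<And>q. q \<in> P \<Longrightarrow> x q t \<le> x p t)
        \<Longrightarrow> x' p t \<le> - r"
  shows "eventually (\<lambda>t. \<forall>p\<in>P. x p t \<le> c) at_top"
proof -
  define S where "S = T + 2 * (max c l - c) / r"
  have S: "T \<le> S" using r by (auto simp: S_def)
  have le_l: "x p t \<le> l - r/2 * (t - T)" if p: "p \<in> P" "T \<le> t" "t \<le> S" "c < l" for p t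
  proof (rule barrier[OF fin, where S = S and T = T and x = x and x' = x'
        and b = "\<lambda>t. l - r/2 * (t - T)" and b' = "\<lambda>_. - (r/2)"])
    fix q s assume *: "q \<in> P" "T \<le> s" "s < S" "x q s = l - r/2 * (s - T)" "\<And>q'. q' \<in> P \<Longrightarrow> x q' s \<le> x q s"
    have "r/2 * (s - T) \<le> r/2 * (S - T)" using * r by (intro mult_left_mono) auto
    also have "\<dots> = l - c" using r \<open>c < l\<close> by (simp add: S_def)
    finally have "c \<le> x q s" using * by simp
    moreover have "x q s \<le> l" using * r by simp
    ultimately have "x' q s \<le> - r" using decr * by blast
    thus "x' q s < - (r/2)" using r by simp
  qed (use x start that r in \<open>auto intro!: derivative_eq_intros\<close>)
  have S_le: "x p S \<le> c" if "p \<in> P" for p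
  proof (cases "c < l")
    case True
    hence "r/2 * (S - T) = l - c" using r by (simp add: S_def field_simps)
    moreover have "x p S \<le> l - r/2 * (S - T)" using le_l[of p S] that S True by simp
    ultimately show ?thesis by linarith
  next
    case False
    thus ?thesis using start[of p] that by (simp add: S_def)
  qed
  have "x p t \<le> c" if "p \<in> P" "t \<ge> S" for p t
  proof (rule barrier[OF fin, where S = t and T = S and x = x and x' = x' and b = "\<lambda>_. c" and b' = "\<lambda>_. 0"])
    fix q s assume *: "q \<in> P" "S \<le> s" "s < t" "x q s = c" "\<And>q'. q' \<in> P \<Longrightarrow> x q' s \<le> x q s"
    hence "x' q s \<le> - r" using decr[of q s] S c by force
    thus "x' q s < 0" using r by simp
  qed (use x S S_le that in auto)
  thus ?thesis by (auto simp: eventually_at_top_linorder intro!: exI[of _ S])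
qed

section \<open>The inertial flow and its memory\<close>

lemma sin_diff_about_midpoint:
  "sin (c - a) - sin (c - b) = - 2 * sin ((a - b) / 2) * cos (c - (a + b) / 2)" for a b c :: real
proof -
  have eq: "(c - a - (c - b)) / 2 = - ((a - b) / 2)" "(c - a + (c - b)) / 2 = c - (a + b) / 2"
    by (simp_all add: field_simps)
  show ?thesis unfolding sin_diff_sin eq sin_minus by simp
qed

lemma abs_sin_diff_le: "\<bar>sin x - sin y\<bar> \<le> \<bar>x - y\<bar>" for x y :: real
proof -
  have "\<bar>sin x - sin y\<bar> = 2 * \<bar>sin ((x - y) / 2)\<bar> * \<bar>cos ((x + y) / 2)\<bar>"
    by (simp add: sin_diff_sin abs_mult)
  also have "\<dots> \<le> 2 * \<bar>(x - y) / 2\<bar> * 1"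
    by (intro mult_mono abs_sin_x_le_abs_x) auto
  finally show ?thesis by simp
qed

definition diffs_le :: "(nat \<Rightarrow> real) \<Rightarrow> nat set \<Rightarrow> real \<Rightarrow> bool" where
  "diffs_le x C K \<longleftrightarrow> (\<forall>i\<in>C. \<forall>j\<in>C. \<bar>x i - x j\<bar> \<le> K)"

lemma diffs_leD: "diffs_le x C K \<Longrightarrow> i \<in> C \<Longrightarrow> j \<in> C \<Longrightarrow> \<bar>x i - x j\<bar> \<le> K"
  by (simp add: diffs_le_def)

lemma diffs_le_mono: "diffs_le x C K \<Longrightarrow> D \<subseteq> C \<Longrightarrow> diffs_le x D K"
  by (auto simp: diffs_le_def)

lemma diffs_le_nonneg: "diffs_le x C K \<Longrightarrow> i \<in> C \<Longrightarrow> 0 \<le> K"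
  using diffs_leD[of x C K i i] by simp

lemma finite_diffs_le:
  assumes "finite C"
  obtains K where "diffs_le x C K"
proof
  show "diffs_le x C (Max ((\<lambda>(i, j). \<bar>x i - x j\<bar>) ` (C \<times> C)))"
    unfolding diffs_le_def using assms by (intro ballI Max_ge) auto
qed

text \<open>This is \<open>xi\<close> with the two diameters replaced by arbitrary numbers \<open>V\<close> and \<open>W\<close>, so that upper
  bounds for a larger set of oscillators can be used for each of its subsets.\<close>
definition lag_bound :: "real \<Rightarrow> real \<Rightarrow> real \<Rightarrow> real \<Rightarrow> real \<Rightarrow> real" where
  "lag_bound m \<kappa> V W \<eta> =
     m * V + 2 * m * \<kappa> + V / (2 * \<kappa>)
     + W * m * max 1 \<eta> * exp (- max 1 \<eta>)
     + W / (2 * \<kappa>) * (exp (- \<eta>) / (1 - exp (- \<eta>)))"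

lemma xi_eq_lag_bound: "xi m \<kappa> V W \<eta> = lag_bound m \<kappa> (diameter V) (diameter W) \<eta>"
  by (simp add: xi_def lag_bound_def)

text \<open>The function \<open>s exp (- s)\<close> increases up to \<open>1\<close> and decreases afterwards; this is the origin of
  \<open>max 1 \<eta>\<close> in \<open>xi\<close>.\<close>
lemma time_decay_le:
  assumes "0 < \<eta>" "\<eta> \<le> (s::real)"
  shows "s * exp (- s) \<le> max 1 \<eta> * exp (- max 1 \<eta>)"
proof -
  have decr: "b * exp (- b) \<le> a * exp (- a)" if "1 \<le> a" "a \<le> b" for a b :: real
  proof (rule DERIV_nonpos_imp_nonincreasing[OF that(2)])
    fix x assume "a \<le> x" "x \<le> b"
    moreover have "((\<lambda>x. x * exp (- x)) has_real_derivative (1 - x) * exp (- x)) (at x)"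
      by (auto intro!: derivative_eq_intros simp: algebra_simps)
    ultimately show "\<exists>y. ((\<lambda>x. x * exp (- x)) has_real_derivative y) (at x) \<and> y \<le> 0"
      using that by (intro exI[of _ "(1 - x) * exp (- x)"]) (auto simp: mult_le_0_iff)
  qed
  have "s * exp (- s) \<le> 1 * exp (- 1)"
  proof -
    have "s \<le> exp (s - 1)" using exp_ge_add_one_self[of "s - 1"] by simp
    hence "s * exp (- s) \<le> exp (s - 1) * exp (- s)" by (intro mult_right_mono) auto
    thus ?thesis by (simp add: exp_add[symmetric])
  qed
  thus ?thesis using decr[of \<eta> s] assms by (cases "\<eta> \<le> 1") (auto simp: max_def)
qed

locale kuramoto =
  fixes N :: nat and m \<kappa> :: real and \<nu> \<theta>0 \<omega>0 :: "nat \<Rightarrow> real" and \<theta> \<omega> :: "nat \<Rightarrow> real \<Rightarrow> real"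
  assumes N_ge_1: "N \<ge> 1" and m_pos: "m > 0" and \<kappa>_pos: "\<kappa> > 0"
    and solution: "inertial_kuramoto N m \<kappa> \<nu> \<theta>0 \<omega>0 \<theta> \<omega>"
begin

definition force :: "nat \<Rightarrow> real \<Rightarrow> real" where
  "force i t = \<nu> i + \<kappa> / real N * (\<Sum>j=1..N. sin (\<theta> j t - \<theta> i t))"

lemma phase_deriv: "i \<in> {1..N} \<Longrightarrow> t > 0 \<Longrightarrow> (\<theta> i has_real_derivative \<omega> i t) (at t)"
proof -
  assume "i \<in> {1..N}" "t > 0"
  hence "(\<theta> i has_real_derivative \<omega> i t) (at t within {0..})"
    using solution unfolding inertial_kuramoto_def by force
  moreover have "at t within {0..} = at t" using \<open>t > 0\<close> by (intro at_within_interior) auto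
  ultimately show ?thesis by simp
qed

lemma velocity_deriv:
  "i \<in> {1..N} \<Longrightarrow> t > 0 \<Longrightarrow> (\<omega> i has_real_derivative (force i t - \<omega> i t) / m) (at t)"
proof -
  assume "i \<in> {1..N}" "t > 0"
  then obtain a where a: "(\<omega> i has_real_derivative a) (at t)" "m * a + \<omega> i t = force i t"
    using solution unfolding inertial_kuramoto_def force_def by blast
  from a(2) have "a = (force i t - \<omega> i t) / m" using m_pos by (simp add: field_simps)
  with a(1) show ?thesis by simp
qed

lemma phase_continuous: "i \<in> {1..N} \<Longrightarrow> S \<subseteq> {0..} \<Longrightarrow> continuous_on S (\<theta> i)"
  using solution unfolding inertial_kuramoto_def
  by (metis (no_types, lifting) DERIV_continuous_on atLeast_iff continuous_on_subset)

lemma velocity_continuous: "i \<in> {1..N} \<Longrightarrow> S \<subseteq> {0..} \<Longrightarrow> continuous_on S (\<omega> i)"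
  using solution unfolding inertial_kuramoto_def by (blast intro: continuous_on_subset)

lemma velocity_initial: "i \<in> {1..N} \<Longrightarrow> \<omega> i 0 = \<omega>0 i"
  using solution unfolding inertial_kuramoto_def by blast

lemma translate_kuramoto: "kuramoto N m \<kappa> \<nu> (\<lambda>i. \<theta>0 i - 2 * of_int (k i) * pi) \<omega>0 (translate k \<theta>) \<omega>"
proof
  have "sin (translate k \<theta> j t - translate k \<theta> i t) = sin (\<theta> j t - \<theta> i t)" for i j t
  proof -
    have "translate k \<theta> j t - translate k \<theta> i t = \<theta> j t - \<theta> i t + 2 * pi * of_int (k i - k j)"
      by (simp add: translate_def algebra_simps)
    thus ?thesis by (simp only: sin_add sin_int_2pin cos_int_2pin mult_1_right mult_zero_right add_0_right)
  qed
  moreover have "(translate k \<theta> i has_real_derivative \<omega> i t) (at t within {0..})"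
    if "(\<theta> i has_real_derivative \<omega> i t) (at t within {0..})" for i t
    unfolding translate_def[abs_def] using that by (auto intro!: derivative_eq_intros)
  ultimately show "inertial_kuramoto N m \<kappa> \<nu> (\<lambda>i. \<theta>0 i - 2 * of_int (k i) * pi) \<omega>0 (translate k \<theta>) \<omega>"
    using solution unfolding inertial_kuramoto_def by (simp add: translate_def)
qed (fact N_ge_1 m_pos \<kappa>_pos)+

lemma coupling_bound: "\<bar>\<kappa> / real N * (\<Sum>j=1..N. sin (\<theta> j t - \<theta> i t))\<bar> \<le> \<kappa>"
proof -
  have "\<bar>\<Sum>j=1..N. sin (\<theta> j t - \<theta> i t)\<bar> \<le> (\<Sum>j=1..N. \<bar>sin (\<theta> j t - \<theta> i t)\<bar>)" by (rule sum_abs)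
  also have "\<dots> \<le> (\<Sum>j=1..N. 1)" by (intro sum_mono) auto
  finally have "\<bar>\<Sum>j=1..N. sin (\<theta> j t - \<theta> i t)\<bar> \<le> real N" by simp
  hence "\<kappa> / real N * \<bar>\<Sum>j=1..N. sin (\<theta> j t - \<theta> i t)\<bar> \<le> \<kappa> / real N * real N"
    using \<kappa>_pos by (intro mult_left_mono) auto
  thus ?thesis using N_ge_1 \<kappa>_pos by (simp add: abs_mult)
qed

lemma force_diff_le: "force i t - force j t \<le> \<nu> i - \<nu> j + 2 * \<kappa>"
  using coupling_bound[of t i] coupling_bound[of t j] unfolding force_def by linarith

text \<open>Variation of constants, without integrals: \<open>exp (s / m) (\<omega> i - \<omega> j - L)\<close> is nonincreasing as soon as
  \<open>L\<close> bounds the difference of the forces.\<close>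
lemma velocity_diff_le:
  assumes ij: "i \<in> {1..N}" "j \<in> {1..N}" and V: "\<nu> i - \<nu> j \<le> V" "0 \<le> V"
    and W: "\<omega>0 i - \<omega>0 j \<le> W" and t: "0 \<le> t"
  shows "\<omega> i t - \<omega> j t \<le> W * exp (- (t / m)) + (V + 2 * \<kappa>)"
proof -
  define L where "L = V + 2 * \<kappa>"
  define H where "H = (\<lambda>s. exp (s / m) * (\<omega> i s - \<omega> j s - L))"
  have "H t \<le> H 0"
  proof (rule DERIV_nonpos_imp_decreasing_open[OF t])
    fix s assume s: "0 < s" "s < t"
    have "(H has_real_derivative exp (s / m) * (1 / m) * (\<omega> i s - \<omega> j s - L)
        + exp (s / m) * ((force i s - \<omega> i s) / m - (force j s - \<omega> j s) / m)) (at s)"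
      unfolding H_def using s ij
      using m_pos by (auto intro!: derivative_eq_intros velocity_deriv)
    moreover have "exp (s / m) * (1 / m) * (\<omega> i s - \<omega> j s - L)
        + exp (s / m) * ((force i s - \<omega> i s) / m - (force j s - \<omega> j s) / m)
        = exp (s / m) / m * (force i s - force j s - L)"
      using m_pos by (simp add: field_simps)
    moreover have "exp (s / m) / m * (force i s - force j s - L) \<le> 0"
      using force_diff_le[of i s j] V m_pos by (intro mult_nonneg_nonpos) (auto simp: L_def)
    ultimately show "\<exists>y. (H has_real_derivative y) (at s) \<and> y \<le> 0" by auto
  next
    show "continuous_on {0..t} H"
      unfolding H_def using ij m_pos by (intro continuous_intros velocity_continuous) auto
  qed
  also have "H 0 \<le> W - L" using W velocity_initial ij by (simp add: H_def)
  finally have "exp (- (t / m)) * H t \<le> exp (- (t / m)) * (W - L)" by (intro mult_left_mono) auto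
  moreover have "exp (- (t / m)) * H t = \<omega> i t - \<omega> j t - L"
    by (simp add: H_def mult.assoc[symmetric] exp_add[symmetric])
  moreover have "0 \<le> exp (- (t / m)) * L" using V \<kappa>_pos by (simp add: L_def)
  ultimately show ?thesis by (simp add: algebra_simps L_def)
qed

text \<open>The integral over \<open>[s, t]\<close> of the bound in \<open>velocity_diff_le\<close>.\<close>
definition drift_bound :: "real \<Rightarrow> real \<Rightarrow> real \<Rightarrow> real \<Rightarrow> real" where
  "drift_bound V W s t = (V + 2 * \<kappa>) * (t - s) + W * m * (exp (- (s / m)) - exp (- (t / m)))"

lemma phase_diff_drift:
  assumes ij: "i \<in> {1..N}" "j \<in> {1..N}" and V: "\<bar>\<nu> i - \<nu> j\<bar> \<le> V"
    and W: "\<bar>\<omega>0 i - \<omega>0 j\<bar> \<le> W" and st: "0 \<le> s" "s \<le> t"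
  shows "\<bar>(\<theta> i s - \<theta> j s) - (\<theta> i t - \<theta> j t)\<bar> \<le> drift_bound V W s t"
proof -
  have one: "(\<theta> i s - \<theta> j s) - (\<theta> i t - \<theta> j t) \<le> drift_bound V W s t"
    if ij: "i \<in> {1..N}" "j \<in> {1..N}" and V: "\<bar>\<nu> i - \<nu> j\<bar> \<le> V" and W: "\<bar>\<omega>0 i - \<omega>0 j\<bar> \<le> W" for i j
  proof -
    define G where "G = (\<lambda>u. \<theta> i u - \<theta> j u + (V + 2 * \<kappa>) * u - W * m * exp (- (u / m)))"
    have "G s \<le> G t"
    proof (rule DERIV_nonneg_imp_increasing_open[OF st(2)])
      fix u assume u: "s < u" "u < t"
      have "(G has_real_derivative (\<omega> i u - \<omega> j u + (V + 2 * \<kappa>) + W * exp (- (u / m)))) (at u)"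
        unfolding G_def using u st ij m_pos
        by (auto intro!: derivative_eq_intros phase_deriv)
      moreover have "\<omega> j u - \<omega> i u \<le> W * exp (- (u / m)) + (V + 2 * \<kappa>)"
        using ij V W u st by (intro velocity_diff_le) auto
      ultimately show "\<exists>y. (G has_real_derivative y) (at u) \<and> 0 \<le> y"
        by (intro exI conjI) auto
    next
      show "continuous_on {s..t} G"
        unfolding G_def using ij st m_pos by (intro continuous_intros phase_continuous) auto
    qed
    thus ?thesis by (simp add: G_def drift_bound_def algebra_simps)
  qed
  show ?thesis using one[OF ij V W] one[of j i] ij V W by (simp add: abs_le_iff abs_minus_commute)
qed

text \<open>The difference of the forces on \<open>p\<close> and \<open>q\<close> at an earlier time \<open>s\<close>, estimated through the positions at
  time \<open>t\<close>. For \<open>k\<close> in \<open>A\<close> both sines are Lipschitz in phase differences of \<open>A \<union> {p, q}\<close>, which costs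
  twice the drift. The phases of the others are not tied to \<open>p\<close> and \<open>q\<close> by \<open>V\<close> and \<open>W\<close>; their
  contribution is at most \<open>2 \<bar>sin ((\<theta> p - \<theta> q) / 2)\<bar>\<close> wherever they are, which costs the drift once.\<close>
lemma past_force_diff_le:
  assumes A: "A \<subseteq> {1..N}" "lam * real N \<le> real (card A)" and pq: "p \<in> {1..N}" "q \<in> {1..N}"
    and V: "diffs_le \<nu> (insert p (insert q A)) V"
    and W: "diffs_le \<omega>0 (insert p (insert q A)) W"
    and x: "x = \<theta> p t - \<theta> q t" "0 \<le> x" "x \<le> 2 * pi"
    and y: "y \<le> pi" "\<And>k. k \<in> A \<Longrightarrow> \<bar>\<theta> k t - (\<theta> p t + \<theta> q t) / 2\<bar> \<le> y"
    and st: "0 \<le> s" "s \<le> t"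
  shows "force p s - force q s
    \<le> V + \<kappa> * (2 * drift_bound V W s t - 2 * sin (x/2) * (lam * cos y - (1 - lam)))"
proof -
  define R where "R = drift_bound V W s t"
  define h where "h = 2 * sin (x/2)"
  define g where "g = (\<lambda>k s. sin (\<theta> k s - \<theta> p s) - sin (\<theta> k s - \<theta> q s))"
  have h0: "0 \<le> h" unfolding h_def using x by (intro mult_nonneg_nonneg sin_ge_zero) auto
  have fA: "finite A" using A by (auto intro: finite_subset)
  have drift: "\<bar>(\<theta> i s - \<theta> j s) - (\<theta> i t - \<theta> j t)\<bar> \<le> R"
    if "i \<in> insert p (insert q A)" "j \<in> insert p (insert q A)" for i j
    unfolding R_def using that A pq st by (intro phase_diff_drift diffs_leD[OF V] diffs_leD[OF W]) auto
  have in_A: "g k s \<le> 2 * R - h * cos y" if k: "k \<in> A" for k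
  proof -
    have "g k s \<le> g k t + 2 * R"
      using abs_sin_diff_le[of "\<theta> k s - \<theta> p s" "\<theta> k t - \<theta> p t"]
        abs_sin_diff_le[of "\<theta> k s - \<theta> q s" "\<theta> k t - \<theta> q t"]
        drift[of k p] drift[of k q] k unfolding g_def by auto
    moreover have "g k t = - (h * cos (\<theta> k t - (\<theta> p t + \<theta> q t) / 2))"
      by (simp add: g_def sin_diff_about_midpoint h_def x)
    moreover have "cos y \<le> cos \<bar>\<theta> k t - (\<theta> p t + \<theta> q t) / 2\<bar>"
      using y(1) y(2)[OF k] by (intro cos_monotone_0_pi_le) auto
    hence "h * cos y \<le> h * cos (\<theta> k t - (\<theta> p t + \<theta> q t) / 2)"
      using h0 by (intro mult_left_mono) auto
    ultimately show ?thesis by linarith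
  qed
  have outside: "g k s \<le> 2 * R + h" for k
  proof -
    have "g k s \<le> \<bar>2 * sin ((\<theta> p s - \<theta> q s) / 2) * cos (\<theta> k s - (\<theta> p s + \<theta> q s) / 2)\<bar>"
      by (simp add: g_def sin_diff_about_midpoint)
    also have "\<dots> \<le> \<bar>2 * sin ((\<theta> p s - \<theta> q s) / 2)\<bar> * 1"
      unfolding abs_mult by (intro mult_left_mono) auto
    also have "\<dots> \<le> h + 2 * \<bar>sin ((\<theta> p s - \<theta> q s) / 2) - sin (x / 2)\<bar>"
    proof -
      have "\<bar>2 * a\<bar> * 1 \<le> 2 * b + 2 * \<bar>a - b\<bar>" if "0 \<le> b" for a b :: real
        using that by (auto simp: abs_if)
      thus ?thesis using h0 by (simp add: h_def)
    qed
    also have "\<bar>sin ((\<theta> p s - \<theta> q s) / 2) - sin (x / 2)\<bar> \<le> \<bar>(\<theta> p s - \<theta> q s) / 2 - x / 2\<bar>"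
      by (rule abs_sin_diff_le)
    also have "2 * \<bar>(\<theta> p s - \<theta> q s) / 2 - x / 2\<bar> = \<bar>(\<theta> p s - \<theta> q s) - x\<bar>"
      by (simp add: abs_if field_simps)
    also have "\<dots> \<le> R" using drift[of p q] x by simp
    finally have "g k s \<le> h + R" by simp
    moreover have "0 \<le> R" using drift[of p q] by (intro order_trans[OF abs_ge_zero]) auto
    ultimately show ?thesis by simp
  qed
  have "(\<Sum>k=1..N. g k s) = (\<Sum>k\<in>A. g k s) + (\<Sum>k\<in>{1..N} - A. g k s)"
    using A by (metis add.commute finite_atLeastAtMost sum.subset_diff)
  also have "\<dots> \<le> (\<Sum>k\<in>A. 2 * R - h * cos y) + (\<Sum>k\<in>{1..N} - A. 2 * R + h)"
    using in_A outside by (intro add_mono sum_mono) auto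
  also have "\<dots> = 2 * real N * R + real N * h - real (card A) * (h * (1 + cos y))"
  proof -
    have "card ({1..N} - A) = N - card A" "card A \<le> N"
      using A fA card_mono[OF _ A(1)] by (auto simp: card_Diff_subset)
    hence eq: "real (card ({1..N} - A)) = real N - real (card A)" by simp
    show ?thesis unfolding sum_constant eq by (simp add: algebra_simps)
  qed
  also have "\<dots> \<le> 2 * real N * R + real N * h - (lam * real N) * (h * (1 + cos y))"
  proof -
    have "0 \<le> 1 + cos y" using cos_ge_minus_one[of y] by linarith
    thus ?thesis using A(2) h0 by (intro diff_mono mult_right_mono mult_nonneg_nonneg) auto
  qed
  also have "\<dots> = real N * (2 * R - h * (lam * cos y - (1 - lam)))" by (simp add: algebra_simps)
  finally have "\<kappa> / real N * (\<Sum>k=1..N. g k s)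
      \<le> \<kappa> / real N * (real N * (2 * R - h * (lam * cos y - (1 - lam))))"
    using \<kappa>_pos by (intro mult_left_mono) auto
  also have "\<dots> = \<kappa> * (2 * R - h * (lam * cos y - (1 - lam)))" using N_ge_1 by simp
  finally have "\<kappa> / real N * (\<Sum>k=1..N. g k s) \<le> \<kappa> * (2 * R - h * (lam * cos y - (1 - lam)))" .
  moreover have "force p s - force q s = \<nu> p - \<nu> q + \<kappa> / real N * (\<Sum>k=1..N. g k s)"
    by (simp add: force_def g_def sum_subtractf algebra_simps)
  moreover have "\<nu> p - \<nu> q \<le> V" using diffs_leD[OF V, of p q] by simp
  ultimately show ?thesis by (simp add: R_def h_def)
qed

text \<open>The central estimate. Multiplying the difference of the equations for \<open>p\<close> and \<open>q\<close> by \<open>exp (s / m)\<close> and inserting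
  \<open>past_force_diff_le\<close> gives a bound for the derivative whose antiderivative \<open>P\<close> is explicit; evaluating
  it at \<open>0\<close> and \<open>t\<close> produces the terms of \<open>xi\<close>. The set \<open>A\<close> provides the majority within distance \<open>y\<close>
  of the midpoint between \<open>p\<close> and \<open>q\<close>, which need not belong to \<open>A\<close>.\<close>
lemma velocity_diff_estimate:
  assumes A: "A \<subseteq> {1..N}" "lam * real N \<le> real (card A)" and pq: "p \<in> {1..N}" "q \<in> {1..N}"
    and V: "diffs_le \<nu> (insert p (insert q A)) V"
    and W: "diffs_le \<omega>0 (insert p (insert q A)) W"
    and x: "x = \<theta> p t - \<theta> q t" "0 \<le> x" "x \<le> 2 * pi"
    and y: "y \<le> pi" "\<And>k. k \<in> A \<Longrightarrow> \<bar>\<theta> k t - (\<theta> p t + \<theta> q t) / 2\<bar> \<le> y"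
    and t: "0 < \<eta>" "\<eta> * m \<le> t"
  shows "\<omega> p t - \<omega> q t \<le> \<kappa> * (1 - exp (- (t / m)))
           * (2 * lag_bound m \<kappa> V W \<eta> - 2 * sin (x/2) * (lam * cos y - (1 - lam)))"
proof -
  define h where "h = 2 * sin (x/2) * (lam * cos y - (1 - lam))"
  define K where "K = V - \<kappa> * h"
  define L where "L = V + 2 * \<kappa>"
  define \<tau> where "\<tau> = t / m"
  have tpos: "0 < t" using t m_pos by (smt (verit) mult_pos_pos)
  have \<tau>: "0 < \<tau>" "\<eta> \<le> \<tau>" "t = m * \<tau>" using t tpos m_pos by (auto simp: \<tau>_def field_simps)
  have V0: "0 \<le> V" and W0: "0 \<le> W" using diffs_le_nonneg[OF V, of p] diffs_le_nonneg[OF W, of p] by auto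
  define P where "P = (\<lambda>s. K * exp (s/m) + 2 * \<kappa> * (L * (t - s) * exp (s/m) + L * m * exp (s/m)
      + W * s - W * m * exp (- \<tau>) * exp (s/m)))"
  define H where "H = (\<lambda>s. exp (s/m) * (\<omega> p s - \<omega> q s) - P s)"
  have "H t \<le> H 0"
  proof (rule DERIV_nonpos_imp_decreasing_open[OF less_imp_le[OF tpos]])
    show "continuous_on {0..t} H"
      unfolding H_def P_def using pq m_pos by (intro continuous_intros velocity_continuous) auto
    fix s assume s: "0 < s" "s < t"
    have P': "(P has_real_derivative exp (s/m) / m * (K + 2 * \<kappa> * drift_bound V W s t)) (at s)"
      unfolding P_def drift_bound_def L_def[symmetric] \<tau>_def[symmetric] using m_pos
      by (auto intro!: derivative_eq_intros simp: field_simps exp_minus)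
    have "(H has_real_derivative exp (s/m) / m * (force p s - force q s)
        - exp (s/m) / m * (K + 2 * \<kappa> * drift_bound V W s t)) (at s)"
      unfolding H_def using s pq m_pos
      by (auto intro!: derivative_eq_intros velocity_deriv P' simp: field_simps)
    moreover have "force p s - force q s \<le> K + 2 * \<kappa> * drift_bound V W s t"
      using past_force_diff_le[OF A pq V W x y, of s] s by (simp add: K_def h_def algebra_simps)
    hence "exp (s/m) / m * (force p s - force q s) \<le> exp (s/m) / m * (K + 2 * \<kappa> * drift_bound V W s t)"
      using m_pos by (intro mult_left_mono) auto
    ultimately show "\<exists>y. (H has_real_derivative y) (at s) \<and> y \<le> 0" by (intro exI conjI) auto
  qed
  hence "exp (- \<tau>) * H t \<le> exp (- \<tau>) * H 0" by (intro mult_left_mono) auto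
  also have "exp (- \<tau>) * H t = \<omega> p t - \<omega> q t - exp (- \<tau>) * P t"
    by (simp add: H_def \<tau>_def algebra_simps mult.assoc[symmetric] exp_add[symmetric])
  also have "exp (- \<tau>) * H 0 = exp (- \<tau>) * (\<omega>0 p - \<omega>0 q) - exp (- \<tau>) * P 0"
    using pq by (simp add: H_def velocity_initial algebra_simps)
  finally have "\<omega> p t - \<omega> q t \<le> exp (- \<tau>) * (\<omega>0 p - \<omega>0 q) + exp (- \<tau>) * (P t - P 0)"
    by (simp add: algebra_simps)
  also have "exp (- \<tau>) * (\<omega>0 p - \<omega>0 q) \<le> exp (- \<tau>) * W"
    using diffs_leD[OF W, of p q] by (intro mult_left_mono) auto
  also have "exp (- \<tau>) * (P t - P 0) = K * (1 - exp (- \<tau>))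
      + 2 * \<kappa> * m * (L * (1 - exp (- \<tau>) - \<tau> * exp (- \<tau>)) + W * exp (- \<tau>) * (\<tau> - 1 + exp (- \<tau>)))"
    using m_pos \<tau>(1) by (simp add: P_def \<tau>(3) exp_minus field_simps)
  also have "L * (1 - exp (- \<tau>) - \<tau> * exp (- \<tau>)) \<le> L * (1 - exp (- \<tau>))"
    using V0 \<kappa>_pos \<tau> by (intro mult_left_mono) (auto simp: L_def)
  also have "W * exp (- \<tau>) * (\<tau> - 1 + exp (- \<tau>)) \<le> W * exp (- \<tau>) * (\<tau> * (1 - exp (- \<tau>)))"
  proof (intro mult_left_mono)
    have "(1 + \<tau>) * exp (- \<tau>) \<le> exp \<tau> * exp (- \<tau>)"
      using exp_ge_add_one_self[of \<tau>] by (intro mult_right_mono) auto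
    thus "\<tau> - 1 + exp (- \<tau>) \<le> \<tau> * (1 - exp (- \<tau>))" by (simp add: algebra_simps exp_add[symmetric])
  qed (use W0 in auto)
  finally have "\<omega> p t - \<omega> q t \<le> exp (- \<tau>) * W + (K * (1 - exp (- \<tau>))
      + 2 * \<kappa> * m * (L * (1 - exp (- \<tau>)) + W * exp (- \<tau>) * (\<tau> * (1 - exp (- \<tau>)))))"
    using \<kappa>_pos m_pos by simp
  also have "\<dots> = (1 - exp (- \<tau>)) * (K + 2 * \<kappa> * m * L + 2 * \<kappa> * (W * m * (\<tau> * exp (- \<tau>)))
      + W * (exp (- \<tau>) / (1 - exp (- \<tau>))))"
    using \<tau> by (simp add: field_simps)
  also have "\<dots> \<le> (1 - exp (- \<tau>)) * (\<kappa> * (2 * lag_bound m \<kappa> V W \<eta> - h))"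
  proof (intro mult_left_mono)
    have "W * m * (\<tau> * exp (- \<tau>)) \<le> W * m * (max 1 \<eta> * exp (- max 1 \<eta>))"
      using time_decay_le[OF t(1) \<tau>(2)] W0 m_pos by (intro mult_left_mono) auto
    hence "2 * \<kappa> * (W * m * (\<tau> * exp (- \<tau>))) \<le> 2 * \<kappa> * (W * m * (max 1 \<eta> * exp (- max 1 \<eta>)))"
      using \<kappa>_pos by (intro mult_left_mono[of _ _ "2 * \<kappa>"]) auto
    moreover have "W * (exp (- \<tau>) / (1 - exp (- \<tau>))) \<le> W * (exp (- \<eta>) / (1 - exp (- \<eta>)))"
      using W0 t \<tau> by (intro mult_left_mono frac_le) auto
    moreover have "\<kappa> * (2 * lag_bound m \<kappa> V W \<eta> - h) = K + 2 * \<kappa> * m * L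
        + 2 * \<kappa> * (W * m * (max 1 \<eta> * exp (- max 1 \<eta>))) + W * (exp (- \<eta>) / (1 - exp (- \<eta>)))"
    proof -
      define E where "E = exp (- \<eta>) / (1 - exp (- \<eta>))"
      show ?thesis
        using \<kappa>_pos unfolding lag_bound_def K_def L_def E_def[symmetric] by (simp add: algebra_simps)
    qed
    ultimately show "K + 2 * \<kappa> * m * L + 2 * \<kappa> * (W * m * (\<tau> * exp (- \<tau>)))
        + W * (exp (- \<tau>) / (1 - exp (- \<tau>))) \<le> \<kappa> * (2 * lag_bound m \<kappa> V W \<eta> - h)"
      by linarith
  qed (use \<tau> in auto)
  finally show ?thesis by (simp add: h_def \<tau>_def mult_ac)
qed

end

section \<open>Contraction of majority clusters\<close>

lemma lag_bound_tendsto: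
  "(lag_bound m \<kappa> V W \<longlongrightarrow> m * V + 2 * m * \<kappa> + V / (2 * \<kappa>)) at_top"
proof -
  have e: "((\<lambda>x::real. exp (- x)) \<longlongrightarrow> 0) at_top"
    by (intro filterlim_compose[OF exp_at_bot] filterlim_uminus_at_bot_at_top)
  have "((\<lambda>x::real. x * exp (- x)) \<longlongrightarrow> 0) at_top"
    using tendsto_power_div_exp_0[of 1] by (simp add: exp_minus field_simps)
  moreover have "eventually (\<lambda>x::real. x * exp (- x) = max 1 x * exp (- max 1 x)) at_top"
    using eventually_ge_at_top[of 1] by eventually_elim (simp add: max_def)
  ultimately have "((\<lambda>x::real. max 1 x * exp (- max 1 x)) \<longlongrightarrow> 0) at_top"
    by (rule Lim_transform_eventually)
  from tendsto_mult_right_zero[OF this, of "W * m"] 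
  have a: "((\<lambda>x::real. W * m * max 1 x * exp (- max 1 x)) \<longlongrightarrow> 0) at_top" by (simp add: mult.assoc)
  have b: "((\<lambda>x::real. W / (2 * \<kappa>) * (exp (- x) / (1 - exp (- x)))) \<longlongrightarrow> W / (2 * \<kappa>) * (0 / (1 - 0))) at_top"
    by (intro tendsto_intros e) auto
  have "((\<lambda>\<eta>. m * V + 2 * m * \<kappa> + V / (2 * \<kappa>) + W * m * max 1 \<eta> * exp (- max 1 \<eta>)
      + W / (2 * \<kappa>) * (exp (- \<eta>) / (1 - exp (- \<eta>))))
      \<longlongrightarrow> m * V + 2 * m * \<kappa> + V / (2 * \<kappa>) + 0 + W / (2 * \<kappa>) * (0 / (1 - 0))) at_top"
    by (intro tendsto_add a b tendsto_const)
  thus ?thesis by (simp add: lag_bound_def[abs_def])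
qed

lemma lag_bound_eventually_below:
  assumes "2 * m * V + 4 * m * \<kappa> + V / \<kappa> < c"
  obtains \<eta> where "0 < \<eta>" "2 * lag_bound m \<kappa> V W \<eta> < c"
proof -
  have "V / (2 * \<kappa>) = V / \<kappa> / 2" by simp
  hence "m * V + 2 * m * \<kappa> + V / (2 * \<kappa>) < c / 2" using assms by simp
  hence "eventually (\<lambda>\<eta>. lag_bound m \<kappa> V W \<eta> < c / 2) at_top"
    using lag_bound_tendsto by (rule order_tendstoD(2)[rotated])
  hence "eventually (\<lambda>\<eta>. lag_bound m \<kappa> V W \<eta> < c / 2 \<and> 0 < \<eta>) at_top"
    using eventually_gt_at_top[of 0] by eventually_elim auto
  then obtain \<eta> where "lag_bound m \<kappa> V W \<eta> < c / 2 \<and> 0 < \<eta>"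
    using eventually_happens'[OF trivial_limit_at_top_linorder] by blast
  thus ?thesis using that[of \<eta>] by simp
qed

text \<open>Twice the limit of \<open>lag_bound\<close> as \<open>\<eta>\<close> tends to infinity; with \<open>V\<close> the diameter of the natural
  frequencies it is \<open>delta\<close>.\<close>
definition level :: "real \<Rightarrow> real \<Rightarrow> real \<Rightarrow> real" where
  "level m \<kappa> V = 2 * m * V + 4 * m * \<kappa> + V / \<kappa>"

definition spread_le :: "(nat \<Rightarrow> real \<Rightarrow> real) \<Rightarrow> nat set \<Rightarrow> real \<Rightarrow> real \<Rightarrow> bool" where
  "spread_le \<theta> C c t \<longleftrightarrow> (\<forall>i\<in>C. \<forall>j\<in>C. \<theta> i t - \<theta> j t \<le> c)"

definition asymptotic_spread_le :: "(nat \<Rightarrow> real \<Rightarrow> real) \<Rightarrow> nat set \<Rightarrow> real \<Rightarrow> bool" where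
  "asymptotic_spread_le \<theta> C c \<longleftrightarrow> (\<forall>c'>c. eventually (spread_le \<theta> C c') at_top)"

lemma spread_le_mono: "spread_le \<theta> C c t \<Longrightarrow> D \<subseteq> C \<Longrightarrow> c \<le> c' \<Longrightarrow> spread_le \<theta> D c' t"
  unfolding spread_le_def by (meson order_trans subsetD)

locale majority_kuramoto = majority_coupling lam + kuramoto N m \<kappa> \<nu> \<theta>0 \<omega>0 \<theta> \<omega>
  for lam N m \<kappa> \<nu> \<theta>0 \<omega>0 \<theta> \<omega> +
  fixes A :: "nat set"
  assumes A_subset: "A \<subseteq> {1..N}" and A_majority: "lam * real N \<le> real (card A)"
begin

lemma A_finite: "finite A" using A_subset by (auto intro: finite_subset)

lemma A_nonempty: "A \<noteq> {}" using A_majority lam_gt_half N_ge_1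
  by (auto simp: mult_le_0_iff)

lemma level_pos: "0 \<le> V \<Longrightarrow> 0 < level m \<kappa> V"
  using m_pos \<kappa>_pos by (simp add: level_def add_nonneg_pos add_pos_nonneg)

lemma level_le_lag_bound:
  assumes "0 < \<eta>" "0 \<le> W"
  shows "level m \<kappa> V \<le> 2 * lag_bound m \<kappa> V W \<eta>"
proof -
  have "0 \<le> W * m * max 1 \<eta> * exp (- max 1 \<eta>)" using assms m_pos by simp
  moreover have "0 \<le> W / (2 * \<kappa>) * (exp (- \<eta>) / (1 - exp (- \<eta>)))"
    using assms \<kappa>_pos by (intro mult_nonneg_nonneg divide_nonneg_nonneg) auto
  moreover have "V / \<kappa> = 2 * (V / (2 * \<kappa>))" by simp
  ultimately show ?thesis unfolding lag_bound_def level_def by argo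
qed

definition phase_gap :: "nat \<times> nat \<Rightarrow> real \<Rightarrow> real" where
  "phase_gap p t = \<theta> (fst p) t - \<theta> (snd p) t"

lemma phase_gap_deriv:
  assumes "p \<in> {1..N} \<times> {1..N}" "0 < t"
  shows "(phase_gap p has_real_derivative \<omega> (fst p) t - \<omega> (snd p) t) (at t)"
  unfolding phase_gap_def[abs_def] using assms by (intro DERIV_diff phase_deriv) auto

lemma spread_le_phase_gap: "spread_le \<theta> C c t \<longleftrightarrow> (\<forall>p\<in>C \<times> C. phase_gap p t \<le> c)"
  by (auto simp: spread_le_def phase_gap_def)

lemma eventually_spread_le:
  assumes C: "C \<subseteq> {1..N}" and T: "0 < T" and start: "spread_le \<theta> C l T" and r: "0 < r" and c: "c \<le> l"
    and decr: "\<And>p q t. p \<in> C \<Longrightarrow> q \<in> C \<Longrightarrow> T \<le> t \<Longrightarrow> c \<le> \<theta> p t - \<theta> q t \<Longrightarrow> \<theta> p t - \<theta> q t \<le> l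
        \<Longrightarrow> spread_le \<theta> C (\<theta> p t - \<theta> q t) t \<Longrightarrow> \<omega> p t - \<omega> q t \<le> - r"
  shows "eventually (spread_le \<theta> C c) at_top"
proof -
  have "eventually (\<lambda>t. \<forall>p\<in>C \<times> C. phase_gap p t \<le> c) at_top"
  proof (rule eventually_below_level[where x' = "\<lambda>p t. \<omega> (fst p) t - \<omega> (snd p) t" and T = T and l = l and r = r])
    show "finite (C \<times> C)" using C by (auto intro: finite_subset)
    fix p t assume *: "p \<in> C \<times> C" "T \<le> t"
    show "(phase_gap p has_real_derivative \<omega> (fst p) t - \<omega> (snd p) t) (at t)"
      using * T C by (intro phase_gap_deriv) auto
    assume "c \<le> phase_gap p t" "phase_gap p t \<le> l" "\<And>q. q \<in> C \<times> C \<Longrightarrow> phase_gap q t \<le> phase_gap p t"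
    thus "\<omega> (fst p) t - \<omega> (snd p) t \<le> - r"
      using decr[of "fst p" "snd p" t] * by (auto simp: spread_le_phase_gap phase_gap_def)
  qed (use start r c in \<open>auto simp: spread_le_phase_gap\<close>)
  thus ?thesis by eventually_elim (simp add: spread_le_phase_gap)
qed

text \<open>For the extreme pair of \<open>A\<close> all of \<open>A\<close> lies between the two phases, hence within half their
  distance of the midpoint, and the general estimate becomes one in terms of \<open>f_lam\<close>.\<close>
lemma cluster_velocity_estimate:
  assumes V: "diffs_le \<nu> A V" and W: "diffs_le \<omega>0 A W"
    and pq: "p \<in> A" "q \<in> A" and x: "\<theta> p t - \<theta> q t \<le> pi" and sp: "spread_le \<theta> A (\<theta> p t - \<theta> q t) t"
    and t: "0 < \<eta>" "\<eta> * m \<le> t"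
  shows "\<omega> p t - \<omega> q t \<le> \<kappa> * (1 - exp (- (t / m)))
           * (2 * lag_bound m \<kappa> V W \<eta> - f_lam lam (\<theta> p t - \<theta> q t))"
proof -
  define x where "x = \<theta> p t - \<theta> q t"
  have x0: "0 \<le> x" using sp pq unfolding spread_le_def x_def by fastforce
  have "\<omega> p t - \<omega> q t \<le> \<kappa> * (1 - exp (- (t / m)))
           * (2 * lag_bound m \<kappa> V W \<eta> - 2 * sin (x/2) * (lam * cos (x/2) - (1 - lam)))"
  proof (rule velocity_diff_estimate[OF A_subset A_majority _ _ _ _ x_def x0])
    fix k assume k: "k \<in> A"
    have "\<theta> k t - \<theta> q t \<le> x" "\<theta> p t - \<theta> k t \<le> x"
      using sp k pq by (auto simp: spread_le_def x_def)
    thus "\<bar>\<theta> k t - (\<theta> p t + \<theta> q t) / 2\<bar> \<le> x / 2" by (simp add: x_def abs_le_iff field_simps)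
  next
    show "x \<le> 2 * pi" "x / 2 \<le> pi" using x x_def x0 pi_gt_zero by linarith+
  next
    show "diffs_le \<nu> (insert p (insert q A)) V" "diffs_le \<omega>0 (insert p (insert q A)) W"
      using pq V W by (simp_all add: insert_absorb)
  qed (use pq A_subset t in auto)
  thus ?thesis by (simp add: f_lam_factor x_def)
qed

lemma contraction_rate_pos:
  assumes "0 < \<eta>" "\<eta> * m \<le> t"
  shows "0 < 1 - exp (- \<eta>)" "1 - exp (- \<eta>) \<le> 1 - exp (- (t / m))"
  using assms m_pos by (auto simp: field_simps)

lemma cluster_stays:
  assumes V: "diffs_le \<nu> A V" and W: "diffs_le \<omega>0 A W"
    and l: "0 < l" "l < cutoff" and lag: "2 * lag_bound m \<kappa> V W \<eta> < f_lam lam l"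
    and T: "0 < \<eta>" "\<eta> * m \<le> T" and start: "spread_le \<theta> A l T" and t: "T \<le> t"
  shows "spread_le \<theta> A l t"
proof -
  have Tpos: "0 < T" using T m_pos by (smt (verit) mult_pos_pos)
  have "phase_gap p t \<le> l" if p: "p \<in> A \<times> A" for p
  proof (rule barrier[where P = "A \<times> A" and T = T and S = t
      and x = phase_gap and x' = "\<lambda>p t. \<omega> (fst p) t - \<omega> (snd p) t" and b = "\<lambda>_. l" and b' = "\<lambda>_. 0"])
    fix p s assume *: "p \<in> A \<times> A" "T \<le> s"
    show "(phase_gap p has_real_derivative \<omega> (fst p) s - \<omega> (snd p) s) (at s)"
      using * Tpos A_subset by (intro phase_gap_deriv) auto
    assume **: "phase_gap p s = l" "\<And>q. q \<in> A \<times> A \<Longrightarrow> phase_gap q s \<le> phase_gap p s"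
    have gap: "\<theta> (fst p) s - \<theta> (snd p) s = l" using **(1) by (simp add: phase_gap_def)
    have sp: "spread_le \<theta> A l s" using ** by (simp add: spread_le_phase_gap)
    have "\<eta> * m \<le> s" using T * by simp
    note r = contraction_rate_pos[OF T(1) this]
    have "\<omega> (fst p) s - \<omega> (snd p) s \<le> \<kappa> * (1 - exp (- (s / m)))
         * (2 * lag_bound m \<kappa> V W \<eta> - f_lam lam (\<theta> (fst p) s - \<theta> (snd p) s))"
      using * gap sp l cutoff_bounds T by (intro cluster_velocity_estimate V W) auto
    also have "\<dots> < 0"
      using lag \<kappa>_pos r gap by (intro mult_pos_neg mult_pos_pos) auto
    finally show "\<omega> (fst p) s - \<omega> (snd p) s < 0" .
  qed (use A_finite start p t in \<open>auto simp: spread_le_phase_gap\<close>)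
  thus ?thesis by (simp add: spread_le_phase_gap)
qed

text \<open>At late times the transients in \<open>lag_bound\<close> are so small that the extreme pair approaches at
  a uniform rate while its distance lies between a given \<open>c\<close> above the smaller root and \<open>l\<close>: on that interval
  \<open>f_lam\<close> has a minimum above the level.\<close>
lemma cluster_contracts:
  assumes V: "diffs_le \<nu> A V" and W: "diffs_le \<omega>0 A W"
    and l: "0 < l" "l < cutoff" and lag: "2 * lag_bound m \<kappa> V W \<eta> < f_lam lam l"
    and T: "0 < \<eta>" "\<eta> * m \<le> T" and start: "spread_le \<theta> A l T"
  shows "asymptotic_spread_le \<theta> A (phi1 lam (level m \<kappa> V))"
  unfolding asymptotic_spread_le_def
proof (intro allI impI)
  fix c assume c: "phi1 lam (level m \<kappa> V) < c"
  obtain a where a: "a \<in> A" using A_nonempty by blast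
  have V0: "0 \<le> V" "0 \<le> W" using a diffs_le_nonneg V W by auto
  have lev: "0 < level m \<kappa> V" "level m \<kappa> V < f_lam lam l"
    using level_pos V0 level_le_lag_bound[OF T(1) V0(2), of V] lag by auto
  note P = phi_props[OF l lev]
  note stays = cluster_stays[OF V W l lag T start]
  show "eventually (spread_le \<theta> A c) at_top"
  proof (cases "c \<le> l")
    case False
    have "eventually (\<lambda>t. t \<ge> T) at_top" by (rule eventually_ge_at_top)
    thus ?thesis by eventually_elim (use stays spread_le_mono[of \<theta> A l] False in auto)
  next
    case True
    obtain x0 where x0: "x0 \<in> {c..l}" "\<And>x. x \<in> {c..l} \<Longrightarrow> f_lam lam x0 \<le> f_lam lam x"
      using continuous_attains_inf[of "{c..l}" "f_lam lam"] continuous_f_lam True by force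
    have "level m \<kappa> V < f_lam lam x0" using x0(1) c P by auto
    then obtain \<eta>' where \<eta>': "0 < \<eta>'" "2 * lag_bound m \<kappa> V W \<eta>' < f_lam lam x0"
      using lag_bound_eventually_below[of m V \<kappa> "f_lam lam x0" W] unfolding level_def by blast
    define T' where "T' = max T (\<eta>' * m)"
    define r where "r = \<kappa> * (1 - exp (- \<eta>')) * (f_lam lam x0 - 2 * lag_bound m \<kappa> V W \<eta>')"
    have r: "r > 0" unfolding r_def using \<kappa>_pos \<eta>' by (intro mult_pos_pos) auto
    have T': "T \<le> T'" "\<eta>' * m \<le> T'" by (auto simp: T'_def)
    show ?thesis
    proof (rule eventually_spread_le[OF A_subset _ _ r True, where T = T'])
      show "0 < T'" using T T' m_pos by (smt (verit) mult_pos_pos)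
      show "spread_le \<theta> A l T'" using stays T' by simp
      fix p q t assume *: "p \<in> A" "q \<in> A" "T' \<le> t" "c \<le> \<theta> p t - \<theta> q t" "\<theta> p t - \<theta> q t \<le> l"
        and sp: "spread_le \<theta> A (\<theta> p t - \<theta> q t) t"
      have t: "\<eta>' * m \<le> t" using T' * by simp
      note rr = contraction_rate_pos[OF \<eta>'(1) t]
      have "\<omega> p t - \<omega> q t \<le> \<kappa> * (1 - exp (- (t / m)))
           * (2 * lag_bound m \<kappa> V W \<eta>' - f_lam lam (\<theta> p t - \<theta> q t))"
        using * sp l cutoff_bounds t \<eta>' by (intro cluster_velocity_estimate V W) auto
      also have "\<dots> \<le> \<kappa> * (1 - exp (- (t / m))) * (2 * lag_bound m \<kappa> V W \<eta>' - f_lam lam x0)"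
        using x0(2)[of "\<theta> p t - \<theta> q t"] * \<kappa>_pos rr by (intro mult_left_mono) auto
      also have "\<dots> \<le> \<kappa> * (1 - exp (- \<eta>')) * (2 * lag_bound m \<kappa> V W \<eta>' - f_lam lam x0)"
        using rr \<eta>' \<kappa>_pos by (intro mult_right_mono_neg mult_left_mono) auto
      also have "\<dots> = - r" by (simp add: r_def algebra_simps)
      finally show "\<omega> p t - \<omega> q t \<le> - r" .
    qed
  qed
qed

text \<open>Every member of \<open>U\<close> is asymptotically within \<open>\<psi>\<close> of all of \<open>A\<close>, with \<open>\<psi>\<close> slightly above the smaller
  root. If the extreme phases of \<open>U\<close> are at a distance \<open>x\<close> between \<open>\<psi>\<close> and \<open>2 \<psi>\<close>, then \<open>A\<close> lies within
  \<open>\<psi> - x / 2\<close> of their midpoint, which is at most \<open>\<psi> / 2\<close>. So the pull is at least \<open>f_lam lam \<psi>\<close>, and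
  this exceeds the level.\<close>
lemma union_of_clusters_contracts:
  assumes U: "A \<subseteq> U" "U \<subseteq> {1..N}"
    and V: "diffs_le \<nu> U V"
    and l: "0 < l" "l < cutoff" and lev: "level m \<kappa> V < f_lam lam l"
    and small: "\<And>i. i \<in> U \<Longrightarrow> asymptotic_spread_le \<theta> (insert i A) (phi1 lam (level m \<kappa> V))"
  shows "asymptotic_spread_le \<theta> U (phi1 lam (level m \<kappa> V))"
  unfolding asymptotic_spread_le_def
proof (intro allI impI)
  fix c0 assume c0: "phi1 lam (level m \<kappa> V) < c0"
  obtain a where a: "a \<in> A" using A_nonempty by blast
  have V0: "0 \<le> V" using diffs_le_nonneg[OF V, of a] a U by auto
  have lev0: "0 < level m \<kappa> V" using level_pos V0 by auto
  note P = phi_props[OF l lev0 lev]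
  have fU: "finite U" using U by (auto intro: finite_subset)
  obtain W where W: "diffs_le \<omega>0 U W" using finite_diffs_le[OF fU] .
  have "phi1 lam (level m \<kappa> V) < min c0 (min (pi/2) (phi2 lam (level m \<kappa> V)))"
    using c0 P phi1_less_pi_half[OF l lev0 lev] by auto
  then obtain \<psi> where \<psi>: "phi1 lam (level m \<kappa> V) < \<psi>" "\<psi> < min c0 (min (pi/2) (phi2 lam (level m \<kappa> V)))"
    using dense by blast
  define c where "c = min c0 (2 * \<psi>)"
  have \<psi>0: "0 < \<psi>" "\<psi> < c" "c \<le> 2 * \<psi>" "\<psi> < cutoff" using \<psi> P by (auto simp: c_def)
  have "level m \<kappa> V < f_lam lam \<psi>" using \<psi> P by auto
  then obtain \<eta> where \<eta>: "0 < \<eta>" "2 * lag_bound m \<kappa> V W \<eta> < f_lam lam \<psi>"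
    using lag_bound_eventually_below[of m V \<kappa> "f_lam lam \<psi>" W] unfolding level_def by blast
  have "eventually (\<lambda>t. \<forall>i\<in>U. spread_le \<theta> (insert i A) \<psi> t) at_top"
    using small \<psi>(1) fU by (intro eventually_ball_finite) (auto simp: asymptotic_spread_le_def)
  then obtain T0 where T0: "\<And>i t. t \<ge> T0 \<Longrightarrow> i \<in> U \<Longrightarrow> spread_le \<theta> (insert i A) \<psi> t"
    by (auto simp: eventually_at_top_linorder)
  define T where "T = max T0 (\<eta> * m)"
  have T: "T0 \<le> T" "\<eta> * m \<le> T" by (auto simp: T_def)
  have Tpos: "0 < T" using T \<eta> m_pos by (smt (verit) mult_pos_pos)
  have near: "\<bar>\<theta> i t - \<theta> k t\<bar> \<le> \<psi>" if "i \<in> U" "k \<in> A" "T \<le> t" for i k t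
    using T0[of t i] that T by (simp add: spread_le_def abs_le_iff)
  define r where "r = \<kappa> * (1 - exp (- \<eta>)) * (f_lam lam \<psi> - 2 * lag_bound m \<kappa> V W \<eta>)"
  have r: "r > 0" unfolding r_def using \<kappa>_pos \<eta> by (intro mult_pos_pos) auto
  have "eventually (spread_le \<theta> U c) at_top"
  proof (rule eventually_spread_le[OF U(2) Tpos _ r \<psi>0(3)])
    show "spread_le \<theta> U (2 * \<psi>) T"
      unfolding spread_le_def
    proof (intro ballI)
      fix i j assume "i \<in> U" "j \<in> U"
      thus "\<theta> i T - \<theta> j T \<le> 2 * \<psi>" using near[of i a T] near[of j a T] a by simp
    qed
    fix p q t assume *: "p \<in> U" "q \<in> U" "T \<le> t" "c \<le> \<theta> p t - \<theta> q t" "\<theta> p t - \<theta> q t \<le> 2 * \<psi>"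
    define x where "x = \<theta> p t - \<theta> q t"
    define y where "y = \<psi> - x / 2"
    have t: "\<eta> * m \<le> t" using T * by simp
    note rr = contraction_rate_pos[OF \<eta>(1) t]
    have xb: "\<psi> \<le> x" "x \<le> 2 * \<psi>" using * \<psi>0 by (auto simp: x_def)
    have "\<omega> p t - \<omega> q t \<le> \<kappa> * (1 - exp (- (t / m)))
           * (2 * lag_bound m \<kappa> V W \<eta> - 2 * sin (x/2) * (lam * cos y - (1 - lam)))"
    proof (rule velocity_diff_estimate[OF A_subset A_majority _ _ _ _ x_def])
      fix k assume k: "k \<in> A"
      show "\<bar>\<theta> k t - (\<theta> p t + \<theta> q t) / 2\<bar> \<le> y"
        using near[OF *(1) k *(3)] near[OF *(2) k *(3)] unfolding x_def y_def abs_le_iff by argo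
    next
      show "0 \<le> x" "x \<le> 2 * pi" "y \<le> pi" using xb \<psi>0 \<psi> pi_gt_zero by (auto simp: y_def)
    next
      show "diffs_le \<nu> (insert p (insert q A)) V" "diffs_le \<omega>0 (insert p (insert q A)) W"
        using * U by (auto intro: diffs_le_mono[OF V] diffs_le_mono[OF W])
    qed (use * U t \<eta> in auto)
    also have "\<dots> \<le> \<kappa> * (1 - exp (- (t / m))) * (2 * lag_bound m \<kappa> V W \<eta> - f_lam lam \<psi>)"
    proof -
      have "sin (\<psi>/2) \<le> sin (x/2)" using xb \<psi> \<psi>0 by (intro sin_monotone_2pi_le) auto
      moreover have "cos (\<psi>/2) \<le> cos y" using xb \<psi> \<psi>0 by (intro cos_monotone_0_pi_le) (auto simp: y_def)
      hence "lam * cos (\<psi>/2) - (1 - lam) \<le> lam * cos y - (1 - lam)" using lam_gt_half by simp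
      moreover have "0 \<le> sin (x/2)" using xb \<psi> \<psi>0 by (intro sin_ge_zero) auto
      moreover have "0 \<le> lam * cos (\<psi>/2) - (1 - lam)" using cos_half_gt[of \<psi>] \<psi>0 by simp
      ultimately have "sin (\<psi>/2) * (lam * cos (\<psi>/2) - (1 - lam)) \<le> sin (x/2) * (lam * cos y - (1 - lam))"
        by (intro mult_mono) auto
      hence "f_lam lam \<psi> \<le> 2 * sin (x/2) * (lam * cos y - (1 - lam))"
        by (simp add: f_lam_factor)
      thus ?thesis using \<kappa>_pos rr by (intro mult_left_mono) auto
    qed
    also have "\<dots> \<le> \<kappa> * (1 - exp (- \<eta>)) * (2 * lag_bound m \<kappa> V W \<eta> - f_lam lam \<psi>)"
      using rr \<eta> \<kappa>_pos by (intro mult_right_mono_neg mult_left_mono) auto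
    also have "\<dots> = - r" by (simp add: r_def algebra_simps)
    finally show "\<omega> p t - \<omega> q t \<le> - r" .
  qed
  thus "eventually (spread_le \<theta> U c0) at_top"
    by eventually_elim (rule spread_le_mono, auto simp: c_def)
qed

end

section \<open>Linear arrangement\<close>

text \<open>For a cooperative linear system whose matrix \<open>((-1, 1), (b, -1))\<close> has \<open>0 \<le> b \<le> \<beta> < 1\<close>, both
  components are eventually below every positive number. The second component is weighted by \<open>1 / \<gamma>\<close> with
  \<open>\<beta> < \<gamma> < 1\<close>, which makes the larger of the two functions decrease strictly as long as it is
  at least \<open>e\<close>.\<close>
lemma overdamped_comparison:
  fixes p v v' b :: "real \<Rightarrow> real"
  assumes r: "0 < r" and \<beta>: "\<beta> < 1"
    and p: "\<And>t. T \<le> t \<Longrightarrow> (p has_real_derivative r * (v t - p t)) (at t)"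
    and v: "\<And>t. T \<le> t \<Longrightarrow> (v has_real_derivative v' t) (at t)"
    and v': "\<And>t. T \<le> t \<Longrightarrow> v' t \<le> r * (b t * p t - v t)"
    and b: "\<And>t. T \<le> t \<Longrightarrow> 0 \<le> b t \<and> b t \<le> \<beta>"
    and e: "0 < e"
  shows "eventually (\<lambda>t. p t \<le> e) at_top"
proof -
  define \<gamma> where "\<gamma> = (1 + \<beta>) / 2"
  have \<beta>0: "0 \<le> \<beta>" using b[of T] by linarith
  have \<gamma>: "0 < \<gamma>" "\<beta> < \<gamma>" "\<gamma> < 1" using \<beta> \<beta>0 by (auto simp: \<gamma>_def)
  define x where "x = (\<lambda>i t. if i then p t else v t / \<gamma>)"
  define x' where "x' = (\<lambda>i t. if i then r * (v t - p t) else v' t / \<gamma>)"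
  define c where "c = min (r * (1 - \<gamma>) * e) (r * (1 - \<beta> / \<gamma>) * e)"
  have "0 < r * (1 - \<gamma>) * e" "0 < r * (1 - \<beta> / \<gamma>) * e"
    using r \<gamma> e by (auto simp: field_simps)
  hence c: "0 < c" by (auto simp: c_def)
  have "eventually (\<lambda>t. \<forall>i\<in>(UNIV::bool set). x i t \<le> e) at_top"
  proof (rule eventually_below_level[where x = x and x' = x' and T = T and r = c and l = "max e (max (x True T) (x False T))"])
    show "finite (UNIV :: bool set)" by simp
    show "x i T \<le> max e (max (x True T) (x False T))" for i by (cases i) auto
    fix i t assume t: "T \<le> t"
    show "(x i has_real_derivative x' i t) (at t)"
      unfolding x_def x'_def using p[OF t] v[OF t] \<gamma> by (cases i) (auto intro!: derivative_eq_intros)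
    assume ge: "e \<le> x i t" and mx: "\<And>j. j \<in> UNIV \<Longrightarrow> x j t \<le> x i t"
    show "x' i t \<le> - c"
    proof (cases i)
      case True
      have "v t \<le> \<gamma> * p t" using mx[of False] True \<gamma> by (simp add: x_def field_simps)
      hence "r * (v t - p t) \<le> r * (\<gamma> * p t - p t)" using r by (intro mult_left_mono) auto
      also have "\<dots> = - (r * (1 - \<gamma>) * p t)" by (simp add: algebra_simps)
      also have "\<dots> \<le> - (r * (1 - \<gamma>) * e)"
        using ge True r \<gamma> by (auto simp: x_def intro!: mult_left_mono)
      finally show ?thesis using True by (simp add: x'_def c_def)
    next
      case False
      define w where "w = v t / \<gamma>"
      have w: "e \<le> w" "p t \<le> w" "v t = \<gamma> * w" using False ge mx[of True] \<gamma> by (auto simp: x_def w_def)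
      have "b t * p t \<le> \<beta> * w"
      proof -
        have "b t * p t \<le> b t * w" using b[OF t] w by (intro mult_left_mono) auto
        also have "\<dots> \<le> \<beta> * w" using b[OF t] w e by (intro mult_right_mono) auto
        finally show ?thesis .
      qed
      hence "r * (b t * p t - v t) \<le> r * (\<beta> * w - \<gamma> * w)" using r w by (intro mult_left_mono) auto
      hence "v' t / \<gamma> \<le> r * (\<beta> * w - \<gamma> * w) / \<gamma>" using v'[OF t] \<gamma> by (intro divide_right_mono) auto
      also have "\<dots> = - (r * (1 - \<beta> / \<gamma>) * w)" using \<gamma> by (simp add: field_simps)
      also have "\<dots> \<le> - (r * (1 - \<beta> / \<gamma>) * e)"
      proof -
        have "0 \<le> r * (1 - \<beta> / \<gamma>)" using r \<gamma> by simp
        from mult_left_mono[OF w(1) this] show ?thesis by simp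
      qed
      finally show ?thesis using False by (simp add: x'_def c_def)
    qed
  qed (use c in auto)
  hence "eventually (\<lambda>t. x True t \<le> e) at_top" by eventually_elim blast
  thus ?thesis by (simp add: x_def)
qed

lemma Limsup_ereal_le_iff:
  "Limsup at_top (\<lambda>t::real. ereal (f t)) \<le> ereal c \<longleftrightarrow> (\<forall>c'>c. eventually (\<lambda>t. f t \<le> c') at_top)"
proof
  assume *: "Limsup at_top (\<lambda>t. ereal (f t)) \<le> ereal c"
  show "\<forall>c'>c. eventually (\<lambda>t. f t \<le> c') at_top"
  proof (intro allI impI)
    fix c' assume "c < c'"
    hence "Limsup at_top (\<lambda>t. ereal (f t)) < ereal c'" using * by (auto intro: le_less_trans)
    hence "eventually (\<lambda>t. ereal (f t) < ereal c') at_top" by (rule Limsup_lessD)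
    thus "eventually (\<lambda>t. f t \<le> c') at_top" by eventually_elim simp
  qed
next
  assume *: "\<forall>c'>c. eventually (\<lambda>t. f t \<le> c') at_top"
  show "Limsup at_top (\<lambda>t. ereal (f t)) \<le> ereal c"
  proof (rule ereal_le_epsilon2)
    fix e :: real assume "0 < e"
    hence "eventually (\<lambda>t. f t \<le> c + e) at_top" using * by simp
    hence "Limsup at_top (\<lambda>t. ereal (f t)) \<le> ereal (c + e)"
      by (intro Limsup_bounded) (auto elim: eventually_mono)
    thus "Limsup at_top (\<lambda>t. ereal (f t)) \<le> ereal c + ereal e" by simp
  qed
qed

lemma le_Liminf_ereal_iff:
  "ereal c \<le> Liminf at_top f \<longleftrightarrow> (\<forall>c'<c. eventually (\<lambda>t::real. ereal c' \<le> f t) at_top)"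
proof
  assume *: "ereal c \<le> Liminf at_top f"
  show "\<forall>c'<c. eventually (\<lambda>t. ereal c' \<le> f t) at_top"
  proof (intro allI impI)
    fix c' assume "c' < c"
    hence "ereal c' < ereal c" by simp
    hence "ereal c' < Liminf at_top f" using * by (rule less_le_trans)
    hence "eventually (\<lambda>t. ereal c' < f t) at_top" by (rule less_LiminfD)
    thus "eventually (\<lambda>t. ereal c' \<le> f t) at_top" by eventually_elim simp
  qed
next
  assume *: "\<forall>c'<c. eventually (\<lambda>t. ereal c' \<le> f t) at_top"
  show "ereal c \<le> Liminf at_top f"
  proof (rule ereal_le_epsilon2)
    fix e :: real assume "0 < e"
    hence "eventually (\<lambda>t. ereal (c - e) \<le> f t) at_top" using * by simp
    hence "ereal (c - e) \<le> Liminf at_top f" by (intro Liminf_bounded) auto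
    hence "ereal (c - e) + ereal e \<le> Liminf at_top f + ereal e" by (intro add_right_mono)
    thus "ereal c \<le> Liminf at_top f + ereal e" by simp
  qed
qed

context majority_kuramoto
begin

lemma majority_cos_sum_ge:
  assumes near: "\<And>k. k \<in> A \<Longrightarrow> \<bar>\<theta> k t - c\<bar> \<le> \<phi>" and \<phi>: "\<phi> \<le> pi"
  shows "real N * (lam * cos \<phi> - (1 - lam)) \<le> (\<Sum>k=1..N. cos (\<theta> k t - c))"
proof -
  have "real (card A) * cos \<phi> \<le> (\<Sum>k\<in>A. cos (\<theta> k t - c))"
  proof (intro sum_bounded_below)
    fix k assume "k \<in> A"
    hence "cos \<phi> \<le> cos \<bar>\<theta> k t - c\<bar>" using near \<phi> by (intro cos_monotone_0_pi_le) auto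
    thus "cos \<phi> \<le> cos (\<theta> k t - c)" by simp
  qed
  moreover have "real (card ({1..N} - A)) * (- 1) \<le> (\<Sum>k\<in>{1..N} - A. cos (\<theta> k t - c))"
    by (intro sum_bounded_below) auto
  moreover have "real (card ({1..N} - A)) = real N - real (card A)"
    using A_subset A_finite card_mono[OF _ A_subset] by (simp add: card_Diff_subset of_nat_diff)
  moreover have "(\<Sum>k=1..N. cos (\<theta> k t - c)) = (\<Sum>k\<in>A. cos (\<theta> k t - c)) + (\<Sum>k\<in>{1..N} - A. cos (\<theta> k t - c))"
    using A_subset by (metis add.commute finite_atLeastAtMost sum.subset_diff)
  moreover have "lam * real N * (1 + cos \<phi>) \<le> real (card A) * (1 + cos \<phi>)"
    using A_majority cos_ge_minus_one[of \<phi>] by (intro mult_right_mono) linarith+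
  ultimately show ?thesis by (simp add: algebra_simps)
qed

definition arrangement_factor :: "real \<Rightarrow> real" where
  "arrangement_factor \<phi> = \<phi> / (2 * sin (\<phi> / 2) * (lam * cos \<phi> - (1 - lam)))"

text \<open>The difference \<open>x\<close> solves \<open>m x'' + x' + a x = \<Delta>\<close>, where \<open>a\<close> lies between \<open>a1\<close> and \<open>\<kappa>\<close> as
  long as the cluster has diameter at most \<open>\<phi>\<close>. With \<open>u = x + 2 m x'\<close> and \<open>r = 1 / (2 m)\<close> this reads
  \<open>x' = r (u - x)\<close>, \<open>u' = r ((1 - 4 m a) x - u) + 2 \<Delta>\<close>, which is cooperative because \<open>4 m \<kappa> < 1\<close>.
  Subtracting \<open>\<Delta> / a1\<close> or \<open>\<Delta> / \<kappa>\<close> from both components leaves an inhomogeneity of one sign.\<close>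
lemma pair_eventually_bounds:
  assumes ij: "i \<in> A" "j \<in> A" and \<nu>: "\<nu> j \<le> \<nu> i" and overdamped: "4 * m * \<kappa> < 1"
    and \<phi>: "0 < \<phi>" "\<phi> < cutoff / 2" and sp: "eventually (spread_le \<theta> A \<phi>) at_top"
    and e: "0 < e"
  shows "eventually (\<lambda>t. \<theta> i t - \<theta> j t \<le> arrangement_factor \<phi> * ((\<nu> i - \<nu> j) / \<kappa>) + e) at_top"
    and "eventually (\<lambda>t. (\<nu> i - \<nu> j) / \<kappa> \<le> \<theta> i t - \<theta> j t + e) at_top"
proof -
  define \<Delta> where "\<Delta> = \<nu> i - \<nu> j"
  define x where "x = (\<lambda>t. \<theta> i t - \<theta> j t)"
  define w where "w = (\<lambda>t. \<omega> i t - \<omega> j t)"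
  define q where "q = (\<lambda>t. (\<Sum>k=1..N. cos (\<theta> k t - (\<theta> i t + \<theta> j t) / 2)) / real N)"
  define s where "s = (\<lambda>t. if x t = 0 then 1 else 2 * sin (x t / 2) / x t)"
  define a where "a = (\<lambda>t. \<kappa> * q t * s t)"
  define r where "r = 1 / (2 * m)"
  define u where "u = (\<lambda>t. x t + 2 * m * w t)"
  have r: "0 < r" "r * (2 * m) = 1" using m_pos by (auto simp: r_def)
  have \<Delta>0: "0 \<le> \<Delta>" using \<nu> by (simp add: \<Delta>_def)
  have ijN: "i \<in> {1..N}" "j \<in> {1..N}" using ij A_subset by auto
  have force: "force i t - force j t = \<Delta> - a t * x t" for t
  proof -
    have "force i t - force j t = \<Delta> + \<kappa> / real N * (\<Sum>k=1..N. sin (\<theta> k t - \<theta> i t) - sin (\<theta> k t - \<theta> j t))"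
      by (simp add: force_def \<Delta>_def sum_subtractf algebra_simps)
    also have "(\<Sum>k=1..N. sin (\<theta> k t - \<theta> i t) - sin (\<theta> k t - \<theta> j t))
        = - 2 * sin (x t / 2) * (\<Sum>k=1..N. cos (\<theta> k t - (\<theta> i t + \<theta> j t) / 2))"
      by (simp add: sin_diff_about_midpoint x_def sum_distrib_left)
    also have "\<kappa> / real N * (- 2 * sin (x t / 2) * (\<Sum>k=1..N. cos (\<theta> k t - (\<theta> i t + \<theta> j t) / 2)))
        = - (\<kappa> * q t * (2 * sin (x t / 2)))" by (simp add: q_def)
    also have "2 * sin (x t / 2) = s t * x t" by (simp add: s_def)
    finally show ?thesis by (simp add: a_def)
  qed
  have ruw: "r * (u t - x t) = w t" for t
  proof -
    have "r * (u t - x t) = (r * (2 * m)) * w t" by (simp add: u_def)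
    thus ?thesis by (simp only: r mult_1_left)
  qed
  have x': "(x has_real_derivative r * (u t - x t)) (at t)" if "t > 0" for t
  proof -
    have "(x has_real_derivative w t) (at t)"
      unfolding x_def w_def using that ijN by (intro DERIV_diff phase_deriv)
    moreover have "r * (u t - x t) = w t" by (rule ruw)
    ultimately show ?thesis by simp
  qed
  define du where "du = (\<lambda>t. r * (x t - u t) + 2 * (\<Delta> - a t * x t))"
  have u': "(u has_real_derivative du t) (at t)" if "t > 0" for t
  proof -
    have "(u has_real_derivative r * (u t - x t)
        + 2 * m * ((force i t - \<omega> i t) / m - (force j t - \<omega> j t) / m)) (at t)"
      unfolding u_def[abs_def] w_def[abs_def]
      using x'[OF that] that ijN by (auto intro!: derivative_eq_intros velocity_deriv simp: u_def w_def)
    moreover have "2 * m * ((force i t - \<omega> i t) / m - (force j t - \<omega> j t) / m)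
        = 2 * (force i t - force j t) - 2 * w t"
      using m_pos by (simp add: field_simps w_def)
    moreover have "2 * w t = 2 * (r * (u t - x t))" by (simp only: ruw)
    ultimately have "(u has_real_derivative r * (u t - x t) + (2 * (\<Delta> - a t * x t) - 2 * (r * (u t - x t)))) (at t)"
      by (simp only: force)
    thus ?thesis by (simp add: du_def algebra_simps)
  qed
  define Q where "Q = lam * cos \<phi> - (1 - lam)"
  define S where "S = 2 * sin (\<phi> / 2) / \<phi>"
  define a1 where "a1 = \<kappa> * Q * S"
  have Q: "0 < Q" using cos_half_gt[of "2 * \<phi>"] \<phi> by (simp add: Q_def)
  have \<phi>pi: "\<phi> < pi / 2" using \<phi> cutoff_bounds by simp
  have "0 < sin (\<phi> / 2)" using \<phi> \<phi>pi by (intro sin_gt_zero) auto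
  hence S: "0 < S" using \<phi> by (simp add: S_def)
  have a1: "0 < a1" using Q S \<kappa>_pos by (simp add: a1_def)
  have a_bounds: "a1 \<le> a t" "a t \<le> \<kappa>" if sp: "spread_le \<theta> A \<phi> t" for t
  proof -
    have near: "\<bar>\<theta> k t - (\<theta> i t + \<theta> j t) / 2\<bar> \<le> \<phi>" if "k \<in> A" for k
    proof -
      have "\<theta> k t - \<theta> i t \<le> \<phi>" "\<theta> k t - \<theta> j t \<le> \<phi>" "\<theta> i t - \<theta> k t \<le> \<phi>" "\<theta> j t - \<theta> k t \<le> \<phi>"
        using sp that ij by (auto simp: spread_le_def)
      thus ?thesis unfolding abs_le_iff by argo
    qed
    have "real N * Q \<le> (\<Sum>k=1..N. cos (\<theta> k t - (\<theta> i t + \<theta> j t) / 2))"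
      unfolding Q_def using \<phi>pi \<phi> near by (intro majority_cos_sum_ge) auto
    hence q1: "Q \<le> q t" using N_ge_1 by (simp add: q_def field_simps)
    have "(\<Sum>k=1..N. cos (\<theta> k t - (\<theta> i t + \<theta> j t) / 2)) \<le> (\<Sum>k=1..N. 1)"
      by (intro sum_mono) auto
    hence q2: "q t \<le> 1" using N_ge_1 by (simp add: q_def field_simps)
    have xb: "\<bar>x t\<bar> \<le> \<phi>" using sp ij by (auto simp: spread_le_def x_def abs_le_iff)
    have s_even: "s t = (if x t = 0 then 1 else 2 * sin (\<bar>x t\<bar> / 2) / \<bar>x t\<bar>)"
      by (simp add: s_def abs_if)
    have s2: "s t \<le> 1" unfolding s_even using sin_x_le_x[of "\<bar>x t\<bar> / 2"] by (auto simp: field_simps)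
    have S1: "S \<le> 1" using sin_x_le_x[of "\<phi> / 2"] \<phi> by (simp add: S_def field_simps)
    have "\<bar>x t\<bar> / 2 * sin (\<phi> / 2) \<le> \<phi> / 2 * sin (\<bar>x t\<bar> / 2)"
      using xb \<phi> \<phi>pi by (intro sin_chord) auto
    hence s1: "S \<le> s t" using \<phi> S1 unfolding s_even S_def by (auto simp: field_simps)
    have "Q * S \<le> q t * s t" using q1 s1 Q S by (intro mult_mono) auto
    thus "a1 \<le> a t" unfolding a_def a1_def using \<kappa>_pos by (simp add: mult.assoc)
    have "q t * s t \<le> 1 * 1" using q2 s2 q1 s1 Q S by (intro mult_mono) auto
    thus "a t \<le> \<kappa>" unfolding a_def using \<kappa>_pos by (simp add: mult.assoc)
  qed
  obtain T0 where T0: "\<And>t. t \<ge> T0 \<Longrightarrow> spread_le \<theta> A \<phi> t"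
    using sp by (auto simp: eventually_at_top_linorder)
  define T where "T = max 1 T0"
  have T: "0 < t" "a1 \<le> a t" "a t \<le> \<kappa>" if "T \<le> t" for t
    using that T0 a_bounds by (auto simp: T_def)
  have b: "0 \<le> 1 - 4 * m * a t \<and> 1 - 4 * m * a t \<le> 1 - 4 * m * a1" if "T \<le> t" for t
  proof -
    have "m * a1 \<le> m * a t" "m * a t \<le> m * \<kappa>" using T[OF that] m_pos by auto
    thus ?thesis using overdamped by simp
  qed
  have ra: "2 * a t = r * (4 * m * a t)" for t using m_pos by (simp add: r_def)
  have "eventually (\<lambda>t. x t - \<Delta> / a1 \<le> e) at_top"
  proof (rule overdamped_comparison[where r = r and \<beta> = "1 - 4 * m * a1" and T = T and v = "\<lambda>t. u t - \<Delta> / a1"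
        and v' = du and b = "\<lambda>t. 1 - 4 * m * a t"])
    show "1 - 4 * m * a1 < 1" using m_pos a1 by simp
    fix t assume t: "T \<le> t"
    show "((\<lambda>t. x t - \<Delta> / a1) has_real_derivative r * (u t - \<Delta> / a1 - (x t - \<Delta> / a1))) (at t)"
      using x'[of t] T[OF t] by (auto intro!: derivative_eq_intros)
    show "((\<lambda>t. u t - \<Delta> / a1) has_real_derivative du t) (at t)"
      using u'[of t] T[OF t] by (auto intro!: derivative_eq_intros)
    have "\<Delta> \<le> a t * (\<Delta> / a1)"
      using T[OF t] a1 \<Delta>0 mult_right_mono[of a1 "a t" \<Delta>] by (simp add: field_simps)
    hence "du t \<le> r * (x t - u t) + 2 * (a t * (\<Delta> / a1) - a t * x t)" by (simp add: du_def)
    also have "\<dots> = r * (x t - u t) - 2 * a t * (x t - \<Delta> / a1)" by (simp add: algebra_simps)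
    also have "\<dots> = r * ((1 - 4 * m * a t) * (x t - \<Delta> / a1) - (u t - \<Delta> / a1))"
      unfolding ra by (simp add: algebra_simps)
    finally show "du t \<le> \<dots>" .
  qed (use r b e in auto)
  moreover have "\<Delta> / a1 = arrangement_factor \<phi> * (\<Delta> / \<kappa>)"
    unfolding arrangement_factor_def a1_def S_def Q_def[symmetric] by (simp add: mult_ac)
  ultimately show "eventually (\<lambda>t. \<theta> i t - \<theta> j t \<le> arrangement_factor \<phi> * ((\<nu> i - \<nu> j) / \<kappa>) + e) at_top"
    by (simp add: x_def \<Delta>_def algebra_simps)
  have "eventually (\<lambda>t. \<Delta> / \<kappa> - x t \<le> e) at_top"
  proof (rule overdamped_comparison[where r = r and \<beta> = "1 - 4 * m * a1" and T = T and v = "\<lambda>t. \<Delta> / \<kappa> - u t"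
        and v' = "\<lambda>t. - du t" and b = "\<lambda>t. 1 - 4 * m * a t"])
    show "1 - 4 * m * a1 < 1" using m_pos a1 by simp
    fix t assume t: "T \<le> t"
    show "((\<lambda>t. \<Delta> / \<kappa> - x t) has_real_derivative r * (\<Delta> / \<kappa> - u t - (\<Delta> / \<kappa> - x t))) (at t)"
      using x'[of t] T[OF t] by (auto intro!: derivative_eq_intros simp: algebra_simps)
    show "((\<lambda>t. \<Delta> / \<kappa> - u t) has_real_derivative - du t) (at t)"
      using u'[of t] T[OF t] by (auto intro!: derivative_eq_intros)
    have "a t * (\<Delta> / \<kappa>) \<le> \<Delta>"
      using T[OF t] \<kappa>_pos \<Delta>0 mult_right_mono[of "a t" \<kappa> \<Delta>] by (simp add: field_simps)
    hence "- du t \<le> - (r * (x t - u t) + 2 * (a t * (\<Delta> / \<kappa>) - a t * x t))" by (simp add: du_def)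
    also have "\<dots> = r * (u t - x t) - 2 * a t * (\<Delta> / \<kappa> - x t)" by (simp add: algebra_simps)
    also have "\<dots> = r * ((1 - 4 * m * a t) * (\<Delta> / \<kappa> - x t) - (\<Delta> / \<kappa> - u t))"
      unfolding ra by (simp add: algebra_simps)
    finally show "- du t \<le> \<dots>" .
  qed (use r b e in auto)
  thus "eventually (\<lambda>t. (\<nu> i - \<nu> j) / \<kappa> \<le> \<theta> i t - \<theta> j t + e) at_top"
    by eventually_elim (simp add: x_def \<Delta>_def)
qed

text \<open>The bounds for a diameter \<open>\<phi>'\<close> slightly above \<open>\<phi>\<close> pass to the limit because the upper one is
  continuous in \<open>\<phi>'\<close>.\<close>
lemma linear_arrangement:
  assumes overdamped: "4 * m * \<kappa> < 1" and \<phi>: "0 < \<phi>" "\<phi> < cutoff / 2"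
    and sp: "asymptotic_spread_le \<theta> A \<phi>"
  shows "linearly_arranged \<kappa> \<nu> lam \<phi> \<theta> A"
  unfolding linearly_arranged_def arrangement_factor_def[symmetric]
proof (intro ballI impI conjI)
  fix i j assume ij: "i \<in> A" "j \<in> A" and \<nu>: "\<nu> j \<le> \<nu> i"
  define G where "G = (\<lambda>\<phi>. arrangement_factor \<phi> * ((\<nu> i - \<nu> j) / \<kappa>))"
  have \<phi>pi: "\<phi> < pi / 2" using \<phi> cutoff_bounds by simp
  note bounds = pair_eventually_bounds[OF ij \<nu> overdamped]
  have ev: "eventually (spread_le \<theta> A \<phi>') at_top" if "\<phi> < \<phi>'" for \<phi>'
    using sp that by (simp add: asymptotic_spread_le_def)
  show "ereal ((\<nu> i - \<nu> j) / \<kappa>) \<le> Liminf at_top (\<lambda>t. ereal (\<theta> i t - \<theta> j t))"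
    unfolding le_Liminf_ereal_iff
  proof (intro allI impI)
    fix c assume c: "c < (\<nu> i - \<nu> j) / \<kappa>"
    obtain \<phi>' where \<phi>': "\<phi> < \<phi>'" "\<phi>' < cutoff / 2" using dense \<phi> by blast
    have "eventually (\<lambda>t. (\<nu> i - \<nu> j) / \<kappa> \<le> \<theta> i t - \<theta> j t + ((\<nu> i - \<nu> j) / \<kappa> - c)) at_top"
      using \<phi> \<phi>' c by (intro bounds(2)[of \<phi>'] ev) auto
    thus "eventually (\<lambda>t. ereal c \<le> ereal (\<theta> i t - \<theta> j t)) at_top" by eventually_elim simp
  qed
  show "Liminf at_top (\<lambda>t. ereal (\<theta> i t - \<theta> j t)) \<le> Limsup at_top (\<lambda>t. ereal (\<theta> i t - \<theta> j t))"
    by (intro Liminf_le_Limsup) auto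
  show "Limsup at_top (\<lambda>t. ereal (\<theta> i t - \<theta> j t)) \<le> ereal (arrangement_factor \<phi> * ((\<nu> i - \<nu> j) / \<kappa>))"
    unfolding Limsup_ereal_le_iff
  proof (intro allI impI)
    fix c assume "arrangement_factor \<phi> * ((\<nu> i - \<nu> j) / \<kappa>) < c"
    hence c: "G \<phi> < c" by (simp add: G_def)
    have "0 < sin (\<phi> / 2)" using \<phi> \<phi>pi by (intro sin_gt_zero) auto
    moreover have "0 < lam * cos \<phi> - (1 - lam)" using cos_half_gt[of "2 * \<phi>"] \<phi> by simp
    ultimately have "isCont G \<phi>" unfolding G_def arrangement_factor_def by (intro continuous_intros) auto
    hence "(G \<longlongrightarrow> G \<phi>) (at_right \<phi>)" by (auto simp: isCont_def intro: tendsto_within_subset)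
    hence "eventually (\<lambda>\<phi>'. G \<phi>' < c) (at_right \<phi>)" using c by (rule order_tendstoD)
    moreover have "eventually (\<lambda>\<phi>'. \<phi>' \<in> {\<phi><..<cutoff / 2}) (at_right \<phi>)"
      using \<phi> by (intro eventually_at_right_real) auto
    ultimately have "eventually (\<lambda>\<phi>'. G \<phi>' < c \<and> \<phi>' \<in> {\<phi><..<cutoff / 2}) (at_right \<phi>)"
      by eventually_elim auto
    then obtain \<phi>' where \<phi>': "G \<phi>' < c" "\<phi> < \<phi>'" "\<phi>' < cutoff / 2"
      using eventually_happens'[OF trivial_limit_at_right_real] by fastforce
    have "eventually (\<lambda>t. \<theta> i t - \<theta> j t \<le> G \<phi>' + (c - G \<phi>')) at_top"
      unfolding G_def using \<phi> \<phi>' by (intro bounds(1)[of \<phi>'] ev) (auto simp: G_def)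
    thus "eventually (\<lambda>t. \<theta> i t - \<theta> j t \<le> c) at_top" by eventually_elim simp
  qed
qed

end

section \<open>Tools for convergence\<close>

lemma frequently_at_top_real: "(\<exists>\<^sub>F t in at_top. P (t::real)) \<longleftrightarrow> (\<forall>M. \<exists>t>M. P t)"
  unfolding frequently_def eventually_at_top_dense by auto

text \<open>A bounded continuous function that does not converge takes every value strictly between its
  lower and upper limit at arbitrarily late times. Convergence can therefore be shown by excluding that a
  whole interval of values recurs.\<close>
lemma converges_if_no_recurrent_interval:
  fixes f :: "real \<Rightarrow> real"
  assumes cont: "continuous_on {T..} f" and bdd: "\<And>t. T \<le> t \<Longrightarrow> \<bar>f t\<bar> \<le> B"
    and rec: "\<And>a b. a < b \<Longrightarrow> (\<And>s. a \<le> s \<Longrightarrow> s \<le> b \<Longrightarrow> \<exists>\<^sub>F t in at_top. f t = s) \<Longrightarrow> False"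
  shows "\<exists>L. (f \<longlongrightarrow> L) at_top"
proof -
  let ?g = "\<lambda>t. ereal (f t)"
  have evB: "eventually (\<lambda>t. ereal (- B) \<le> ?g t \<and> ?g t \<le> ereal B) at_top"
    using eventually_ge_at_top[of T] by eventually_elim (use bdd in \<open>auto simp: abs_le_iff\<close>, force)
  have lo: "ereal (- B) \<le> Liminf at_top ?g" by (intro Liminf_bounded) (use evB in \<open>auto elim: eventually_mono\<close>)
  have hi: "Limsup at_top ?g \<le> ereal B" by (intro Limsup_bounded) (use evB in \<open>auto elim: eventually_mono\<close>)
  have le: "Liminf at_top ?g \<le> Limsup at_top ?g" by (intro Liminf_le_Limsup) auto
  have "Liminf at_top ?g = Limsup at_top ?g"
  proof (rule ccontr)
    assume "Liminf at_top ?g \<noteq> Limsup at_top ?g"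
    hence "Liminf at_top ?g < Limsup at_top ?g" using le by simp
    then obtain a where a: "Liminf at_top ?g < ereal a" "ereal a < Limsup at_top ?g"
      using ereal_dense2 by blast
    obtain b where b: "ereal a < ereal b" "ereal b < Limsup at_top ?g"
      using ereal_dense2[OF a(2)] by blast
    have fa: "\<exists>\<^sub>F t in at_top. f t < a"
    proof (rule ccontr)
      assume "\<not> (\<exists>\<^sub>F t in at_top. f t < a)"
      hence "eventually (\<lambda>t. ereal a \<le> ?g t) at_top" by (simp add: not_frequently not_less)
      hence "ereal a \<le> Liminf at_top ?g" by (rule Liminf_bounded)
      thus False using a by simp
    qed
    have fb: "\<exists>\<^sub>F t in at_top. b < f t"
    proof (rule ccontr)
      assume "\<not> (\<exists>\<^sub>F t in at_top. b < f t)"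
      hence "eventually (\<lambda>t. ?g t \<le> ereal b) at_top" by (simp add: not_frequently not_less)
      hence "Limsup at_top ?g \<le> ereal b" by (rule Limsup_bounded)
      thus False using b by simp
    qed
    have "\<exists>\<^sub>F t in at_top. f t = s" if s: "a \<le> s" "s \<le> b" for s
      unfolding frequently_at_top_real
    proof
      fix M
      obtain u where u: "u > max M T" "f u < a" using fa unfolding frequently_at_top_real by blast
      obtain v where v: "v > u" "b < f v" using fb unfolding frequently_at_top_real by blast
      have "\<exists>t\<ge>u. t \<le> v \<and> f t = s"
        using u v s by (intro IVT' continuous_on_subset[OF cont]) auto
      then obtain t where "u \<le> t" "f t = s" by blast
      thus "\<exists>t>M. f t = s" using u(1) by (intro exI[of _ t]) simp
    qed
    thus False using rec[of a b] b by simp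
  qed
  then obtain L where L: "Liminf at_top ?g = L" "Limsup at_top ?g = L" by simp
  obtain l where l: "L = ereal l" using lo hi L by (cases L) auto
  have "(?g \<longlongrightarrow> ereal l) at_top" using L l by (subst tendsto_iff_Liminf_eq_Limsup) auto
  hence "(f \<longlongrightarrow> l) at_top" by simp
  thus ?thesis ..
qed

lemma lipschitz_of_deriv_bound:
  fixes f f' :: "real \<Rightarrow> real"
  assumes "\<And>t. T \<le> t \<Longrightarrow> (f has_real_derivative f' t) (at t)" "\<And>t. T \<le> t \<Longrightarrow> \<bar>f' t\<bar> \<le> K"
    and "T \<le> s" "T \<le> t"
  shows "\<bar>f s - f t\<bar> \<le> K * \<bar>s - t\<bar>"
proof -
  have one: "\<bar>f v - f u\<bar> \<le> K * \<bar>v - u\<bar>" if uv: "T \<le> u" "u < v" for u v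
  proof -
    obtain z where z: "u < z" "z < v" "f v - f u = (v - u) * f' z"
      using MVT2[OF uv(2), of f f'] assms(1) uv(1) by (auto intro: order_trans)
    have "\<bar>f v - f u\<bar> = \<bar>f' z\<bar> * (v - u)" using z uv by (simp add: abs_mult)
    also have "\<dots> \<le> K * (v - u)" using assms(2)[of z] z uv by (intro mult_right_mono) auto
    finally show ?thesis using uv by simp
  qed
  show ?thesis
    using one[of s t] one[of t s] assms by (cases s t rule: linorder_cases) (auto simp: abs_minus_commute)
qed

text \<open>If the derivative is Lipschitz, its value at \<open>t\<close> differs by at most \<open>\<bar>K\<bar> h\<close> from a difference
  quotient of step \<open>h\<close>, and for fixed \<open>h\<close> these quotients vanish in the limit.\<close>
lemma barbalat:
  fixes f f' :: "real \<Rightarrow> real"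
  assumes deriv: "\<And>t. T \<le> t \<Longrightarrow> (f has_real_derivative f' t) (at t)"
    and lip: "\<And>s t. T \<le> s \<Longrightarrow> T \<le> t \<Longrightarrow> \<bar>f' s - f' t\<bar> \<le> K * \<bar>s - t\<bar>"
    and lim: "(f \<longlongrightarrow> L) at_top"
  shows "(f' \<longlongrightarrow> 0) at_top"
proof (rule tendstoI)
  fix e :: real assume e: "0 < e"
  define h where "h = e / (2 * (\<bar>K\<bar> + 1))"
  have h: "0 < h" "\<bar>K\<bar> * h < e / 2" using e by (auto simp: h_def field_simps add_pos_nonneg)
  have "0 < e * h / 4" using e h by simp
  hence "eventually (\<lambda>t. dist (f t) L < e * h / 4) at_top" using lim by (rule tendstoD[rotated])
  then obtain M where M: "\<And>t. t \<ge> M \<Longrightarrow> dist (f t) L < e * h / 4"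
    by (auto simp: eventually_at_top_linorder)
  have "dist (f' t) 0 < e" if t: "max M T \<le> t" for t
  proof -
    obtain z where z: "t < z" "z < t + h" "f (t + h) - f t = (t + h - t) * f' z"
      using MVT2[of t "t + h" f f'] deriv h t by auto
    have "h * \<bar>f' z\<bar> = \<bar>f (t + h) - f t\<bar>" using z h by (simp add: abs_mult)
    also have "\<dots> < h * (e / 2)"
    proof -
      have "\<bar>f t - L\<bar> < e * h / 4" "\<bar>f (t + h) - L\<bar> < e * h / 4"
        using M[of t] M[of "t + h"] t h by (auto simp: dist_real_def)
      hence "\<bar>f (t + h) - f t\<bar> < e * h / 4 + e * h / 4" by linarith
      thus ?thesis by (simp add: mult_ac)
    qed
    finally have "\<bar>f' z\<bar> < e / 2" using h by simp
    moreover have "\<bar>f' t - f' z\<bar> \<le> K * \<bar>t - z\<bar>" using t z by (intro lip) auto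
    moreover have "K * \<bar>t - z\<bar> \<le> \<bar>K\<bar> * h" using z h by (intro mult_mono) auto
    ultimately show ?thesis using h by (simp add: dist_real_def)
  qed
  with eventually_ge_at_top[of "max M T"] show "eventually (\<lambda>t. dist (f' t) 0 < e) at_top"
    by (auto elim: eventually_mono)
qed

lemma nonincreasing_bounded_converges:
  fixes f :: "real \<Rightarrow> real"
  assumes "\<And>s t. T \<le> s \<Longrightarrow> s \<le> t \<Longrightarrow> f t \<le> f s" "\<And>t. T \<le> t \<Longrightarrow> B \<le> f t"
  shows "\<exists>L. (f \<longlongrightarrow> L) at_top"
proof -
  have bdd: "bdd_below (f ` {T..})" using assms(2) by (auto intro!: bdd_belowI[of _ B])
  have "(f \<longlongrightarrow> Inf (f ` {T..})) at_top"
  proof (rule decreasing_tendsto)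
    show "eventually (\<lambda>t. Inf (f ` {T..}) \<le> f t) at_top"
      using eventually_ge_at_top[of T] by eventually_elim (auto intro!: cInf_lower bdd)
    fix x assume "Inf (f ` {T..}) < x"
    then obtain s where s: "T \<le> s" "f s < x" using bdd by (subst (asm) cInf_less_iff) auto
    show "eventually (\<lambda>t. f t < x) at_top"
      using eventually_ge_at_top[of s] by eventually_elim (use assms(1)[of s] s in force)
  qed
  thus ?thesis ..
qed

text \<open>With \<open>n\<close> oscillators, the equation for the modulus \<open>s\<close> of the order parameter when \<open>\<sigma> i\<close> is the component of
  the order parameter orthogonal to the phase of \<open>i\<close>; the signs are those of the parallel components.\<close>
definition self_consistent :: "'i set \<Rightarrow> real \<Rightarrow> ('i \<Rightarrow> real) \<Rightarrow> real \<Rightarrow> bool" where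
  "self_consistent I n \<sigma> s \<longleftrightarrow>
     (\<exists>e\<in>PiE I (\<lambda>_. {-1, 1}). n * s\<^sup>2 = (\<Sum>i\<in>I. e i * sqrt (s\<^sup>2 - (\<sigma> i)\<^sup>2)))"

text \<open>For each choice of signs the two sides of the equation extend holomorphically to a half-plane
  to the right of all \<open>\<bar>\<sigma> i\<bar>\<close>. Infinitely many solutions in a compact interval would make them equal
  on the whole half-plane, but for large real arguments the left-hand side grows quadratically and the
  right-hand side only linearly.\<close>
lemma self_consistent_radii_finite:
  fixes \<sigma> :: "'i \<Rightarrow> real" and n :: real
  assumes I: "finite I" and n: "real (card I) \<le> n" "0 < n"
    and M: "0 \<le> M" "\<And>i. i \<in> I \<Longrightarrow> \<bar>\<sigma> i\<bar> \<le> M" "M < a"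
  shows "finite {s \<in> {a..b}. self_consistent I n \<sigma> s}"
proof -
  have "finite {s \<in> {a..b}. n * s\<^sup>2 = (\<Sum>i\<in>I. e i * sqrt (s\<^sup>2 - (\<sigma> i)\<^sup>2))}" (is "finite ?Z")
    if e: "e \<in> PiE I (\<lambda>_. {-1, 1::real})" for e
  proof (rule ccontr)
    assume inf: "infinite ?Z"
    define H where "H = {z::complex. M < Re z}"
    define F where "F = (\<lambda>z::complex. of_real n * z\<^sup>2 - (\<Sum>i\<in>I. of_real (e i) * csqrt (z\<^sup>2 - (of_real (\<sigma> i))\<^sup>2)))"
    have real: "F (of_real x) = of_real (n * x\<^sup>2 - (\<Sum>i\<in>I. e i * sqrt (x\<^sup>2 - (\<sigma> i)\<^sup>2)))" if "M < x" for x :: real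
    proof -
      have "csqrt ((of_real x)\<^sup>2 - (of_real (\<sigma> i))\<^sup>2) = of_real (sqrt (x\<^sup>2 - (\<sigma> i)\<^sup>2))" if i: "i \<in> I" for i
      proof -
        have "(\<sigma> i)\<^sup>2 \<le> x\<^sup>2" using M(2)[OF i] \<open>M < x\<close> by (intro abs_le_square_iff[THEN iffD1]) auto
        hence "csqrt (of_real (x\<^sup>2 - (\<sigma> i)\<^sup>2)) = of_real (sqrt (x\<^sup>2 - (\<sigma> i)\<^sup>2))"
          by (intro of_real_sqrt[symmetric]) auto
        thus ?thesis by simp
      qed
      thus ?thesis by (simp add: F_def)
    qed
    have H: "open H" "connected H"
      unfolding H_def by (auto intro: open_halfspace_Re_gt convex_connected convex_halfspace_Re_gt)
    have hol: "F holomorphic_on H"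
      unfolding F_def
    proof (intro holomorphic_intros)
      fix i z assume i: "i \<in> I" and z: "z \<in> H"
      show "z\<^sup>2 - (complex_of_real (\<sigma> i))\<^sup>2 \<notin> \<real>\<^sub>\<le>\<^sub>0"
      proof
        assume "z\<^sup>2 - (complex_of_real (\<sigma> i))\<^sup>2 \<in> \<real>\<^sub>\<le>\<^sub>0"
        hence "Im (z\<^sup>2 - (complex_of_real (\<sigma> i))\<^sup>2) = 0" and re: "Re (z\<^sup>2 - (complex_of_real (\<sigma> i))\<^sup>2) \<le> 0"
          by (auto simp: complex_nonpos_Reals_iff)
        hence "Im z = 0" using z M by (auto simp: H_def power2_eq_square)
        with re have "(Re z)\<^sup>2 \<le> (\<sigma> i)\<^sup>2" by (simp add: power2_eq_square)
        hence "\<bar>Re z\<bar> \<le> \<bar>\<sigma> i\<bar>" by (simp add: abs_le_square_iff)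
        thus False using M(2)[OF i] z M(1) by (auto simp: H_def)
      qed
    qed
    define U where "U = complex_of_real ` ?Z"
    have infU: "infinite U" unfolding U_def using inf by (subst finite_image_iff) (auto intro: inj_onI)
    have K: "compact (complex_of_real ` {a..b})" by (intro compact_continuous_image continuous_intros) auto
    have "U \<subseteq> complex_of_real ` {a..b}" by (auto simp: U_def)
    then obtain \<xi> where \<xi>: "\<xi> \<in> complex_of_real ` {a..b}" "\<xi> islimpt U"
      using K infU by (meson compact_eq_Bolzano_Weierstrass)
    have UH: "U \<subseteq> H" "\<xi> \<in> H" using M \<xi> by (auto simp: U_def H_def)
    have zero: "F z = 0" if "z \<in> U" for z
    proof -
      obtain s where s: "z = of_real s" "a \<le> s" "n * s\<^sup>2 = (\<Sum>i\<in>I. e i * sqrt (s\<^sup>2 - (\<sigma> i)\<^sup>2))"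
        using \<open>z \<in> U\<close> by (auto simp: U_def)
      thus ?thesis using real[of s] M(3) by simp
    qed
    define x where "x = max M 1 + 1"
    have x: "M < x" "1 < x" by (auto simp: x_def)
    have "F (of_real x) = 0"
      by (rule analytic_continuation[OF hol H UH \<xi>(2) zero]) (use x in \<open>auto simp: H_def\<close>)
    hence "complex_of_real (n * x\<^sup>2 - (\<Sum>i\<in>I. e i * sqrt (x\<^sup>2 - (\<sigma> i)\<^sup>2))) = 0"
      unfolding real[OF x(1)] .
    hence eq: "n * x\<^sup>2 = (\<Sum>i\<in>I. e i * sqrt (x\<^sup>2 - (\<sigma> i)\<^sup>2))" unfolding of_real_eq_0_iff by simp
    have "(\<Sum>i\<in>I. e i * sqrt (x\<^sup>2 - (\<sigma> i)\<^sup>2)) \<le> (\<Sum>i\<in>I. x)"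
    proof (intro sum_mono)
      fix i assume i: "i \<in> I"
      have "(\<sigma> i)\<^sup>2 \<le> x\<^sup>2" using M(2)[OF i] x by (intro abs_le_square_iff[THEN iffD1]) auto
      hence s: "0 \<le> sqrt (x\<^sup>2 - (\<sigma> i)\<^sup>2)" by simp
      have "sqrt (x\<^sup>2 - (\<sigma> i)\<^sup>2) \<le> sqrt (x\<^sup>2)" by (intro real_sqrt_le_mono) auto
      hence le: "sqrt (x\<^sup>2 - (\<sigma> i)\<^sup>2) \<le> x" using x by simp
      have "e i = -1 \<or> e i = 1" using e i by (auto simp: PiE_def Pi_def)
      thus "e i * sqrt (x\<^sup>2 - (\<sigma> i)\<^sup>2) \<le> x"
      proof
        assume "e i = -1"
        hence "e i * sqrt (x\<^sup>2 - (\<sigma> i)\<^sup>2) = - sqrt (x\<^sup>2 - (\<sigma> i)\<^sup>2)" by simp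
        also have "\<dots> \<le> 0" using s by simp
        finally show ?thesis using x by linarith
      qed (use le in simp)
    qed
    also have "\<dots> \<le> n * x" using n x by simp
    also have "n * x < n * (x * x)" using n x by simp
    finally show False using eq by (simp add: power2_eq_square)
  qed
  moreover have "finite (PiE I (\<lambda>_. {-1, 1::real}))" using I by (intro finite_PiE) auto
  ultimately have "finite (\<Union>e\<in>PiE I (\<lambda>_. {-1, 1::real}). {s \<in> {a..b}. n * s\<^sup>2 = (\<Sum>i\<in>I. e i * sqrt (s\<^sup>2 - (\<sigma> i)\<^sup>2))})"
    by blast
  thus ?thesis by (rule rev_finite_subset) (auto simp: self_consistent_def)
qed

section \<open>Energy dissipation and the order parameter\<close>

lemma abs_deviation_from_mean_le:
  fixes x :: "nat \<Rightarrow> real"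
  assumes N: "N \<ge> 1" and i: "i \<in> {1..N}" and K: "\<And>i j. i \<in> {1..N} \<Longrightarrow> j \<in> {1..N} \<Longrightarrow> \<bar>x i - x j\<bar> \<le> K"
  shows "\<bar>x i - (\<Sum>j=1..N. x j) / real N\<bar> \<le> K"
proof -
  have "\<bar>real N * x i - (\<Sum>j=1..N. x j)\<bar> = \<bar>\<Sum>j=1..N. x i - x j\<bar>" by (simp add: sum_subtractf)
  also have "\<dots> \<le> (\<Sum>j=1..N. \<bar>x i - x j\<bar>)" by (rule sum_abs)
  also have "\<dots> \<le> (\<Sum>j=1..N. K)" using i K by (intro sum_mono) auto
  finally have "\<bar>real N * x i - (\<Sum>j=1..N. x j)\<bar> \<le> real N * K" by simp
  moreover have "real N * x i - (\<Sum>j=1..N. x j) = real N * (x i - (\<Sum>j=1..N. x j) / real N)"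
    using N by (simp add: field_simps)
  ultimately have "real N * \<bar>x i - (\<Sum>j=1..N. x j) / real N\<bar> \<le> real N * K" by (simp add: abs_mult)
  thus ?thesis using N by simp
qed

context kuramoto
begin

text \<open>With \<open>r exp (i \<psi>)\<close> the mean of the \<open>exp (i \<theta> k)\<close>, these are \<open>r sin (\<psi> - \<theta> i)\<close> and
  \<open>r cos (\<psi> - \<theta> i)\<close>. Expressing them without \<open>\<psi>\<close> avoids choosing a continuous argument.\<close>
definition coupling_sin :: "nat \<Rightarrow> real \<Rightarrow> real" where
  "coupling_sin i t = (\<Sum>k=1..N. sin (\<theta> k t - \<theta> i t)) / real N"

definition coupling_cos :: "nat \<Rightarrow> real \<Rightarrow> real" where
  "coupling_cos i t = (\<Sum>k=1..N. cos (\<theta> k t - \<theta> i t)) / real N"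

definition mean :: "(nat \<Rightarrow> real) \<Rightarrow> real" where
  "mean x = (\<Sum>i=1..N. x i) / real N"

lemma force_eq_coupling_sin: "force i t = \<nu> i + \<kappa> * coupling_sin i t"
  by (simp add: force_def coupling_sin_def)

lemma coupling_sin_sum: "(\<Sum>i=1..N. coupling_sin i t) = 0"
proof -
  let ?S = "\<Sum>i=1..N. \<Sum>k=1..N. sin (\<theta> k t - \<theta> i t)"
  have "?S = (\<Sum>i=1..N. \<Sum>k=1..N. - sin (\<theta> i t - \<theta> k t))"
    by (intro sum.cong refl) (metis minus_diff_eq sin_minus)
  also have "\<dots> = - (\<Sum>i=1..N. \<Sum>k=1..N. sin (\<theta> i t - \<theta> k t))" by (simp add: sum_negf)
  also have "\<dots> = - ?S" by (subst sum.swap) (rule refl)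
  finally have "?S = 0" by simp
  thus ?thesis by (simp add: coupling_sin_def sum_divide_distrib[symmetric])
qed

lemma abs_coupling_sin_le: "\<bar>coupling_sin i t\<bar> \<le> 1"
proof -
  have "\<bar>\<Sum>k=1..N. sin (\<theta> k t - \<theta> i t)\<bar> \<le> (\<Sum>k=1..N. \<bar>sin (\<theta> k t - \<theta> i t)\<bar>)" by (rule sum_abs)
  also have "\<dots> \<le> (\<Sum>k=1..N. 1)" by (intro sum_mono) auto
  finally show ?thesis using N_ge_1 by (simp add: coupling_sin_def)
qed

definition dev_velocity :: "nat \<Rightarrow> real \<Rightarrow> real" where
  "dev_velocity i t = \<omega> i t - mean (\<lambda>j. \<omega> j t)"

text \<open>The force relative to the mean force; it vanishes for all oscillators exactly at the
  configurations that can rotate rigidly.\<close>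
definition residual :: "nat \<Rightarrow> real \<Rightarrow> real" where
  "residual i t = \<nu> i - mean \<nu> + \<kappa> * coupling_sin i t"

definition dev_acceleration :: "nat \<Rightarrow> real \<Rightarrow> real" where
  "dev_acceleration i t = (residual i t - dev_velocity i t) / m"

lemma mean_force: "mean (\<lambda>i. force i t) = mean \<nu>"
  by (simp add: mean_def force_eq_coupling_sin sum.distrib sum_distrib_left[symmetric] coupling_sin_sum
      del: One_nat_def)

lemma dev_velocity_deriv:
  assumes "i \<in> {1..N}" "0 < t"
  shows "(dev_velocity i has_real_derivative dev_acceleration i t) (at t)"
proof -
  have "(dev_velocity i has_real_derivative
      (force i t - \<omega> i t) / m - (\<Sum>j=1..N. (force j t - \<omega> j t) / m) / real N) (at t)"
    unfolding dev_velocity_def[abs_def] mean_def using assms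
    by (intro DERIV_diff DERIV_cdivide DERIV_sum velocity_deriv) auto
  also have "(\<Sum>j=1..N. (force j t - \<omega> j t) / m) / real N = (mean (\<lambda>j. force j t) - mean (\<lambda>j. \<omega> j t)) / m"
    by (simp add: mean_def sum_divide_distrib[symmetric] sum_subtractf diff_divide_distrib mult_ac)
  also have "(force i t - \<omega> i t) / m - (mean (\<lambda>j. force j t) - mean (\<lambda>j. \<omega> j t)) / m
      = dev_acceleration i t"
    unfolding mean_force dev_acceleration_def
    by (simp add: residual_def dev_velocity_def force_eq_coupling_sin diff_divide_distrib add_divide_distrib)
  finally show ?thesis .
qed

lemma velocity_diffs_bounded:
  obtains K where "0 \<le> K" "\<And>i j t. i \<in> {1..N} \<Longrightarrow> j \<in> {1..N} \<Longrightarrow> 0 \<le> t \<Longrightarrow> \<bar>\<omega> i t - \<omega> j t\<bar> \<le> K"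
proof -
  obtain V W where VW: "diffs_le \<nu> {1..N} V" "diffs_le \<omega>0 {1..N} W"
    using finite_diffs_le[of "{1..N}"] by (metis finite_atLeastAtMost)
  note V = diffs_leD[OF VW(1)] and W = diffs_leD[OF VW(2)]
  have VW: "0 \<le> V" "0 \<le> W" using V[of 1 1] W[of 1 1] N_ge_1 by auto
  have one: "\<omega> i t - \<omega> j t \<le> W + (V + 2 * \<kappa>)" if "i \<in> {1..N}" "j \<in> {1..N}" "0 \<le> t" for i j t
  proof -
    have "\<omega> i t - \<omega> j t \<le> W * exp (- (t / m)) + (V + 2 * \<kappa>)"
      using that V[of i j] W[of i j] VW by (intro velocity_diff_le) auto
    moreover have "W * exp (- (t / m)) \<le> W * 1" using VW that m_pos by (intro mult_left_mono) auto
    ultimately show ?thesis by simp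
  qed
  show ?thesis
    by (rule that[of "W + (V + 2 * \<kappa>)"]) (use one VW \<kappa>_pos in \<open>auto simp: abs_le_iff\<close>)
qed

text \<open>The interaction forces are antisymmetric, so their work depends on the deviations from the mean
  velocity only.\<close>
lemma sum_antisym_work:
  "(\<Sum>i=1..N. \<Sum>k=1..N. sin (\<theta> k t - \<theta> i t) * (\<omega> k t - \<omega> i t))
    = - 2 * real N * (\<Sum>i=1..N. dev_velocity i t * coupling_sin i t)"
proof -
  have eq: "(\<Sum>k=1..N. sin (\<theta> k t - \<theta> i t)) = real N * coupling_sin i t" for i
    using N_ge_1 by (simp add: coupling_sin_def)
  have "(\<Sum>i=1..N. \<Sum>k=1..N. sin (\<theta> k t - \<theta> i t) * (\<omega> k t - \<omega> i t))
      = (\<Sum>i=1..N. \<Sum>k=1..N. sin (\<theta> k t - \<theta> i t) * dev_velocity k t)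
        - (\<Sum>i=1..N. \<Sum>k=1..N. sin (\<theta> k t - \<theta> i t) * dev_velocity i t)"
    unfolding sum_subtractf[symmetric] by (simp add: dev_velocity_def algebra_simps)
  also have "(\<Sum>i=1..N. \<Sum>k=1..N. sin (\<theta> k t - \<theta> i t) * dev_velocity k t)
      = (\<Sum>k=1..N. \<Sum>i=1..N. - (sin (\<theta> i t - \<theta> k t) * dev_velocity k t))"
    by (subst sum.swap) (intro sum.cong refl, metis minus_diff_eq minus_mult_left sin_minus)
  also have "\<dots> = - (\<Sum>i=1..N. \<Sum>k=1..N. sin (\<theta> k t - \<theta> i t) * dev_velocity i t)"
    by (simp add: sum_negf)
  also have "- (\<Sum>i=1..N. \<Sum>k=1..N. sin (\<theta> k t - \<theta> i t) * dev_velocity i t)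
      - (\<Sum>i=1..N. \<Sum>k=1..N. sin (\<theta> k t - \<theta> i t) * dev_velocity i t)
      = - 2 * (\<Sum>i=1..N. \<Sum>k=1..N. sin (\<theta> k t - \<theta> i t) * dev_velocity i t)" by simp
  also have "(\<Sum>i=1..N. \<Sum>k=1..N. sin (\<theta> k t - \<theta> i t) * dev_velocity i t)
      = real N * (\<Sum>i=1..N. dev_velocity i t * coupling_sin i t)"
    unfolding sum_distrib_right[symmetric] eq sum_distrib_left
    by (intro sum.cong refl) (simp add: mult_ac)
  finally show ?thesis by simp
qed

definition dev_square :: "real \<Rightarrow> real" where
  "dev_square t = (\<Sum>i=1..N. (dev_velocity i t)\<^sup>2)"

lemma dev_square_nonneg: "0 \<le> dev_square t"
  by (simp add: dev_square_def sum_nonneg)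

lemma dev_square_deriv:
  assumes t: "0 < t"
  shows "(dev_square has_real_derivative (\<Sum>i=1..N. 2 * dev_velocity i t * dev_acceleration i t)) (at t)"
  unfolding dev_square_def[abs_def]
proof (rule DERIV_sum)
  fix i assume "i \<in> {1..N}"
  thus "((\<lambda>t. (dev_velocity i t)\<^sup>2) has_real_derivative 2 * dev_velocity i t * dev_acceleration i t) (at t)"
    using dev_velocity_deriv[of i t] t by (auto intro!: derivative_eq_intros)
qed

text \<open>Kinetic and potential energy in the frame that moves with the mean phase.\<close>
definition energy :: "real \<Rightarrow> real" where
  "energy t = m / 2 * dev_square t
     - (\<Sum>i=1..N. (\<nu> i - mean \<nu>) * (\<theta> i t - mean (\<lambda>j. \<theta> j t)))
     - \<kappa> / (2 * real N) * (\<Sum>i=1..N. \<Sum>k=1..N. cos (\<theta> k t - \<theta> i t))"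

lemma energy_deriv:
  assumes t: "0 < t"
  shows "(energy has_real_derivative - dev_square t) (at t)"
proof -
  have d2: "((\<lambda>t. \<theta> i t - mean (\<lambda>j. \<theta> j t)) has_real_derivative dev_velocity i t) (at t)" if "i \<in> {1..N}" for i
    unfolding dev_velocity_def mean_def using that t
    by (intro DERIV_diff DERIV_cdivide DERIV_sum phase_deriv) auto
  have d3: "((\<lambda>t. cos (\<theta> k t - \<theta> i t)) has_real_derivative - (sin (\<theta> k t - \<theta> i t) * (\<omega> k t - \<omega> i t))) (at t)"
    if "i \<in> {1..N}" "k \<in> {1..N}" for i k
    using phase_deriv[OF that(1) t] phase_deriv[OF that(2) t] by (auto intro!: derivative_eq_intros)
  have d: "(energy has_real_derivative
      m / 2 * (\<Sum>i=1..N. 2 * dev_velocity i t * dev_acceleration i t)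
      - (\<Sum>i=1..N. (\<nu> i - mean \<nu>) * dev_velocity i t)
      - \<kappa> / (2 * real N) * (\<Sum>i=1..N. \<Sum>k=1..N. - (sin (\<theta> k t - \<theta> i t) * (\<omega> k t - \<omega> i t)))) (at t)"
    unfolding energy_def[abs_def]
    by (intro DERIV_diff DERIV_cmult DERIV_sum dev_square_deriv d2 d3 t) auto
  have e1: "m / 2 * (\<Sum>i=1..N. 2 * dev_velocity i t * dev_acceleration i t)
      = (\<Sum>i=1..N. dev_velocity i t * residual i t) - dev_square t"
    unfolding dev_square_def sum_distrib_left sum_subtractf[symmetric] using m_pos
    by (intro sum.cong refl) (simp add: dev_acceleration_def field_simps power2_eq_square)
  have e2: "(\<Sum>i=1..N. dev_velocity i t * residual i t)
      = (\<Sum>i=1..N. (\<nu> i - mean \<nu>) * dev_velocity i t) + \<kappa> * (\<Sum>i=1..N. dev_velocity i t * coupling_sin i t)"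
    by (simp add: residual_def sum_distrib_left sum.distrib[symmetric] algebra_simps)
  have e3: "\<kappa> / (2 * real N) * (\<Sum>i=1..N. \<Sum>k=1..N. - (sin (\<theta> k t - \<theta> i t) * (\<omega> k t - \<omega> i t)))
      = \<kappa> * (\<Sum>i=1..N. dev_velocity i t * coupling_sin i t)"
    unfolding sum_negf sum_antisym_work using N_ge_1 by simp
  show ?thesis using d unfolding e1 e2 e3 by simp
qed

text \<open>Bounded phase differences bound the energy from below, so it converges. Barbalat's lemma then
  applies twice: to the energy, whose derivative is minus the sum of the squared deviations of
  the velocities, and to these deviations, whose derivative is the residual up to the factor
  \<open>1 / m\<close> and a vanishing term.\<close>
lemma residual_tendsto_0:
  assumes bdd: "\<And>i j t. i \<in> {1..N} \<Longrightarrow> j \<in> {1..N} \<Longrightarrow> 0 \<le> t \<Longrightarrow> \<bar>\<theta> i t - \<theta> j t\<bar> \<le> M"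
    and i: "i \<in> {1..N}"
  shows "(residual i \<longlongrightarrow> 0) at_top"
proof -
  obtain K where K: "0 \<le> K" "\<And>i j t. i \<in> {1..N} \<Longrightarrow> j \<in> {1..N} \<Longrightarrow> 0 \<le> t \<Longrightarrow> \<bar>\<omega> i t - \<omega> j t\<bar> \<le> K"
    using velocity_diffs_bounded by blast
  have dev: "\<bar>dev_velocity i t\<bar> \<le> K" if "i \<in> {1..N}" "0 \<le> t" for i t
    unfolding dev_velocity_def mean_def using that K N_ge_1 by (intro abs_deviation_from_mean_le) auto
  obtain V where "diffs_le \<nu> {1..N} V" using finite_diffs_le[of "{1..N}"] by blast
  note V0 = diffs_leD[OF this]
  have V: "\<bar>\<nu> i - mean \<nu>\<bar> \<le> V" if "i \<in> {1..N}" for i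
    unfolding mean_def using that N_ge_1 V0 by (intro abs_deviation_from_mean_le) auto
  have res: "\<bar>residual i t\<bar> \<le> V + \<kappa>" if "i \<in> {1..N}" for i t
  proof -
    have "\<bar>\<kappa> * coupling_sin i t\<bar> \<le> \<kappa> * 1"
      unfolding abs_mult using abs_coupling_sin_le \<kappa>_pos by (intro mult_mono) auto
    thus ?thesis using V[OF that] unfolding residual_def by linarith
  qed
  define D where "D = (V + \<kappa> + K) / m"
  have acc: "\<bar>dev_acceleration i t\<bar> \<le> D" if "i \<in> {1..N}" "1 \<le> t" for i t
  proof -
    have "\<bar>residual i t - dev_velocity i t\<bar> \<le> V + \<kappa> + K" using res[of i t] dev[of i t] that by auto
    thus ?thesis using m_pos by (simp add: dev_acceleration_def D_def abs_divide divide_right_mono)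
  qed
  have energy_lower: "- (real N * (V * M)) - \<kappa> * real N / 2 \<le> energy t" if t: "1 \<le> t" for t
  proof -
    have "(\<Sum>i=1..N. (\<nu> i - mean \<nu>) * (\<theta> i t - mean (\<lambda>j. \<theta> j t))) \<le> (\<Sum>i=1..N. V * M)"
    proof (intro sum_mono)
      fix i assume i: "i \<in> {1..N}"
      have "\<bar>\<theta> i t - mean (\<lambda>j. \<theta> j t)\<bar> \<le> M"
        unfolding mean_def using i t bdd N_ge_1 by (intro abs_deviation_from_mean_le) auto
      hence "\<bar>(\<nu> i - mean \<nu>) * (\<theta> i t - mean (\<lambda>j. \<theta> j t))\<bar> \<le> V * M"
        unfolding abs_mult using V[OF i] by (intro mult_mono) auto
      thus "(\<nu> i - mean \<nu>) * (\<theta> i t - mean (\<lambda>j. \<theta> j t)) \<le> V * M" by simp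
    qed
    moreover have "(\<Sum>i=1..N. \<Sum>k=1..N. cos (\<theta> k t - \<theta> i t)) \<le> (\<Sum>i=1..N. \<Sum>k=1..N. 1)"
      by (intro sum_mono) auto
    hence "\<kappa> / (2 * real N) * (\<Sum>i=1..N. \<Sum>k=1..N. cos (\<theta> k t - \<theta> i t)) \<le> \<kappa> / (2 * real N) * (\<Sum>i=1..N. \<Sum>k=1..N. 1)"
      using \<kappa>_pos by (intro mult_left_mono) auto
    hence "\<kappa> / (2 * real N) * (\<Sum>i=1..N. \<Sum>k=1..N. cos (\<theta> k t - \<theta> i t)) \<le> \<kappa> * real N / 2"
      using N_ge_1 by simp
    moreover have "0 \<le> m / 2 * dev_square t"
      using m_pos dev_square_nonneg by simp
    ultimately show ?thesis unfolding energy_def by simp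
  qed
  have energy_mono: "energy t \<le> energy s" if "1 \<le> s" "s \<le> t" for s t
  proof (rule DERIV_nonpos_imp_nonincreasing[OF that(2)])
    fix u assume "s \<le> u" "u \<le> t"
    thus "\<exists>y. (energy has_real_derivative y) (at u) \<and> y \<le> 0"
      using energy_deriv[of u] dev_square_nonneg that by (intro exI conjI) auto
  qed
  obtain E where E: "(energy \<longlongrightarrow> E) at_top"
    using nonincreasing_bounded_converges[where f = energy and T = 1, OF energy_mono energy_lower] by blast
  have lip: "\<bar>- dev_square s - - dev_square t\<bar> \<le> (real N * (2 * K * D)) * \<bar>s - t\<bar>"
    if "1 \<le> s" "1 \<le> t" for s t
  proof (rule lipschitz_of_deriv_bound[OF _ _ that])
    fix t :: real assume t: "1 \<le> t"
    show "((\<lambda>t. - dev_square t) has_real_derivative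
        - (\<Sum>i=1..N. 2 * dev_velocity i t * dev_acceleration i t)) (at t)"
      using t by (intro DERIV_minus dev_square_deriv) simp
    have "\<bar>\<Sum>i=1..N. 2 * dev_velocity i t * dev_acceleration i t\<bar>
        \<le> (\<Sum>i=1..N. \<bar>2 * dev_velocity i t * dev_acceleration i t\<bar>)" by (rule sum_abs)
    also have "\<dots> \<le> (\<Sum>i=1..N. 2 * K * D)"
    proof (intro sum_mono)
      fix i assume i: "i \<in> {1..N}"
      have "\<bar>2 * dev_velocity i t\<bar> * \<bar>dev_acceleration i t\<bar> \<le> (2 * K) * D"
        using dev[OF i] acc[OF i t] t K(1) by (intro mult_mono) (auto simp: abs_mult)
      thus "\<bar>2 * dev_velocity i t * dev_acceleration i t\<bar> \<le> 2 * K * D"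
        by (simp only: abs_mult)
    qed
    finally show "\<bar>- (\<Sum>i=1..N. 2 * dev_velocity i t * dev_acceleration i t)\<bar> \<le> real N * (2 * K * D)"
      by simp
  qed
  have "((\<lambda>t. - dev_square t) \<longlongrightarrow> 0) at_top"
    using energy_deriv by (intro barbalat[where T = 1, OF _ lip E]) force
  hence sq: "(dev_square \<longlongrightarrow> 0) at_top"
    using tendsto_minus_cancel_left[of dev_square 0 at_top] by simp
  have "((\<lambda>t. (dev_velocity i t)\<^sup>2) \<longlongrightarrow> 0) at_top"
  proof (rule tendsto_sandwich[OF _ _ tendsto_const sq])
    show "eventually (\<lambda>t. (dev_velocity i t)\<^sup>2 \<le> dev_square t) at_top"
      unfolding dev_square_def using i by (intro always_eventually allI member_le_sum) auto
  qed auto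
  hence dev0: "(dev_velocity i \<longlongrightarrow> 0) at_top" by simp
  have "(dev_acceleration i \<longlongrightarrow> 0) at_top"
  proof (rule barbalat[where T = 1 and f = "dev_velocity i"])
    show "(dev_velocity i has_real_derivative dev_acceleration i t) (at t)" if "1 \<le> t" for t
      using that i by (intro dev_velocity_deriv) auto
    fix s t :: real assume st: "1 \<le> s" "1 \<le> t"
    show "\<bar>dev_acceleration i s - dev_acceleration i t\<bar> \<le> ((\<kappa> * K + D) / m) * \<bar>s - t\<bar>"
    proof (rule lipschitz_of_deriv_bound[OF _ _ st])
      fix t :: real assume t: "1 \<le> t"
      define c where "c = (\<Sum>k=1..N. cos (\<theta> k t - \<theta> i t) * (\<omega> k t - \<omega> i t)) / real N"
      have "(coupling_sin i has_real_derivative c) (at t)"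
        unfolding coupling_sin_def[abs_def] c_def
      proof (intro DERIV_cdivide DERIV_sum)
        fix k assume "k \<in> {1..N}"
        thus "((\<lambda>t. sin (\<theta> k t - \<theta> i t)) has_real_derivative cos (\<theta> k t - \<theta> i t) * (\<omega> k t - \<omega> i t)) (at t)"
          using phase_deriv[of k t] phase_deriv[OF i, of t] t by (auto intro!: derivative_eq_intros)
      qed
      thus "(dev_acceleration i has_real_derivative
          (\<kappa> * c - dev_acceleration i t) / m) (at t)"
        unfolding dev_acceleration_def[abs_def] residual_def[abs_def]
        using dev_velocity_deriv[OF i, of t] t m_pos
        by (auto intro!: derivative_eq_intros simp: dev_acceleration_def residual_def)
      have "\<bar>\<Sum>k=1..N. cos (\<theta> k t - \<theta> i t) * (\<omega> k t - \<omega> i t)\<bar> \<le> (\<Sum>k=1..N. \<bar>cos (\<theta> k t - \<theta> i t) * (\<omega> k t - \<omega> i t)\<bar>)"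
        by (rule sum_abs)
      also have "\<dots> \<le> (\<Sum>k=1..N. 1 * K)"
        unfolding abs_mult using K t i by (intro sum_mono mult_mono) auto
      finally have "\<bar>c\<bar> \<le> K" using N_ge_1 by (simp add: c_def field_simps)
      hence "\<kappa> * \<bar>c\<bar> \<le> \<kappa> * K" using \<kappa>_pos by simp
      hence "\<bar>\<kappa> * c\<bar> \<le> \<kappa> * K" using \<kappa>_pos by (simp add: abs_mult)
      hence "\<bar>\<kappa> * c - dev_acceleration i t\<bar> \<le> \<kappa> * K + D"
        using acc[OF i t] by linarith
      thus "\<bar>(\<kappa> * c - dev_acceleration i t) / m\<bar> \<le> (\<kappa> * K + D) / m"
        using m_pos unfolding abs_divide by (simp add: divide_right_mono)
    qed
  qed (rule dev0)
  from tendsto_add[OF tendsto_mult[OF tendsto_const[of m] this] dev0]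
  show ?thesis using m_pos by (simp add: dev_acceleration_def)
qed

text \<open>The squared modulus of the order parameter. Its expression through the relative phases of the
  oscillators is the self-consistency relation behind \<open>order_parameter_converges\<close>.\<close>
definition order_sq :: "real \<Rightarrow> real" where
  "order_sq t = (\<Sum>i=1..N. coupling_cos i t) / real N"

lemma coupling_eq_mean_field:
  "coupling_cos i t = mean (\<lambda>k. cos (\<theta> k t)) * cos (\<theta> i t) + mean (\<lambda>k. sin (\<theta> k t)) * sin (\<theta> i t)"
  "coupling_sin i t = mean (\<lambda>k. sin (\<theta> k t)) * cos (\<theta> i t) - mean (\<lambda>k. cos (\<theta> k t)) * sin (\<theta> i t)"
  by (simp_all add: coupling_cos_def coupling_sin_def mean_def cos_diff sin_diff sum.distrib sum_subtractf
      sum_distrib_right add_divide_distrib diff_divide_distrib sum_divide_distrib)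

lemma order_sq_eq: "order_sq t = (mean (\<lambda>k. cos (\<theta> k t)))\<^sup>2 + (mean (\<lambda>k. sin (\<theta> k t)))\<^sup>2"
proof -
  define X where "X = mean (\<lambda>k. cos (\<theta> k t))"
  define Y where "Y = mean (\<lambda>k. sin (\<theta> k t))"
  have "(\<Sum>i=1..N. X * cos (\<theta> i t) + Y * sin (\<theta> i t))
      = X * (\<Sum>i=1..N. cos (\<theta> i t)) + Y * (\<Sum>i=1..N. sin (\<theta> i t))"
    by (simp only: sum.distrib sum_distrib_left)
  also have "\<dots> = (X * X + Y * Y) * real N" using N_ge_1 by (simp add: X_def Y_def mean_def field_simps)
  finally show ?thesis
    unfolding order_sq_def coupling_eq_mean_field X_def[symmetric] Y_def[symmetric]
    using N_ge_1 by (simp add: power2_eq_square)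
qed

text \<open>The products \<open>exp (i (\<psi> - \<theta> i)) exp (- i (\<psi> - \<theta> j))\<close>, scaled by \<open>r\<^sup>2\<close>, in real form: relative
  phases can be read off from the couplings.\<close>
lemma coupling_products:
  "coupling_cos i t * coupling_cos j t + coupling_sin i t * coupling_sin j t = order_sq t * cos (\<theta> i t - \<theta> j t)"
  "coupling_cos i t * coupling_sin j t - coupling_sin i t * coupling_cos j t = order_sq t * sin (\<theta> i t - \<theta> j t)"
  unfolding coupling_eq_mean_field order_sq_eq cos_diff sin_diff by (simp_all add: algebra_simps power2_eq_square)

lemma coupling_squares: "(coupling_cos i t)\<^sup>2 + (coupling_sin i t)\<^sup>2 = order_sq t"
  using coupling_products(1)[of i t i] by (simp add: power2_eq_square)

lemma order_sq_nonneg: "0 \<le> order_sq t"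
  using coupling_squares[of 1 t] by (metis add_nonneg_nonneg zero_le_power2)

lemma order_sq_le_1: "order_sq t \<le> 1"
proof -
  have "coupling_cos i t \<le> 1" for i
  proof -
    have "(\<Sum>k=1..N. cos (\<theta> k t - \<theta> i t)) \<le> (\<Sum>k=1..N. 1)" by (intro sum_mono) auto
    thus ?thesis using N_ge_1 by (simp add: coupling_cos_def)
  qed
  hence "(\<Sum>i=1..N. coupling_cos i t) \<le> (\<Sum>i=1..N. 1)" by (intro sum_mono) auto
  thus ?thesis using N_ge_1 by (simp add: order_sq_def)
qed

lemma coupling_continuous:
  assumes "i \<in> {1..N}"
  shows "continuous_on {0..} (coupling_cos i)" "continuous_on {0..} (coupling_sin i)" "continuous_on {0..} order_sq"
proof -
  have "continuous_on {0..} (coupling_cos i)" if "i \<in> {1..N}" for i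
    unfolding coupling_cos_def[abs_def] using that N_ge_1 by (intro continuous_intros phase_continuous) auto
  thus "continuous_on {0..} order_sq" "continuous_on {0..} (coupling_cos i)"
    unfolding order_sq_def[abs_def] using N_ge_1 assms by (auto intro!: continuous_intros)
  show "continuous_on {0..} (coupling_sin i)"
    unfolding coupling_sin_def[abs_def] using assms N_ge_1 by (intro continuous_intros phase_continuous) auto
qed

text \<open>At a time when the modulus equals \<open>s\<close>, each \<open>coupling_cos i\<close> is \<open>\<plusminus> sqrt (s\<^sup>2 - coupling_sin i\<^sup>2)\<close>, and
  the sum of these numbers is \<open>N s\<^sup>2\<close>. If \<open>s\<close> recurs, then in the limit \<open>s\<close> satisfies the equation with
  \<open>\<sigma> i\<close> instead of \<open>coupling_sin i\<close> for one of the finitely many patterns of signs. So no interval recurs.\<close>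
lemma order_parameter_converges:
  assumes lim: "\<And>i. i \<in> {1..N} \<Longrightarrow> (coupling_sin i \<longlongrightarrow> \<sigma> i) at_top"
  shows "\<exists>L. ((\<lambda>t. sqrt (order_sq t)) \<longlongrightarrow> L) at_top"
proof (rule converges_if_no_recurrent_interval[where T = 0 and B = 1])
  show "continuous_on {0..} (\<lambda>t. sqrt (order_sq t))"
    using N_ge_1 by (intro continuous_intros coupling_continuous(3)[of 1]) auto
  show "\<bar>sqrt (order_sq t)\<bar> \<le> 1" for t using order_sq_nonneg[of t] order_sq_le_1[of t] by simp
  fix a b :: real
  assume ab: "a < b" and rec: "\<And>s. a \<le> s \<Longrightarrow> s \<le> b \<Longrightarrow> \<exists>\<^sub>F t in at_top. sqrt (order_sq t) = s"
  have nonneg: "0 \<le> s" if s: "a \<le> s" "s \<le> b" for s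
    using frequently_ex[OF rec[OF s]] order_sq_nonneg by auto
  have \<sigma>: "\<bar>\<sigma> i\<bar> \<le> a" if i: "i \<in> {1..N}" for i
  proof (rule ccontr)
    assume "\<not> \<bar>\<sigma> i\<bar> \<le> a"
    hence "eventually (\<lambda>t. a < \<bar>coupling_sin i t\<bar>) at_top"
      by (intro order_tendstoD(1)[OF tendsto_rabs[OF lim[OF i]]]) auto
    moreover have "\<exists>\<^sub>F t in at_top. sqrt (order_sq t) = a" using rec ab by auto
    ultimately have "\<exists>\<^sub>F t in at_top. sqrt (order_sq t) = a \<and> a < \<bar>coupling_sin i t\<bar>"
      by (rule frequently_eventually_frequently[rotated])
    then obtain t where t: "sqrt (order_sq t) = a" "a < \<bar>coupling_sin i t\<bar>" by (auto dest: frequently_ex)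
    have "(coupling_sin i t)\<^sup>2 \<le> order_sq t" using coupling_squares[of i t] by (metis le_add_same_cancel2 zero_le_power2)
    hence "sqrt ((coupling_sin i t)\<^sup>2) \<le> sqrt (order_sq t)" by (rule real_sqrt_le_mono)
    thus False using t by simp
  qed
  have "self_consistent {1..N} (real N) \<sigma> s"
    if s: "a \<le> s" "s \<le> b" for s
  proof (rule ccontr)
    define P where "P = PiE {1..N} (\<lambda>_. {-1, 1::real})"
    define h where "h = (\<lambda>e. \<bar>real N * s\<^sup>2 - (\<Sum>i\<in>{1..N}. e i * sqrt (s\<^sup>2 - (\<sigma> i)\<^sup>2))\<bar>)"
    assume "\<not> (self_consistent {1..N} (real N) \<sigma> s)"
    hence pos: "0 < h e" if "e \<in> P" for e using that by (auto simp: h_def P_def self_consistent_def)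
    have P: "finite P" "P \<noteq> {}" unfolding P_def by (auto intro!: finite_PiE simp: PiE_eq_empty_iff)
    define \<delta> where "\<delta> = Min (h ` P)"
    have \<delta>: "0 < \<delta>" "\<And>e. e \<in> P \<Longrightarrow> \<delta> \<le> h e" using P pos by (auto simp: \<delta>_def)
    define gap where "gap = (\<lambda>t. \<Sum>i\<in>{1..N}. \<bar>sqrt (s\<^sup>2 - (coupling_sin i t)\<^sup>2) - sqrt (s\<^sup>2 - (\<sigma> i)\<^sup>2)\<bar>)"
    have "(gap \<longlongrightarrow> (\<Sum>i\<in>{1..N}. \<bar>sqrt (s\<^sup>2 - (\<sigma> i)\<^sup>2) - sqrt (s\<^sup>2 - (\<sigma> i)\<^sup>2)\<bar>)) at_top"
      unfolding gap_def by (intro tendsto_intros lim) auto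
    hence "eventually (\<lambda>t. gap t < \<delta>) at_top"
      by (rule order_tendstoD(2)) (use \<delta> in auto)
    with rec[OF s] have "\<exists>\<^sub>F t in at_top. sqrt (order_sq t) = s \<and> gap t < \<delta>"
      by (rule frequently_eventually_frequently)
    then obtain t where t: "sqrt (order_sq t) = s" "gap t < \<delta>" by (auto dest: frequently_ex)
    define e where "e = restrict (\<lambda>i. if coupling_cos i t < 0 then -1 else 1::real) {1..N}"
    have e: "e \<in> P" by (auto simp: e_def P_def)
    have s2: "s\<^sup>2 = order_sq t" using t(1) order_sq_nonneg[of t] by auto
    have C: "coupling_cos i t = e i * sqrt (s\<^sup>2 - (coupling_sin i t)\<^sup>2)" if i: "i \<in> {1..N}" for i
    proof -
      have "s\<^sup>2 - (coupling_sin i t)\<^sup>2 = (coupling_cos i t)\<^sup>2" using coupling_squares[of i t] s2 by simp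
      thus ?thesis using i by (simp add: e_def)
    qed
    have abs_e: "\<bar>e i\<bar> = 1" if "i \<in> {1..N}" for i using that by (simp add: e_def)
    have "real N * s\<^sup>2 = (\<Sum>i\<in>{1..N}. coupling_cos i t)" using N_ge_1 by (simp add: s2 order_sq_def)
    also have "\<dots> = (\<Sum>i\<in>{1..N}. e i * sqrt (s\<^sup>2 - (coupling_sin i t)\<^sup>2))"
      by (intro sum.cong C refl)
    finally have "h e = \<bar>\<Sum>i\<in>{1..N}. e i * (sqrt (s\<^sup>2 - (coupling_sin i t)\<^sup>2) - sqrt (s\<^sup>2 - (\<sigma> i)\<^sup>2))\<bar>"
      by (simp add: h_def sum_subtractf right_diff_distrib)
    also have "\<dots> \<le> (\<Sum>i\<in>{1..N}. \<bar>e i * (sqrt (s\<^sup>2 - (coupling_sin i t)\<^sup>2) - sqrt (s\<^sup>2 - (\<sigma> i)\<^sup>2))\<bar>)"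
      by (rule sum_abs)
    also have "\<dots> = gap t"
      unfolding gap_def by (intro sum.cong refl) (simp add: abs_mult abs_e)
    also have "\<dots> < \<delta>" by (rule t(2))
    finally show False using \<delta>(2)[OF e] by simp
  qed
  \<comment> \<open>The lower end is moved from \<open>a\<close> to the midpoint, so that it exceeds all \<open>\<bar>\<sigma> i\<bar>\<close> strictly.\<close>
  hence "{(a + b) / 2..b} \<subseteq> {s \<in> {(a + b) / 2..b}. self_consistent {1..N} (real N) \<sigma> s}" using ab by auto
  moreover have "finite {s \<in> {(a + b) / 2..b}. self_consistent {1..N} (real N) \<sigma> s}"
    using nonneg[of a] \<sigma> ab N_ge_1 by (intro self_consistent_radii_finite[where M = a]) auto
  ultimately have "finite {(a + b) / 2..b}" by (rule finite_subset)
  thus False using ab infinite_Icc[of "(a + b) / 2" b] by simp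
qed

text \<open>As the modulus converges to a positive limit, so do the squares of the \<open>coupling_cos i\<close>, then
  these functions themselves, being continuous, and then sine and cosine of every phase difference.\<close>
lemma phase_locking_if_coherent:
  assumes bdd: "\<And>i j t. i \<in> {1..N} \<Longrightarrow> j \<in> {1..N} \<Longrightarrow> 0 \<le> t \<Longrightarrow> \<bar>\<theta> i t - \<theta> j t\<bar> \<le> M"
    and r: "0 < r" "eventually (\<lambda>t. r \<le> sqrt (order_sq t)) at_top"
  shows "phase_locking N \<theta>"
  unfolding phase_locking_def
proof (intro ballI)
  fix i j assume ij: "i \<in> {1..N}" "j \<in> {1..N}"
  define \<sigma> where "\<sigma> = (\<lambda>i. - (\<nu> i - mean \<nu>) / \<kappa>)"
  have S: "(coupling_sin i \<longlongrightarrow> \<sigma> i) at_top" if "i \<in> {1..N}" for i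
  proof -
    have "((\<lambda>t. (residual i t - (\<nu> i - mean \<nu>)) / \<kappa>) \<longlongrightarrow> (0 - (\<nu> i - mean \<nu>)) / \<kappa>) at_top"
      using \<kappa>_pos by (intro tendsto_intros residual_tendsto_0[OF bdd that]) auto
    thus ?thesis using \<kappa>_pos by (simp add: residual_def \<sigma>_def)
  qed
  obtain L where L: "((\<lambda>t. sqrt (order_sq t)) \<longlongrightarrow> L) at_top"
    using order_parameter_converges[OF S] by blast
  have "r \<le> L" by (rule tendsto_lowerbound[OF L r(2)]) simp
  hence L0: "0 < L" using r by simp
  have R: "(order_sq \<longlongrightarrow> L\<^sup>2) at_top"
    using tendsto_power[OF L, of 2] order_sq_nonneg by simp
  have C: "\<exists>c. (coupling_cos i \<longlongrightarrow> c) at_top" if i: "i \<in> {1..N}" for i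
  proof (rule converges_if_no_recurrent_interval[where T = 0 and B = 1])
    show "continuous_on {0..} (coupling_cos i)" using i by (rule coupling_continuous)
    show "\<bar>coupling_cos i t\<bar> \<le> 1" for t
    proof -
      have "(coupling_cos i t)\<^sup>2 \<le> 1"
        using coupling_squares[of i t] order_sq_le_1[of t] zero_le_power2[of "coupling_sin i t"] by linarith
      thus ?thesis by (simp add: abs_square_le_1)
    qed
    fix a b :: real
    assume ab: "a < b" and rec: "\<And>s. a \<le> s \<Longrightarrow> s \<le> b \<Longrightarrow> \<exists>\<^sub>F t in at_top. coupling_cos i t = s"
    have "((\<lambda>t. order_sq t - (coupling_sin i t)\<^sup>2) \<longlongrightarrow> L\<^sup>2 - (\<sigma> i)\<^sup>2) at_top"
      by (intro tendsto_intros R S i)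
    hence sq: "((\<lambda>t. (coupling_cos i t)\<^sup>2) \<longlongrightarrow> L\<^sup>2 - (\<sigma> i)\<^sup>2) at_top"
      by (simp flip: coupling_squares[of i])
    have "s\<^sup>2 = L\<^sup>2 - (\<sigma> i)\<^sup>2" if s: "a \<le> s" "s \<le> b" for s
    proof (rule ccontr)
      assume ne: "s\<^sup>2 \<noteq> L\<^sup>2 - (\<sigma> i)\<^sup>2"
      have "eventually (\<lambda>t. (coupling_cos i t)\<^sup>2 \<noteq> s\<^sup>2) at_top"
        using tendsto_imp_eventually_ne[OF sq] ne by auto
      with rec[OF s] have "\<exists>\<^sub>F t in at_top. coupling_cos i t = s \<and> (coupling_cos i t)\<^sup>2 \<noteq> s\<^sup>2"
        by (rule frequently_eventually_frequently)
      thus False by (auto dest: frequently_ex)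
    qed
    hence "{a..b} \<subseteq> {s. s\<^sup>2 = L\<^sup>2 - (\<sigma> i)\<^sup>2}" by auto
    moreover have "finite {s. s\<^sup>2 = L\<^sup>2 - (\<sigma> i)\<^sup>2}"
    proof (rule finite_subset)
      show "{s. s\<^sup>2 = L\<^sup>2 - (\<sigma> i)\<^sup>2} \<subseteq> {sqrt (L\<^sup>2 - (\<sigma> i)\<^sup>2), - sqrt (L\<^sup>2 - (\<sigma> i)\<^sup>2)}"
      proof
        fix x assume "x \<in> {s. s\<^sup>2 = L\<^sup>2 - (\<sigma> i)\<^sup>2}"
        hence "sqrt (L\<^sup>2 - (\<sigma> i)\<^sup>2) = \<bar>x\<bar>" by (metis mem_Collect_eq real_sqrt_abs)
        thus "x \<in> {sqrt (L\<^sup>2 - (\<sigma> i)\<^sup>2), - sqrt (L\<^sup>2 - (\<sigma> i)\<^sup>2)}" by auto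
      qed
    qed auto
    ultimately have "finite {a..b}" by (rule finite_subset)
    thus False using ab infinite_Icc[of a b] by simp
  qed
  obtain ci cj where c: "(coupling_cos i \<longlongrightarrow> ci) at_top" "(coupling_cos j \<longlongrightarrow> cj) at_top"
    using C ij by blast
  have "eventually (\<lambda>t. order_sq t \<noteq> 0) at_top"
    using r(2) by eventually_elim (use r in auto)
  hence cancel: "eventually (\<lambda>t. order_sq t * x t / order_sq t = x t) at_top" for x
    by (auto elim: eventually_mono)
  have "((\<lambda>t. (coupling_cos i t * coupling_cos j t + coupling_sin i t * coupling_sin j t) / order_sq t)
      \<longlongrightarrow> (ci * cj + \<sigma> i * \<sigma> j) / L\<^sup>2) at_top"
    using L0 by (intro tendsto_intros c S ij R) auto
  hence cos_lim: "((\<lambda>t. cos (\<theta> i t - \<theta> j t)) \<longlongrightarrow> (ci * cj + \<sigma> i * \<sigma> j) / L\<^sup>2) at_top"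
    unfolding coupling_products by (rule Lim_transform_eventually[OF _ cancel])
  have "((\<lambda>t. (coupling_cos i t * coupling_sin j t - coupling_sin i t * coupling_cos j t) / order_sq t)
      \<longlongrightarrow> (ci * \<sigma> j - \<sigma> i * cj) / L\<^sup>2) at_top"
    using L0 by (intro tendsto_intros c S ij R) auto
  hence sin_lim: "((\<lambda>t. sin (\<theta> i t - \<theta> j t)) \<longlongrightarrow> (ci * \<sigma> j - \<sigma> i * cj) / L\<^sup>2) at_top"
    unfolding coupling_products by (rule Lim_transform_eventually[OF _ cancel])
  show "\<exists>L. ((\<lambda>t. \<theta> i t - \<theta> j t) \<longlongrightarrow> L) at_top"
  proof (rule converges_if_no_recurrent_interval[where T = 0 and B = M])
    show "continuous_on {0..} (\<lambda>t. \<theta> i t - \<theta> j t)"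
      using ij by (intro continuous_intros phase_continuous) auto
    show "\<bar>\<theta> i t - \<theta> j t\<bar> \<le> M" if "0 \<le> t" for t using bdd ij that by auto
    fix a b :: real
    assume ab: "a < b" and rec: "\<And>s. a \<le> s \<Longrightarrow> s \<le> b \<Longrightarrow> \<exists>\<^sub>F t in at_top. \<theta> i t - \<theta> j t = s"
    have val: "f s = l" if "a \<le> s" "s \<le> b" "((\<lambda>t. f (\<theta> i t - \<theta> j t)) \<longlongrightarrow> l) at_top" for f :: "real \<Rightarrow> real" and s l
    proof (rule ccontr)
      assume "f s \<noteq> l"
      hence "eventually (\<lambda>t. f (\<theta> i t - \<theta> j t) \<noteq> f s) at_top"
        using tendsto_imp_eventually_ne[OF that(3)] by auto
      with rec[OF that(1,2)] have "\<exists>\<^sub>F t in at_top. \<theta> i t - \<theta> j t = s \<and> f (\<theta> i t - \<theta> j t) \<noteq> f s"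
        by (rule frequently_eventually_frequently)
      thus False by (auto dest: frequently_ex)
    qed
    \<comment> \<open>Two recurrent values less than a full turn apart cannot share sine and cosine.\<close>
    define b' where "b' = min b (a + 1)"
    have b': "a < b'" "b' \<le> b" "b' \<le> a + 1" using ab by (auto simp: b'_def)
    have "cos a = cos b'" "sin a = sin b'"
      using val[OF _ _ cos_lim, of a] val[OF _ _ cos_lim, of b'] val[OF _ _ sin_lim, of a] val[OF _ _ sin_lim, of b'] b' ab
      by auto
    hence "cos (b' - a) = 1" by (simp add: cos_diff flip: power2_eq_square)
    moreover have "cos (b' - a) < cos 0"
      using b' pi_gt3 by (intro cos_monotone_0_pi) auto
    ultimately show False by simp
  qed
qed

end

section \<open>Confinement and the maximal majority cluster\<close>

lemma diameter_le_iff_spread_le: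
  assumes C: "finite C" "C \<noteq> {}"
  shows "diameter ((\<lambda>i. \<theta> i t) ` C) \<le> c \<longleftrightarrow> spread_le \<theta> C c t"
proof
  assume le: "diameter ((\<lambda>i. \<theta> i t) ` C) \<le> c"
  show "spread_le \<theta> C c t"
    unfolding spread_le_def
  proof (intro ballI)
    fix i j assume "i \<in> C" "j \<in> C"
    hence "dist (\<theta> i t) (\<theta> j t) \<le> diameter ((\<lambda>i. \<theta> i t) ` C)"
      using C by (intro diameter_bounded_bound finite_imp_bounded) auto
    thus "\<theta> i t - \<theta> j t \<le> c" using le by (simp add: dist_real_def)
  qed
next
  assume sp: "spread_le \<theta> C c t"
  show "diameter ((\<lambda>i. \<theta> i t) ` C) \<le> c"
    using sp C(2) by (intro diameter_le) (auto simp: spread_le_def abs_le_iff)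
qed

lemma Limsup_diameter_le_iff:
  assumes C: "finite C" "C \<noteq> {}"
  shows "Limsup at_top (\<lambda>t. ereal (diameter ((\<lambda>i. \<theta> i t) ` C))) \<le> ereal c \<longleftrightarrow> asymptotic_spread_le \<theta> C c"
  unfolding Limsup_ereal_le_iff asymptotic_spread_le_def diameter_le_iff_spread_le[OF C] ..

lemma asymptotic_spread_le_mono: "asymptotic_spread_le \<theta> C c \<Longrightarrow> D \<subseteq> C \<Longrightarrow> asymptotic_spread_le \<theta> D c"
  unfolding asymptotic_spread_le_def by (auto elim!: eventually_mono intro: spread_le_mono)

lemma spread_le_translate_cong:
  assumes "\<And>i. i \<in> C \<Longrightarrow> k i = k' i"
  shows "spread_le (translate k \<theta>) C c t \<longleftrightarrow> spread_le (translate k' \<theta>) C c t"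
  using assms by (simp add: spread_le_def translate_def)

lemma asymptotic_spread_le_translate_cong:
  assumes "\<And>i. i \<in> C \<Longrightarrow> k i = k' i"
  shows "asymptotic_spread_le (translate k \<theta>) C c \<longleftrightarrow> asymptotic_spread_le (translate k' \<theta>) C c"
proof -
  have "spread_le (translate k \<theta>) C c' = spread_le (translate k' \<theta>) C c'" for c'
    by (rule ext) (rule spread_le_translate_cong[OF assms])
  thus ?thesis by (simp add: asymptotic_spread_le_def)
qed

lemma translate_0 [simp]: "translate (\<lambda>_. 0) \<theta> = \<theta>"
  by (simp add: translate_def fun_eq_iff)

text \<open>The translation that moves only the phase of \<open>i\<close>, by \<open>n\<close> turns.\<close>
definition shift_one :: "nat \<Rightarrow> int \<Rightarrow> nat \<Rightarrow> int" where
  "shift_one i n = (\<lambda>_. 0)(i := n)"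

context majority_kuramoto
begin

text \<open>Translated phases solve the same equations, and a superset of a majority is a majority. So all
  results on majority clusters apply to \<open>A\<close> enlarged by translated oscillators.\<close>
lemma translated_cluster:
  assumes "A \<subseteq> C" "C \<subseteq> {1..N}"
  shows "majority_kuramoto lam N m \<kappa> \<nu> (\<lambda>i. \<theta>0 i - 2 * of_int (k i) * pi) \<omega>0 (translate k \<theta>) \<omega> C"
proof -
  interpret K: kuramoto N m \<kappa> \<nu> "\<lambda>i. \<theta>0 i - 2 * of_int (k i) * pi" \<omega>0 "translate k \<theta>" \<omega>
    by (rule translate_kuramoto)
  have "card A \<le> card C" using assms by (intro card_mono) (auto intro: finite_subset)
  thus ?thesis using assms(2) A_majority by unfold_locales auto
qed

text \<open>The modulus of the order parameter dominates its component in the direction of the centre of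
  the cluster, from which no member is further away than \<open>l / 2\<close>.\<close>
lemma coherence:
  assumes sp: "spread_le \<theta> A l t" and l: "0 < l" "l < cutoff"
  shows "lam * cos (l / 2) - (1 - lam) \<le> sqrt (order_sq t)"
proof -
  define hi where "hi = Max ((\<lambda>k. \<theta> k t) ` A)"
  define lo where "lo = Min ((\<lambda>k. \<theta> k t) ` A)"
  define c where "c = (hi + lo) / 2"
  have "hi \<in> (\<lambda>k. \<theta> k t) ` A" "lo \<in> (\<lambda>k. \<theta> k t) ` A"
    unfolding hi_def lo_def using A_finite A_nonempty by (auto intro!: Max_in Min_in)
  hence spread: "hi - lo \<le> l" using sp by (auto simp: spread_le_def)
  have range: "lo \<le> \<theta> k t" "\<theta> k t \<le> hi" if "k \<in> A" for k
    unfolding hi_def lo_def using A_finite that by auto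
  have near: "\<bar>\<theta> k t - c\<bar> \<le> l / 2" if "k \<in> A" for k
    using range[OF that] spread unfolding c_def abs_le_iff by argo
  define X where "X = mean (\<lambda>k. cos (\<theta> k t))"
  define Y where "Y = mean (\<lambda>k. sin (\<theta> k t))"
  have "real N * (lam * cos (l / 2) - (1 - lam)) \<le> (\<Sum>k=1..N. cos (\<theta> k t - c))"
    using near l cutoff_bounds by (intro majority_cos_sum_ge) auto
  also have "\<dots> = real N * (X * cos c + Y * sin c)"
    unfolding cos_diff sum.distrib sum_distrib_right[symmetric] X_def Y_def mean_def
    using N_ge_1 by (simp add: field_simps)
  finally have "lam * cos (l / 2) - (1 - lam) \<le> X * cos c + Y * sin c" using N_ge_1 by simp
  also have "\<dots> \<le> sqrt (order_sq t)"
  proof (rule real_le_rsqrt)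
    have "(X * cos c + Y * sin c)\<^sup>2 + (X * sin c - Y * cos c)\<^sup>2
        = (X\<^sup>2 + Y\<^sup>2) * ((sin c)\<^sup>2 + (cos c)\<^sup>2)" by algebra
    hence "(X * cos c + Y * sin c)\<^sup>2 + (X * sin c - Y * cos c)\<^sup>2 = order_sq t"
      by (simp add: order_sq_eq X_def Y_def)
    thus "(X * cos c + Y * sin c)\<^sup>2 \<le> order_sq t" by (metis le_add_same_cancel1 zero_le_power2)
  qed
  finally show ?thesis .
qed

end

text \<open>The situation after the majority cluster has settled: \<open>V\<close> bounds the frequency differences in
  \<open>B\<close>, and the level for \<open>B\<close> is still below \<open>f_lam lam l\<close>.\<close>
locale majority_confinement = majority_kuramoto +
  fixes B :: "nat set" and V l t1 :: real
  assumes A_subset_B: "A \<subseteq> B" and B_subset: "B \<subseteq> {1..N}"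
    and V_bound: "diffs_le \<nu> B V"
    and l_pos: "0 < l" and l_less_cutoff: "l < cutoff"
    and level_less: "level m \<kappa> V < f_lam lam l"
    and A_stays: "\<And>t. t1 \<le> t \<Longrightarrow> spread_le \<theta> A l t"
begin

abbreviation "\<phi>\<^sub>1 \<equiv> phi1 lam (level m \<kappa> V)"
abbreviation "\<phi>\<^sub>2 \<equiv> phi2 lam (level m \<kappa> V)"

lemma B_finite: "finite B" using B_subset by (auto intro: finite_subset)

lemma V_nonneg: "0 \<le> V"
proof -
  obtain a where "a \<in> A" using A_nonempty by blast
  thus ?thesis using diffs_le_nonneg[OF V_bound] A_subset_B by auto
qed

lemmas phi_facts = phi_props[OF l_pos l_less_cutoff level_pos[OF V_nonneg] level_less]

abbreviation "shifted i n \<equiv> translate (shift_one i n) \<theta>"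

text \<open>From time \<open>T\<close> on, any translated subset of \<open>B\<close> containing \<open>A\<close> that has diameter at most \<open>l'\<close> keeps
  this bound and contracts to the smaller root.\<close>
definition captures_from :: "real \<Rightarrow> real \<Rightarrow> bool" where
  "captures_from l' T \<longleftrightarrow> (\<forall>C k t. A \<subseteq> C \<longrightarrow> C \<subseteq> B \<longrightarrow> T \<le> t \<longrightarrow> spread_le (translate k \<theta>) C l' t \<longrightarrow>
     (\<forall>s\<ge>t. spread_le (translate k \<theta>) C l' s) \<and> asymptotic_spread_le (translate k \<theta>) C \<phi>\<^sub>1)"

lemma capturesD:
  assumes "captures_from l' T" "A \<subseteq> C" "C \<subseteq> B" "T \<le> t" "spread_le (translate k \<theta>) C l' t"
  shows "t \<le> s \<Longrightarrow> spread_le (translate k \<theta>) C l' s" "asymptotic_spread_le (translate k \<theta>) C \<phi>\<^sub>1"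
  using assms unfolding captures_from_def by blast+

text \<open>The time \<open>T\<close> is uniform in the subset and the translation because the bounds \<open>V\<close> and \<open>W\<close> for
  all of \<open>B\<close> serve for each of its subsets.\<close>
lemma capture:
  assumes l': "0 < l'" "l' < cutoff" "level m \<kappa> V < f_lam lam l'"
  obtains T where "0 < T" "captures_from l' T"
proof -
  obtain W where W: "diffs_le \<omega>0 B W" using finite_diffs_le[OF B_finite] .
  obtain \<eta> where \<eta>: "0 < \<eta>" "2 * lag_bound m \<kappa> V W \<eta> < f_lam lam l'"
    using lag_bound_eventually_below[of m V \<kappa> "f_lam lam l'" W] l'(3) unfolding level_def by blast
  show ?thesis
  proof (rule that[of "\<eta> * m"])
    show "0 < \<eta> * m" using \<eta> m_pos by simp
    show "captures_from l' (\<eta> * m)"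
      unfolding captures_from_def
    proof (intro allI impI)
      fix C k t
      assume C: "A \<subseteq> C" "C \<subseteq> B" and t: "\<eta> * m \<le> t" and sp: "spread_le (translate k \<theta>) C l' t"
      interpret K: majority_kuramoto lam N m \<kappa> \<nu> "\<lambda>i. \<theta>0 i - 2 * of_int (k i) * pi" \<omega>0 "translate k \<theta>" \<omega> C
        using C B_subset by (intro translated_cluster) auto
      note bounds = diffs_le_mono[OF V_bound C(2)] diffs_le_mono[OF W C(2)]
      show "(\<forall>s\<ge>t. spread_le (translate k \<theta>) C l' s) \<and> asymptotic_spread_le (translate k \<theta>) C \<phi>\<^sub>1"
      proof (intro conjI allI impI)
        show "spread_le (translate k \<theta>) C l' s" if "t \<le> s" for s
          using bounds l'(1,2) \<eta>(2,1) t sp that by (rule K.cluster_stays)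
        show "asymptotic_spread_le (translate k \<theta>) C \<phi>\<^sub>1"
          using bounds l'(1,2) \<eta>(2,1) t sp by (rule K.cluster_contracts)
      qed
    qed
  qed
qed

lemma A_asymptotic: "asymptotic_spread_le \<theta> A \<phi>\<^sub>1"
proof -
  obtain T where T: "captures_from l T" using capture[OF l_pos l_less_cutoff level_less] by blast
  show ?thesis
    using capturesD(2)[OF T, of A "max t1 T" "\<lambda>_. 0"] A_subset_B A_stays by simp
qed

text \<open>If \<open>\<theta> i\<close> meets \<open>\<theta> a\<close> modulo \<open>2 \<pi>\<close> at a late time, the translate that meets it lies inside the
  range of \<open>A\<close> at that moment and is captured. Otherwise \<open>\<theta> i - \<theta> a\<close> never equals a multiple of
  \<open>2 \<pi>\<close> and cannot move by more than \<open>2 \<pi>\<close>.\<close>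
lemma phase_diff_bounded_from_A:
  assumes i: "i \<in> B" and a: "a \<in> A"
  shows "\<exists>M. \<forall>t\<ge>0. \<bar>\<theta> i t - \<theta> a t\<bar> \<le> M"
proof -
  obtain T0 where T0: "0 < T0" "captures_from l T0"
    using capture[OF l_pos l_less_cutoff level_less] by blast
  define T where "T = max t1 T0"
  have T: "0 < T" "t1 \<le> T" "T0 \<le> T" using T0 by (auto simp: T_def)
  define x where "x = (\<lambda>t. \<theta> i t - \<theta> a t)"
  have iN: "i \<in> {1..N}" "a \<in> {1..N}" using i a A_subset B_subset by auto
  have cont: "continuous_on S x" if "S \<subseteq> {0..}" for S
    unfolding x_def using iN that by (intro continuous_intros phase_continuous) auto
  have late: "\<exists>S\<ge>0. \<exists>M. \<forall>t\<ge>S. \<bar>x t\<bar> \<le> M"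
  proof (cases "\<exists>s\<ge>T. \<exists>n::int. x s = 2 * pi * of_int n")
    case True
    then obtain s n where s: "T \<le> s" "x s = 2 * pi * of_int n" by blast
    show ?thesis
    proof (cases "i = a")
      case True
      hence "\<forall>t\<ge>0. \<bar>x t\<bar> \<le> 0" by (simp add: x_def)
      thus ?thesis by blast
    next
      case False
      have eq: "shifted i n j s = (if j = i then \<theta> a s else \<theta> j s)" for j
        using s by (auto simp: translate_def shift_one_def x_def algebra_simps)
      have A: "spread_le \<theta> A l s" using A_stays s T by simp
      have sp: "spread_le (shifted i n) (insert i A) l s"
        using A a l_pos unfolding spread_le_def eq by auto
      have C: "A \<subseteq> insert i A" "insert i A \<subseteq> B" "T0 \<le> s" using i A_subset_B s T by auto
      have "\<bar>shifted i n i t - shifted i n a t\<bar> \<le> l" if "s \<le> t" for t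
      proof -
        have "spread_le (shifted i n) (insert i A) l t"
          using that by (rule capturesD(1)[OF T0(2) C sp])
        hence "shifted i n i t - shifted i n a t \<le> l"
            "shifted i n a t - shifted i n i t \<le> l"
          using a by (simp_all add: spread_le_def)
        thus ?thesis by (simp add: abs_le_iff)
      qed
      hence near: "\<bar>x t - 2 * pi * of_int n\<bar> \<le> l" if "s \<le> t" for t
        using that False by (simp add: translate_def shift_one_def x_def algebra_simps)
      have "\<bar>x t\<bar> \<le> l + \<bar>2 * pi * of_int n\<bar>" if "s \<le> t" for t
        using near[OF that] by linarith
      moreover have "0 \<le> s" using s T by simp
      ultimately show ?thesis by blast
    qed
  next
    case False
    have "\<bar>x t\<bar> \<le> \<bar>x T\<bar> + 2 * pi" if t: "T \<le> t" for t
    proof (rule ccontr)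
      assume "\<not> \<bar>x t\<bar> \<le> \<bar>x T\<bar> + 2 * pi"
      hence "x T + 2 * pi < x t \<or> x t < x T - 2 * pi" by linarith
      thus False
      proof
        assume gt: "x T + 2 * pi < x t"
        define n where "n = \<lceil>x T / (2 * pi)\<rceil>"
        have "x T / (2 * pi) \<le> of_int n" "of_int n \<le> x T / (2 * pi) + 1" unfolding n_def by linarith+
        hence "x T \<le> 2 * pi * of_int n" "2 * pi * of_int n \<le> x T + 2 * pi" by (auto simp: field_simps)
        hence "\<exists>s\<ge>T. s \<le> t \<and> x s = 2 * pi * of_int n"
          using gt t T by (intro IVT' cont) auto
        thus False using False by blast
      next
        assume lt: "x t < x T - 2 * pi"
        define n where "n = \<lfloor>x T / (2 * pi)\<rfloor>"
        have "of_int n \<le> x T / (2 * pi)" "x T / (2 * pi) - 1 \<le> of_int n" unfolding n_def by linarith+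
        hence "2 * pi * of_int n \<le> x T" "x T - 2 * pi \<le> 2 * pi * of_int n" by (auto simp: field_simps)
        hence "\<exists>s\<ge>T. s \<le> t \<and> x s = 2 * pi * of_int n"
          using lt t T by (intro IVT2' cont) auto
        thus False using False by blast
      qed
    qed
    moreover have "0 \<le> T" using T by simp
    ultimately show ?thesis by blast
  qed
  then obtain S M where S: "0 \<le> S" "\<And>t. S \<le> t \<Longrightarrow> \<bar>x t\<bar> \<le> M" by blast
  have "bounded (x ` {0..S})" by (intro compact_imp_bounded compact_continuous_image cont) auto
  then obtain M' where "\<forall>t\<in>{0..S}. \<bar>x t\<bar> \<le> M'" unfolding bounded_iff by auto
  hence M': "\<bar>x t\<bar> \<le> M'" if "t \<in> {0..S}" for t using that by blast
  have "\<bar>x t\<bar> \<le> max M M'" if "0 \<le> t" for t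
    using S(2)[of t] M'[of t] that by (cases "S \<le> t") auto
  thus ?thesis unfolding x_def by blast
qed

lemma phase_diffs_bounded:
  "\<exists>M. \<forall>i\<in>B. \<forall>j\<in>B. \<forall>t\<ge>0. \<bar>\<theta> i t - \<theta> j t\<bar> \<le> M"
proof -
  obtain a where a: "a \<in> A" using A_nonempty by blast
  have "\<forall>i\<in>B. \<exists>M. \<forall>t\<ge>0. \<bar>\<theta> i t - \<theta> a t\<bar> \<le> M" using phase_diff_bounded_from_A a by blast
  then obtain F where F: "\<And>i t. i \<in> B \<Longrightarrow> 0 \<le> t \<Longrightarrow> \<bar>\<theta> i t - \<theta> a t\<bar> \<le> F i" by metis
  have F_le: "F i \<le> (\<Sum>i\<in>B. \<bar>F i\<bar>)" if "i \<in> B" for i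
    using member_le_sum[OF that, of "\<lambda>i. \<bar>F i\<bar>"] B_finite by auto
  have "\<bar>\<theta> i t - \<theta> j t\<bar> \<le> 2 * (\<Sum>i\<in>B. \<bar>F i\<bar>)" if "i \<in> B" "j \<in> B" "0 \<le> t" for i j t
    using F[of i t] F[of j t] F_le[of i] F_le[of j] that by linarith
  thus ?thesis by blast
qed

lemma phase_locking_of_whole_population:
  assumes "B = {1..N}"
  shows "phase_locking N \<theta>"
proof -
  obtain M where M: "\<And>i j t. i \<in> {1..N} \<Longrightarrow> j \<in> {1..N} \<Longrightarrow> 0 \<le> t \<Longrightarrow> \<bar>\<theta> i t - \<theta> j t\<bar> \<le> M"
    using phase_diffs_bounded unfolding assms by blast
  show ?thesis
  proof (rule phase_locking_if_coherent[OF M])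
    show "0 < lam * cos (l / 2) - (1 - lam)"
      using cos_half_gt[of l] l_pos l_less_cutoff by simp
    show "eventually (\<lambda>t. lam * cos (l / 2) - (1 - lam) \<le> sqrt (order_sq t)) at_top"
      using eventually_ge_at_top[of t1]
      by eventually_elim (intro coherence A_stays l_pos l_less_cutoff)
  qed
qed

definition captured_by :: "nat \<Rightarrow> int \<Rightarrow> bool" where
  "captured_by i n \<longleftrightarrow> asymptotic_spread_le (shifted i n) (insert i A) \<phi>\<^sub>1"

definition A_max :: "nat set" where
  "A_max = {i \<in> B. \<exists>n. captured_by i n}"

text \<open>Phases of \<open>A\<close> stay untranslated, as \<open>maximal_majority_cluster\<close> demands; the choice matters for
  the captured oscillators outside \<open>A\<close> only, and is arbitrary for the others.\<close>
definition turns :: "nat \<Rightarrow> int" where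
  "turns i = (if i \<in> A then 0 else SOME n. captured_by i n)"

lemma captured_by_translate:
  assumes "\<And>j. j \<in> A \<Longrightarrow> k j = 0" and "i \<in> A \<Longrightarrow> n = 0"
  shows "asymptotic_spread_le (translate (k(i := n)) \<theta>) (insert i A) \<phi>\<^sub>1 \<longleftrightarrow> captured_by i n"
  unfolding captured_by_def
  by (rule asymptotic_spread_le_translate_cong) (use assms in \<open>auto simp: shift_one_def\<close>)

lemma A_captured: "i \<in> A \<Longrightarrow> captured_by i 0"
  using A_asymptotic by (simp add: captured_by_def shift_one_def insert_absorb fun_upd_idem)

lemma A_max_sandwich: "A \<subseteq> A_max" "A_max \<subseteq> B"
  using A_subset_B A_captured by (auto simp: A_max_def)

lemma captured_by_turns: "i \<in> A_max \<Longrightarrow> captured_by i (turns i)"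
  unfolding turns_def A_max_def using A_captured by (auto intro: someI_ex)

lemma union_asymptotic:
  assumes U: "A \<subseteq> U" "U \<subseteq> B" and k: "\<And>j. j \<in> A \<Longrightarrow> k j = 0"
    and cap: "\<And>i. i \<in> U \<Longrightarrow> captured_by i (k i)"
  shows "asymptotic_spread_le (translate k \<theta>) U \<phi>\<^sub>1"
proof -
  interpret K: majority_kuramoto lam N m \<kappa> \<nu> "\<lambda>i. \<theta>0 i - 2 * of_int (k i) * pi" \<omega>0 "translate k \<theta>" \<omega> A
    by (rule translated_cluster) (use A_subset in auto)
  show ?thesis
  proof (rule K.union_of_clusters_contracts[OF U(1) _ _ l_pos l_less_cutoff level_less])
    fix i assume "i \<in> U"
    thus "asymptotic_spread_le (translate k \<theta>) (insert i A) \<phi>\<^sub>1"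
      using captured_by_translate[of k i "k i"] k cap by simp
  next
    show "diffs_le \<nu> U V" using V_bound U(2) by (rule diffs_le_mono)
  qed (use U B_subset in auto)
qed

lemma A_max_asymptotic: "asymptotic_spread_le (translate turns \<theta>) A_max \<phi>\<^sub>1"
  using A_max_sandwich captured_by_turns by (intro union_asymptotic) (auto simp: turns_def)

text \<open>Capture works from every diameter \<open>l'\<close> below the larger root. An oscillator that comes closer than
  \<open>l'\<close> at a late time is captured and thus belongs to \<open>A_max\<close>.\<close>
lemma outsiders_stay_away:
  assumes c: "c < \<phi>\<^sub>2"
  shows "eventually (\<lambda>t. \<forall>i\<in>B - A_max. \<forall>n. \<not> spread_le (shifted i n) (insert i A) c t) at_top"
proof -
  have "max l c < \<phi>\<^sub>2" using c phi_facts by simp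
  then obtain l' where l': "max l c < l'" "l' < \<phi>\<^sub>2" using dense by blast
  have "0 < l'" "l' < cutoff" "level m \<kappa> V < f_lam lam l'" using l' phi_facts l_pos by auto
  then obtain T where T: "captures_from l' T" using capture by blast
  show ?thesis
    using eventually_ge_at_top[of T]
  proof eventually_elim
    case (elim t)
    show ?case
    proof (intro ballI allI notI)
      fix i n assume i: "i \<in> B - A_max" and sp: "spread_le (shifted i n) (insert i A) c t"
      have "spread_le (shifted i n) (insert i A) l' t"
        using sp by (rule spread_le_mono) (use l' in auto)
      hence "captured_by i n"
        unfolding captured_by_def using i A_subset_B elim by (intro capturesD(2)[OF T, of _ t]) auto
      thus False using i by (auto simp: A_max_def)
    qed
  qed
qed

lemma maximal_majority_cluster_A_max:
  "maximal_majority_cluster lam (level m \<kappa> V) \<theta> A B turns A_max"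
  unfolding maximal_majority_cluster_def
proof (intro conjI impI)
  have fin: "finite A_max" "A_max \<noteq> {}" using A_max_sandwich B_finite A_nonempty by (auto intro: finite_subset)
  show "A \<subseteq> A_max" "A_max \<subseteq> B" by (rule A_max_sandwich)+
  show "\<forall>i\<in>A. turns i = 0" by (simp add: turns_def)
  show "Limsup at_top (\<lambda>t. ereal (diameter ((\<lambda>i. translate turns \<theta> i t) ` A_max))) \<le> ereal \<phi>\<^sub>1"
    unfolding Limsup_diameter_le_iff[OF fin] by (rule A_max_asymptotic)
  have A_turns: "translate turns \<theta> j t = \<theta> j t" if "j \<in> A" for j t
    using that by (simp add: translate_def turns_def)
  have shifted_eq: "shifted i n j t = (if j = i then \<theta> i t - 2 * pi * of_int n else \<theta> j t)" for i j n t
    by (simp add: translate_def shift_one_def)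
  show "ereal \<phi>\<^sub>2 \<le> Liminf at_top (\<lambda>t. INF i\<in>B - A_max. INF n\<in>(UNIV :: int set).
      ereal (diameter (insert (\<theta> i t - 2 * pi * of_int n) ((\<lambda>j. translate turns \<theta> j t) ` A_max))))"
    (is "_ \<le> Liminf at_top ?F")
    unfolding le_Liminf_ereal_iff
  proof (intro allI impI)
    fix c assume "c < \<phi>\<^sub>2"
    from outsiders_stay_away[OF this]
    show "eventually (\<lambda>t. ereal c \<le> ?F t) at_top"
    proof eventually_elim
      case (elim t)
      show ?case
      proof (intro INF_greatest)
        fix i and n :: int assume i: "i \<in> B - A_max"
        have iA: "i \<notin> A" using i A_max_sandwich by auto
        let ?X = "insert (\<theta> i t - 2 * pi * of_int n) ((\<lambda>j. translate turns \<theta> j t) ` A_max)"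
        have "\<not> spread_le (shifted i n) (insert i A) c t" using elim i by blast
        then obtain p q where pq: "p \<in> insert i A" "q \<in> insert i A"
            "c < shifted i n p t - shifted i n q t"
          unfolding spread_le_def by (meson not_le)
        have "shifted i n j t \<in> ?X" if "j \<in> insert i A" for j
        proof (cases "j = i")
          case False
          hence j: "j \<in> A" using that by simp
          hence "translate turns \<theta> j t \<in> (\<lambda>j. translate turns \<theta> j t) ` A_max"
            using A_max_sandwich by (intro imageI) auto
          thus ?thesis using False A_turns[OF j] by (simp add: shifted_eq)
        qed (simp add: shifted_eq)
        hence "dist (shifted i n p t) (shifted i n q t) \<le> diameter ?X"
          using pq fin by (intro diameter_bounded_bound finite_imp_bounded) auto
        thus "ereal c \<le> ereal (diameter ?X)" using pq(3) by (simp add: dist_real_def)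
      qed
    qed
  qed
  show "ereal (\<phi>\<^sub>2 - \<phi>\<^sub>1) \<le> Liminf at_top (\<lambda>t. INF i\<in>B - A_max. INF j\<in>A_max. INF n\<in>(UNIV :: int set).
      ereal \<bar>\<theta> i t - 2 * pi * of_int n - translate turns \<theta> j t\<bar>)"
    (is "_ \<le> Liminf at_top ?G")
    unfolding le_Liminf_ereal_iff
  proof (intro allI impI)
    fix c assume c: "c < \<phi>\<^sub>2 - \<phi>\<^sub>1"
    define e where "e = (\<phi>\<^sub>2 - \<phi>\<^sub>1 - c) / 2"
    have e: "0 < e" "\<phi>\<^sub>2 - e = c + (\<phi>\<^sub>1 + e)" using c by (auto simp: e_def field_simps)
    have "eventually (spread_le (translate turns \<theta>) A_max (\<phi>\<^sub>1 + e)) at_top"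
      using A_max_asymptotic e by (simp add: asymptotic_spread_le_def)
    moreover have "eventually (\<lambda>t. \<forall>i\<in>B - A_max. \<forall>n. \<not> spread_le (shifted i n) (insert i A) (\<phi>\<^sub>2 - e) t) at_top"
      using e by (intro outsiders_stay_away) simp
    ultimately show "eventually (\<lambda>t. ereal c \<le> ?G t) at_top"
    proof eventually_elim
      case (elim t)
      show ?case
      proof (intro INF_greatest)
        fix i j and n :: int assume i: "i \<in> B - A_max" and j: "j \<in> A_max"
        have iA: "i \<notin> A" using i A_max_sandwich by auto
        show "ereal c \<le> ereal \<bar>\<theta> i t - 2 * pi * of_int n - translate turns \<theta> j t\<bar>"
        proof (rule ccontr)
          assume "\<not> ereal c \<le> ereal \<bar>\<theta> i t - 2 * pi * of_int n - translate turns \<theta> j t\<bar>"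
          hence close: "\<bar>\<theta> i t - 2 * pi * of_int n - translate turns \<theta> j t\<bar> < c" by simp
          hence c0: "0 < c" by linarith
          have A: "\<bar>\<theta> p t - translate turns \<theta> q t\<bar> \<le> \<phi>\<^sub>1 + e" if "p \<in> A" "q \<in> A_max" for p q
          proof -
            have "translate turns \<theta> p t - translate turns \<theta> q t \<le> \<phi>\<^sub>1 + e"
                "translate turns \<theta> q t - translate turns \<theta> p t \<le> \<phi>\<^sub>1 + e"
              using elim(1) that A_max_sandwich unfolding spread_le_def by blast+
            thus ?thesis using A_turns[OF that(1)] by (simp add: abs_le_iff)
          qed
          have AA: "\<theta> p t - \<theta> q t \<le> \<phi>\<^sub>2 - e" if "p \<in> A" "q \<in> A" for p q
            using A[of p q] A_turns[OF that(2), of t] that A_max_sandwich c0 e by auto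
          have iA': "\<bar>\<theta> i t - 2 * pi * of_int n - \<theta> p t\<bar> \<le> \<phi>\<^sub>2 - e" if "p \<in> A" for p
            using A[OF that j] close e by linarith
          have "spread_le (shifted i n) (insert i A) (\<phi>\<^sub>2 - e) t"
            unfolding spread_le_def
          proof (intro ballI)
            fix p q assume pq: "p \<in> insert i A" "q \<in> insert i A"
            have "0 \<le> \<phi>\<^sub>2 - e" using e c0 phi_facts(1) by linarith
            thus "shifted i n p t - shifted i n q t \<le> \<phi>\<^sub>2 - e"
              using pq AA[of p q] iA'[of p] iA'[of q] unfolding shifted_eq abs_le_iff by auto
          qed
          thus False using elim(2) i by blast
        qed
      qed
    qed
  qed
qed

text \<open>Every member of a maximal majority cluster \<open>M\<close> is captured, so \<open>M \<subseteq> A_max\<close>. If \<open>i\<close> in \<open>A_max\<close>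
  were missing from \<open>M\<close>, then \<open>M \<union> {i}\<close> would contract to the smaller root, whereas \<open>M\<close> repels the
  oscillators outside it up to the larger one.\<close>
lemma maximal_majority_cluster_unique:
  assumes mmc: "maximal_majority_cluster lam (level m \<kappa> V) \<theta> A B k M"
  shows "M = A_max"
proof
  have M: "A \<subseteq> M" "M \<subseteq> B" and k: "\<And>i. i \<in> A \<Longrightarrow> k i = 0"
    using mmc by (auto simp: maximal_majority_cluster_def)
  have fin: "finite M" "M \<noteq> {}" using M B_finite A_nonempty by (auto intro: finite_subset)
  have sp: "asymptotic_spread_le (translate k \<theta>) M \<phi>\<^sub>1"
    using mmc unfolding maximal_majority_cluster_def Limsup_diameter_le_iff[OF fin] by blast
  have cap: "captured_by i (k i)" if "i \<in> M" for i
  proof -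
    have "asymptotic_spread_le (translate k \<theta>) (insert i A) \<phi>\<^sub>1"
      using sp by (rule asymptotic_spread_le_mono) (use that M in auto)
    thus ?thesis using captured_by_translate[of k i "k i"] k by simp
  qed
  show "M \<subseteq> A_max" using cap M by (auto simp: A_max_def)
  show "A_max \<subseteq> M"
  proof
    fix i assume i: "i \<in> A_max"
    show "i \<in> M"
    proof (rule ccontr)
      assume iM: "i \<notin> M"
      have iB: "i \<in> B" using i A_max_sandwich by auto
      define k' where "k' = k(i := turns i)"
      have "asymptotic_spread_le (translate k' \<theta>) (insert i M) \<phi>\<^sub>1"
        using M iB k cap iM captured_by_turns[OF i]
        by (intro union_asymptotic) (auto simp: k'_def turns_def)
      moreover obtain c where c: "\<phi>\<^sub>1 < c" "c < \<phi>\<^sub>2" using dense[of \<phi>\<^sub>1 \<phi>\<^sub>2] phi_facts by force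
      ultimately have ev1: "eventually (spread_le (translate k' \<theta>) (insert i M) c) at_top"
        by (simp add: asymptotic_spread_le_def)
      obtain c' where c': "c < c'" "c' < \<phi>\<^sub>2" using dense c by blast
      have "ereal \<phi>\<^sub>2 \<le> Liminf at_top (\<lambda>t. INF i\<in>B - M. INF n\<in>(UNIV :: int set).
          ereal (diameter (insert (\<theta> i t - 2 * pi * of_int n) ((\<lambda>j. translate k \<theta> j t) ` M))))"
        (is "_ \<le> Liminf at_top ?F")
        using mmc iM iB unfolding maximal_majority_cluster_def by blast
      hence "eventually (\<lambda>t. ereal c' \<le> ?F t) at_top"
        unfolding le_Liminf_ereal_iff using c' by blast
      with ev1 have "eventually (\<lambda>t. c' \<le> c) (at_top :: real filter)"
      proof eventually_elim
        case (elim t)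
        have eq: "insert (\<theta> i t - 2 * pi * of_int (turns i)) ((\<lambda>j. translate k \<theta> j t) ` M)
            = (\<lambda>j. translate k' \<theta> j t) ` insert i M"
          using iM by (auto simp: translate_def k'_def image_iff)
        have "ereal c' \<le> (INF n\<in>(UNIV :: int set). ereal (diameter (insert (\<theta> i t - 2 * pi * of_int n) ((\<lambda>j. translate k \<theta> j t) ` M))))"
          using elim(2) by (rule order_trans) (rule INF_lower, use iB iM in auto)
        also have "\<dots> \<le> ereal (diameter (insert (\<theta> i t - 2 * pi * of_int (turns i)) ((\<lambda>j. translate k \<theta> j t) ` M)))"
          by (rule INF_lower) simp
        finally have "c' \<le> diameter ((\<lambda>j. translate k' \<theta> j t) ` insert i M)" unfolding eq by simp
        moreover have "diameter ((\<lambda>j. translate k' \<theta> j t) ` insert i M) \<le> c"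
          using elim(1) fin by (subst diameter_le_iff_spread_le) auto
        ultimately show ?case by simp
      qed
      thus False using c' by simp
    qed
  qed
qed

end

lemma delta_eq_level: "delta m \<kappa> S = level m \<kappa> (diameter S)"
  by (simp add: delta_def level_def)

lemma diffs_le_diameter: "finite C \<Longrightarrow> diffs_le x C (diameter (x ` C))"
  unfolding diffs_le_def dist_real_def[symmetric]
  by (auto intro!: diameter_bounded_bound finite_imp_bounded)

theorem theorem4p1:
  fixes N :: nat and m \<kappa> lam l \<eta> t1 :: real
    and \<nu> \<theta>0 \<omega>0 :: "nat \<Rightarrow> real"
    and \<theta> \<omega> :: "nat \<Rightarrow> real \<Rightarrow> real"
    and A :: "nat set"
  assumes "N \<ge> 1" and "m > 0" and "\<kappa> > 0"
    and "inertial_kuramoto N m \<kappa> \<nu> \<theta>0 \<omega>0 \<theta> \<omega>"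
    and "1 / 2 < lam" and "lam \<le> 1"
    and "l \<in> {0<..<2 * arccos (1 / lam - 1)}"
    and "A \<subseteq> {1..N}" and "real (card A) \<ge> lam * real N"
    and "\<eta> > 0"
    and "xi m \<kappa> (\<nu> ` A) (\<omega>0 ` A) \<eta> < lam / 2 * sin l - (1 - lam) * sin (l / 2)"
    and "t1 \<ge> \<eta> * m"
    and "diameter ((\<lambda>i. \<theta> i t1) ` A) \<le> l"
  shows
    "((SUP t\<in>{t1..}. ereal (diameter ((\<lambda>i. \<theta> i t) ` A))) \<le> ereal l \<and>
      Limsup at_top (\<lambda>t. ereal (diameter ((\<lambda>i. \<theta> i t) ` A)))
        \<le> ereal (phi1 lam (delta m \<kappa> (\<nu> ` A))) \<and>
      phi1 lam (delta m \<kappa> (\<nu> ` A)) < 3 * pi / (4 * (2 * lam - 1)) * delta m \<kappa> (\<nu> ` A)) \<and>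
     (delta m \<kappa> (\<nu> ` A) < arrangement_threshold lam \<longrightarrow>
        linearly_arranged \<kappa> \<nu> lam (phi1 lam (delta m \<kappa> (\<nu> ` A))) \<theta> A) \<and>
     (\<forall>B. A \<subseteq> B \<and> B \<subseteq> {1..N} \<and>
          m * diameter (\<nu> ` B) + 2 * m * \<kappa> + diameter (\<nu> ` B) / (2 * \<kappa>)
            < lam / 2 * sin l - (1 - lam) * sin (l / 2) \<longrightarrow>
        ((SUP t\<in>{0..}. ereal (diameter ((\<lambda>i. \<theta> i t) ` B))) < \<infinity> \<and>
         (B = {1..N} \<longrightarrow> phase_locking N \<theta>)) \<and>
        (\<exists>!M. \<exists>k. maximal_majority_cluster lam (delta m \<kappa> (\<nu> ` B)) \<theta> A B k M) \<and>
        (\<forall>M k. maximal_majority_cluster lam (delta m \<kappa> (\<nu> ` B)) \<theta> A B k M \<and>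
               delta m \<kappa> (\<nu> ` B) < arrangement_threshold lam \<longrightarrow>
           linearly_arranged \<kappa> \<nu> lam (phi1 lam (delta m \<kappa> (\<nu> ` B))) (translate k \<theta>) M))"
proof -
  interpret majority_kuramoto lam N m \<kappa> \<nu> \<theta>0 \<omega>0 \<theta> \<omega> A
    using assms(1-6,8,9) by unfold_locales auto
  define V where "V = diameter (\<nu> ` A)"
  define W where "W = diameter (\<omega>0 ` A)"
  have V: "diffs_le \<nu> A V" and W: "diffs_le \<omega>0 A W"
    unfolding V_def W_def using A_finite by (rule diffs_le_diameter)+
  have V0: "0 \<le> V" "0 \<le> W" using A_nonempty diffs_le_nonneg V W by auto
  have l: "0 < l" "l < cutoff"
    using assms(5,7) by (auto simp: cutoff_def diff_divide_distrib)
  have f_l: "f_lam lam l = 2 * (lam / 2 * sin l - (1 - lam) * sin (l / 2))"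
    by (simp add: f_lam_def algebra_simps)
  have lag: "2 * lag_bound m \<kappa> V W \<eta> < f_lam lam l"
    using assms(11) unfolding f_l xi_eq_lag_bound V_def W_def by simp
  have lev: "0 < level m \<kappa> V" "level m \<kappa> V < f_lam lam l"
    using level_pos[OF V0(1)] level_le_lag_bound[OF assms(10) V0(2), of V] lag by auto
  have start: "spread_le \<theta> A l t1"
    using assms(13) diameter_le_iff_spread_le[OF A_finite A_nonempty] by blast
  have stays: "spread_le \<theta> A l t" if "t1 \<le> t" for t
    using V W l lag assms(10,12) start that by (rule cluster_stays)
  have asym: "asymptotic_spread_le \<theta> A (phi1 lam (level m \<kappa> V))"
    using V W l lag assms(10,12) start by (rule cluster_contracts)
  have overdamped: "4 * m * \<kappa> < 1" if "level m \<kappa> V' < arrangement_threshold lam" "0 \<le> V'" for V'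
  proof -
    have "4 * m * \<kappa> \<le> level m \<kappa> V'" using that m_pos \<kappa>_pos by (simp add: level_def)
    thus ?thesis using that arrangement_threshold_le_1 by simp
  qed
  have 1: "(SUP t\<in>{t1..}. ereal (diameter ((\<lambda>i. \<theta> i t) ` A))) \<le> ereal l"
    using stays diameter_le_iff_spread_le[OF A_finite A_nonempty] by (intro SUP_least) auto
  have 2: "Limsup at_top (\<lambda>t. ereal (diameter ((\<lambda>i. \<theta> i t) ` A))) \<le> ereal (phi1 lam (level m \<kappa> V))"
    unfolding Limsup_diameter_le_iff[OF A_finite A_nonempty] by (rule asym)
  have 3: "phi1 lam (level m \<kappa> V) < 3 * pi / (4 * (2 * lam - 1)) * level m \<kappa> V"
    using l lev by (rule phi1_linear_bound)
  have 4: "linearly_arranged \<kappa> \<nu> lam (phi1 lam (level m \<kappa> V)) \<theta> A" if "level m \<kappa> V < arrangement_threshold lam"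
    using overdamped[OF that V0(1)] phi_props(1)[OF l lev] phi1_below_threshold[OF lev(1) that] asym
    by (rule linear_arrangement)
  let ?confines = "\<lambda>B. ((SUP t\<in>{0..}. ereal (diameter ((\<lambda>i. \<theta> i t) ` B))) < \<infinity> \<and>
         (B = {1..N} \<longrightarrow> phase_locking N \<theta>)) \<and>
        (\<exists>!M. \<exists>k. maximal_majority_cluster lam (delta m \<kappa> (\<nu> ` B)) \<theta> A B k M) \<and>
        (\<forall>M k. maximal_majority_cluster lam (delta m \<kappa> (\<nu> ` B)) \<theta> A B k M \<and>
               delta m \<kappa> (\<nu> ` B) < arrangement_threshold lam \<longrightarrow>
           linearly_arranged \<kappa> \<nu> lam (phi1 lam (delta m \<kappa> (\<nu> ` B))) (translate k \<theta>) M)"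
  have B: "?confines B"
    if hB: "A \<subseteq> B" "B \<subseteq> {1..N}" "m * diameter (\<nu> ` B) + 2 * m * \<kappa> + diameter (\<nu> ` B) / (2 * \<kappa>)
            < lam / 2 * sin l - (1 - lam) * sin (l / 2)" for B
  proof -
    have finB: "finite B" "B \<noteq> {}" using hB A_nonempty by (auto intro: finite_subset)
    have "level m \<kappa> (diameter (\<nu> ` B)) = 2 * (m * diameter (\<nu> ` B) + 2 * m * \<kappa> + diameter (\<nu> ` B) / (2 * \<kappa>))"
      by (simp add: level_def algebra_simps)
    hence levB: "level m \<kappa> (diameter (\<nu> ` B)) < f_lam lam l" using hB(3) f_l by simp
    interpret C: majority_confinement lam N m \<kappa> \<nu> \<theta>0 \<omega>0 \<theta> \<omega> A B "diameter (\<nu> ` B)" l t1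
      using hB l levB stays finB by unfold_locales (auto intro: diffs_le_diameter)
    let ?mmc = "maximal_majority_cluster lam (level m \<kappa> (diameter (\<nu> ` B))) \<theta> A B"
    have bounded: "(SUP t\<in>{0..}. ereal (diameter ((\<lambda>i. \<theta> i t) ` B))) < \<infinity>"
    proof -
      obtain M where M: "\<And>i j t. i \<in> B \<Longrightarrow> j \<in> B \<Longrightarrow> 0 \<le> t \<Longrightarrow> \<bar>\<theta> i t - \<theta> j t\<bar> \<le> M"
        using C.phase_diffs_bounded by blast
      have "(SUP t\<in>{0..}. ereal (diameter ((\<lambda>i. \<theta> i t) ` B))) \<le> ereal M"
      proof (intro SUP_least)
        fix t :: real assume "t \<in> {0..}"
        hence "spread_le \<theta> B M t" using M unfolding spread_le_def by (auto simp: abs_le_iff)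
        thus "ereal (diameter ((\<lambda>i. \<theta> i t) ` B)) \<le> ereal M"
          using diameter_le_iff_spread_le[OF finB] by simp
      qed
      thus ?thesis by (rule le_less_trans) simp
    qed
    have arranged: "linearly_arranged \<kappa> \<nu> lam (C.\<phi>\<^sub>1) (translate k \<theta>) M"
      if mmc: "?mmc k M"
        and thr: "level m \<kappa> (diameter (\<nu> ` B)) < arrangement_threshold lam" for k M
    proof -
      have M: "A \<subseteq> M" "M \<subseteq> B" using mmc by (auto simp: maximal_majority_cluster_def)
      have finM: "finite M" "M \<noteq> {}" using M finB A_nonempty by (auto intro: finite_subset)
      interpret K: majority_kuramoto lam N m \<kappa> \<nu> "\<lambda>i. \<theta>0 i - 2 * of_int (k i) * pi" \<omega>0 "translate k \<theta>" \<omega> M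
        using M hB by (intro translated_cluster) auto
      have "asymptotic_spread_le (translate k \<theta>) M (C.\<phi>\<^sub>1)"
        using mmc unfolding maximal_majority_cluster_def Limsup_diameter_le_iff[OF finM] by blast
      thus ?thesis
        using overdamped[OF thr C.V_nonneg] C.phi_facts(1)
          phi1_below_threshold[OF level_pos[OF C.V_nonneg] thr]
        by (intro K.linear_arrangement)
    qed
    have unique: "\<exists>!M. \<exists>k. ?mmc k M"
    proof (rule ex1I)
      show "\<exists>k. ?mmc k C.A_max"
        by (rule exI, rule C.maximal_majority_cluster_A_max)
      show "M = C.A_max" if "\<exists>k. ?mmc k M" for M
        using that by (elim exE) (rule C.maximal_majority_cluster_unique)
    qed
    show ?thesis
      unfolding delta_eq_level
    proof (intro conjI allI impI)
      show "phase_locking N \<theta>" if "B = {1..N}"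
        using that by (rule C.phase_locking_of_whole_population)
      show "linearly_arranged \<kappa> \<nu> lam (C.\<phi>\<^sub>1) (translate k \<theta>) M"
        if "?mmc k M \<and>
          level m \<kappa> (diameter (\<nu> ` B)) < arrangement_threshold lam" for k M
        using that by (elim conjE) (rule arranged)
    qed (rule bounded unique)+
  qed
  show ?thesis
  proof (intro conjI)
    show "\<forall>B. A \<subseteq> B \<and> B \<subseteq> {1..N} \<and> m * diameter (\<nu> ` B) + 2 * m * \<kappa> + diameter (\<nu> ` B) / (2 * \<kappa>)
        < lam / 2 * sin l - (1 - lam) * sin (l / 2) \<longrightarrow> ?confines B"
      by (intro allI impI, elim conjE) (rule B)
  qed (use 1 2 3 4 in \<open>simp_all add: delta_eq_level V_def\<close>)
qed

end
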